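(* Let $q$ be a prime power with $4\mid q-1$ and let $\lambda\in\mathbb{F}_q^\times$ with $\lambda^4\neq1$. Let $P_r(x_1,x_2)\in\mathbb{Z}[x_1,x_2]$ be the unique polynomial satisfying $P_r(\alpha+\beta,\alpha\beta)=\alpha^r+\beta^r$. Let $w=(m,m,m,m)$ with $m\in\{1,2,3\}$. Then for any $r\ge1$, $$F^w_{r,\rm red}(\lambda)=\Big(\frac{\varphi_2(1-\lambda^4)\,q}{j(\varphi_4^w)}\Big)^r+P_r\Big(F^w_{1,\rm red}(\lambda)-\frac{\varphi_2(1-\lambda^4)\,q}{j(\varphi_4^w)},\ \Big(\frac{q}{j(\varphi_4^w)}\Big)^2\Big).$$
   Context: For a finite field $k$ with $Q$ elements let $\widehat{k^\times}=\mathrm{Hom}(k^\times,\overline{\mathbb{Q}}^\times)$, with trivial character $\varepsilon$; put $\eta(0)=0$ for every $\eta$ (including $\varepsilon$), and $\delta(\eta)=1$ if $\eta=\varepsilon$, $0$ otherwise. Fix a nontrivial additive character $\psi$ of $k$ and put $g(\eta)=-\sum_{x\in k^\times}\eta(x)\psi(x)$, $g^\circ(\eta)=Q^{\delta(\eta)}g(\eta)$, $(\alpha)_\nu=g(\alpha\nu)/g(\alpha)$, $(\alpha)_\nu^\circ=g^\circ(\alpha\nu)/g^\circ(\alpha)$, and $$F(\alpha_1,\dots,\alpha_s;\beta_1,\dots,\beta_s;z)_Q=\frac{1}{1-Q}\sum_{\nu\in\widehat{k^\times}}\frac{(\alpha_1)_\nu\cdots(\alpha_s)_\nu}{(\beta_1)^\circ_\nu\cdots(\beta_s)^\circ_\nu}\,\nu(z)$$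 (independent of $\psi$). $F_{\rm red}(\alpha_1,\dots;\beta_1,\dots;z)_Q$ denotes the value of $F$ after cancelling (with multiplicity) all parameters common to the lists $(\alpha_i)$ and $(\beta_i)$, until the remaining lists are disjoint. Jacobi sum over $\mathbb{F}_q$: $j(\eta_1,\dots,\eta_n)=(-1)^{n-1}\sum_{x_i\in\mathbb{F}_q^\times,\ x_1+\cdots+x_n=1}\eta_1(x_1)\cdots\eta_n(x_n)$. Fix a generator $\varphi$ of $\widehat{\mathbb{F}_q^\times}$, put $\varphi_s=\varphi^{(q-1)/s}$ for $s\mid q-1$, and $j(\varphi_4^w)=j(\varphi_4^m,\varphi_4^m,\varphi_4^m,\varphi_4^m)$. For $\eta\in\widehat{\mathbb{F}_q^\times}$, $\widetilde\eta=\eta\circ\mathrm{N}_{\mathbb{F}_{q^r}/\mathbb{F}_q}$, and $$F^{w}_{r,\rm red}(\lambda)=F_{\rm red}\big(\widetilde{\varphi}_4^{\,m},\widetilde{\varphi}_4^{\,m},\widetilde{\varphi}_4^{\,m},\widetilde{\varphi}_4^{\,m};\ \widetilde{\varepsilon},\widetilde{\varphi}_4,\widetilde{\varphi}_4^{\,2},\widetilde{\varphi}_4^{\,3};\ \lambda^4\big)_{q^r}.$$ *)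

theory Defs
  imports
    "HOL-Computational_Algebra.Computational_Algebra"
    "HOL-Library.Cardinality"
begin

text \<open>
  A finite field is a type of sort \<open>{finite, field}\<close>; it has \<open>CARD('k)\<close> elements.
  Characters take values in \<open>complex\<close>. Their nonzero values are roots of unity, so these are
  the characters with algebraic values, the algebraic closure of the rationals being embedded
  in the complex numbers.
  A multiplicative character is represented by its extension by \<open>0\<close> to the whole field;
  this is also done for the trivial character.
\<close>

definition mult_chars :: "('k::{finite,field} \<Rightarrow> complex) set" where
  "mult_chars = {\<eta>. \<eta> 0 = 0 \<and> \<eta> 1 = 1 \<and> (\<forall>x y. \<eta> (x * y) = \<eta> x * \<eta> y)}"

definition triv_char :: "'k::{finite,field} \<Rightarrow> complex" where
  "triv_char x = (if x = 0 then 0 else 1)"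

definition char_mult :: "('k::{finite,field} \<Rightarrow> complex) \<Rightarrow> ('k \<Rightarrow> complex) \<Rightarrow> 'k \<Rightarrow> complex" where
  "char_mult \<alpha> \<nu> x = \<alpha> x * \<nu> x"

text \<open>The case distinction matters for \<open>n = 0\<close>, where \<open>\<eta> 0 ^ 0 = 1\<close>.\<close>

definition char_pow :: "('k::{finite,field} \<Rightarrow> complex) \<Rightarrow> nat \<Rightarrow> 'k \<Rightarrow> complex" where
  "char_pow \<eta> n x = (if x = 0 then 0 else \<eta> x ^ n)"

definition char_generator :: "('k::{finite,field} \<Rightarrow> complex) \<Rightarrow> bool" where
  "char_generator \<phi> \<longleftrightarrow> \<phi> \<in> mult_chars \<and> (\<forall>\<eta>\<in>mult_chars. \<exists>n. \<eta> = char_pow \<phi> n)"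

text \<open>\<open>\<phi>\<^sub>s\<close>, the power of a generator \<open>\<phi>\<close> that has order \<open>s\<close>; meant for \<open>s\<close> dividing \<open>q - 1\<close>.\<close>

definition char_of_order :: "('k::{finite,field} \<Rightarrow> complex) \<Rightarrow> nat \<Rightarrow> 'k \<Rightarrow> complex" where
  "char_of_order \<phi> s = char_pow \<phi> ((CARD('k) - 1) div s)"

definition nontrivial_add_char :: "('k::{finite,field} \<Rightarrow> complex) \<Rightarrow> bool" where
  "nontrivial_add_char \<psi> \<longleftrightarrow>
     \<psi> 0 = 1 \<and> (\<forall>x y. \<psi> (x + y) = \<psi> x * \<psi> y) \<and> (\<exists>x. \<psi> x \<noteq> 1)"

definition gauss_sum :: "('k::{finite,field} \<Rightarrow> complex) \<Rightarrow> ('k \<Rightarrow> complex) \<Rightarrow> complex" where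
  "gauss_sum \<psi> \<eta> = - (\<Sum>x\<in>UNIV - {0}. \<eta> x * \<psi> x)"

definition gauss_sum_circ :: "('k::{finite,field} \<Rightarrow> complex) \<Rightarrow> ('k \<Rightarrow> complex) \<Rightarrow> complex" where
  "gauss_sum_circ \<psi> \<eta> =
     of_nat CARD('k) ^ (if \<eta> = triv_char then 1 else 0) * gauss_sum \<psi> \<eta>"

definition poch :: "('k::{finite,field} \<Rightarrow> complex) \<Rightarrow> ('k \<Rightarrow> complex) \<Rightarrow> ('k \<Rightarrow> complex) \<Rightarrow> complex" where
  "poch \<psi> \<alpha> \<nu> = gauss_sum \<psi> (char_mult \<alpha> \<nu>) / gauss_sum \<psi> \<alpha>"

definition poch_circ :: "('k::{finite,field} \<Rightarrow> complex) \<Rightarrow> ('k \<Rightarrow> complex) \<Rightarrow> ('k \<Rightarrow> complex) \<Rightarrow> complex" where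
  "poch_circ \<psi> \<alpha> \<nu> = gauss_sum_circ \<psi> (char_mult \<alpha> \<nu>) / gauss_sum_circ \<psi> \<alpha>"

text \<open>
  The hypergeometric function does not depend on the order of the upper parameters or of the
  lower parameters, so both lists are given as multisets. On multisets, \<open>A - B\<close> and \<open>B - A\<close>
  are the parameters left over when all common ones are cancelled with multiplicity.
\<close>

definition hyp_F ::
  "('k::{finite,field} \<Rightarrow> complex) \<Rightarrow> ('k \<Rightarrow> complex) multiset \<Rightarrow> ('k \<Rightarrow> complex) multiset \<Rightarrow> 'k \<Rightarrow> complex"
  where
  "hyp_F \<psi> A B z =
     1 / (1 - of_nat CARD('k)) *
     (\<Sum>\<nu>\<in>mult_chars. (\<Prod>\<alpha>\<in>#A. poch \<psi> \<alpha> \<nu>) / (\<Prod>\<beta>\<in>#B. poch_circ \<psi> \<beta> \<nu>) * \<nu> z)"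

definition hyp_F_red ::
  "('k::{finite,field} \<Rightarrow> complex) \<Rightarrow> ('k \<Rightarrow> complex) multiset \<Rightarrow> ('k \<Rightarrow> complex) multiset \<Rightarrow> 'k \<Rightarrow> complex"
  where
  "hyp_F_red \<psi> A B z = hyp_F \<psi> (A - B) (B - A) z"

definition jacobi_sum :: "('k::{finite,field} \<Rightarrow> complex) list \<Rightarrow> complex" where
  "jacobi_sum \<eta>s =
     (-1) ^ (length \<eta>s - 1) *
     (\<Sum>xs | length xs = length \<eta>s \<and> 0 \<notin> set xs \<and> sum_list xs = 1.
        \<Prod>i<length \<eta>s. (\<eta>s ! i) (xs ! i))"

definition field_embedding :: "('k::field \<Rightarrow> 'l::field) \<Rightarrow> bool" where
  "field_embedding \<iota> \<longleftrightarrow>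
     \<iota> 1 = 1 \<and> (\<forall>x y. \<iota> (x + y) = \<iota> x + \<iota> y) \<and> (\<forall>x y. \<iota> (x * y) = \<iota> x * \<iota> y)"

text \<open>
  The norm of an extension \<open>\<iota> : 'k \<rightarrow> 'l\<close> of finite fields of degree \<open>r\<close>: the product of the
  conjugates \<open>x ^ (q ^ i)\<close>, \<open>i < r\<close>, with \<open>q = CARD('k)\<close>, which lies in the image of \<open>\<iota>\<close>,
  pulled back along the injection \<open>\<iota>\<close>.
\<close>

definition ext_norm :: "('k::{finite,field} \<Rightarrow> 'l::{finite,field}) \<Rightarrow> nat \<Rightarrow> 'l \<Rightarrow> 'k" where
  "ext_norm \<iota> r x = inv \<iota> (\<Prod>i<r. x ^ (CARD('k) ^ i))"

definition char_lift ::
  "('k::{finite,field} \<Rightarrow> 'l::{finite,field}) \<Rightarrow> nat \<Rightarrow> ('k \<Rightarrow> complex) \<Rightarrow> 'l \<Rightarrow> complex" where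
  "char_lift \<iota> r \<eta> = \<eta> \<circ> ext_norm \<iota> r"

text \<open>
  The reduced hypergeometric sum with index \<open>w = (m, m, m, m)\<close> at \<open>lam ^ 4\<close>, where \<open>\<iota>\<close> embeds the base field in its extension of
  degree \<open>r\<close> and \<open>\<psi>\<close> is an additive character of the extension.
\<close>

definition F_w_red ::
  "('k::{finite,field} \<Rightarrow> 'l::{finite,field}) \<Rightarrow> nat \<Rightarrow> ('l \<Rightarrow> complex) \<Rightarrow> ('k \<Rightarrow> complex) \<Rightarrow> nat \<Rightarrow> 'k \<Rightarrow> complex"
  where
  "F_w_red \<iota> r \<psi> \<phi> m lam =
     (let \<phi>4 = char_lift \<iota> r (char_of_order \<phi> 4) in
      hyp_F_red \<psi>
        {# char_pow \<phi>4 m, char_pow \<phi>4 m, char_pow \<phi>4 m, char_pow \<phi>4 m #}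
        {# char_lift \<iota> r triv_char, \<phi>4, char_pow \<phi>4 2, char_pow \<phi>4 3 #}
        (\<iota> (lam ^ 4)))"

definition jacobi_w :: "('k::{finite,field} \<Rightarrow> complex) \<Rightarrow> nat \<Rightarrow> complex" where
  "jacobi_w \<phi> m =
     (let \<chi> = char_pow (char_of_order \<phi> 4) m in jacobi_sum [\<chi>, \<chi>, \<chi>, \<chi>])"

text \<open>
  \<open>\<int>[x\<^sub>1, x\<^sub>2]\<close> is \<open>int poly poly\<close>: polynomials in \<open>x\<^sub>2\<close> with coefficients in \<open>\<int>[x\<^sub>1]\<close>.
\<close>

definition eval2 :: "int poly poly \<Rightarrow> complex \<Rightarrow> complex \<Rightarrow> complex" where
  "eval2 P x1 x2 = poly (map_poly (\<lambda>c. poly (map_poly of_int c) x1) P) x2"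

definition power_sum_poly :: "nat \<Rightarrow> int poly poly" where
  "power_sum_poly r = (THE P. \<forall>\<alpha> \<beta>. eval2 P (\<alpha> + \<beta>) (\<alpha> * \<beta>) = \<alpha> ^ r + \<beta> ^ r)"

lemma eval1_diff:
  "poly (map_poly of_int (c - d :: int poly)) (x::complex) =
   poly (map_poly of_int c) x - poly (map_poly of_int d) x"
proof -
  have "map_poly of_int (c - d) = map_poly of_int c - (map_poly of_int d :: complex poly)"
    by (rule poly_eqI) (simp add: coeff_map_poly)
  thus ?thesis by simp
qed

lemma eval2_diff: "eval2 (P - Q) x y = eval2 P x y - eval2 Q x y"
proof -
  let ?f = "\<lambda>c. poly (map_poly of_int c) x :: complex"
  have "map_poly ?f (P - Q) = map_poly ?f P - map_poly ?f Q"
    by (rule poly_eqI) (simp add: coeff_map_poly eval1_diff)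
  thus ?thesis by (simp add: eval2_def)
qed

lemma eval2_x1: "eval2 (smult [:0, 1:] P) x y = x * eval2 P x y"
proof -
  let ?f = "\<lambda>c. poly (map_poly of_int c) x :: complex"
  have f: "?f ([:0, 1:] * c) = x * ?f c" for c
    by (simp add: map_poly_pCons)
  have "map_poly ?f (smult [:0, 1:] P) = smult x (map_poly ?f P)"
    by (rule poly_eqI) (simp only: coeff_map_poly coeff_smult f map_poly_0 poly_0)
  thus ?thesis by (simp add: eval2_def)
qed

lemma eval2_x2: "eval2 (pCons 0 P) x y = y * eval2 P x y"
  by (simp add: eval2_def map_poly_pCons)

lemma eval2_eq_0D:
  assumes "\<And>x y. eval2 P x y = 0"
  shows "P = 0"
proof (rule poly_eqI)
  fix i
  have "poly (map_poly of_int (coeff P i)) x = (0::complex)" for x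
  proof -
    let ?f = "\<lambda>c. poly (map_poly of_int c) x :: complex"
    have "map_poly ?f P = 0"
      using assms[of x] unfolding eval2_def by (metis poly_all_0_iff_0)
    hence "coeff (map_poly ?f P) i = 0" by simp
    thus ?thesis by (simp add: coeff_map_poly)
  qed
  hence "map_poly of_int (coeff P i) = (0 :: complex poly)"
    by (metis poly_all_0_iff_0)
  hence "coeff (map_poly of_int (coeff P i)) j = (0::complex)" for j by simp
  thus "coeff P i = coeff 0 i" by (intro poly_eqI) (simp add: coeff_map_poly)
qed

lemma power_sum_poly_ex1:
  "\<exists>!P. \<forall>\<alpha> \<beta>. eval2 P (\<alpha> + \<beta>) (\<alpha> * \<beta>) = \<alpha> ^ r + \<beta> ^ r"
proof (rule ex_ex1I)
  show "\<exists>P. \<forall>\<alpha> \<beta>. eval2 P (\<alpha> + \<beta>) (\<alpha> * \<beta>) = \<alpha> ^ r + \<beta> ^ r"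
  proof (induction r rule: less_induct)
    case (less r)
    consider "r = 0" | "r = 1" | s where "r = Suc (Suc s)"
      by (metis One_nat_def not0_implies_Suc)
    thus ?case
    proof cases
      case 1
      thus ?thesis by (intro exI[of _ "[:[:2:]:]"]) (simp add: eval2_def map_poly_pCons)
    next
      case 2
      thus ?thesis by (intro exI[of _ "[:[:0, 1:]:]"]) (simp add: eval2_def map_poly_pCons)
    next
      case (3 s)
      obtain P where P: "\<And>\<alpha> \<beta>. eval2 P (\<alpha> + \<beta>) (\<alpha> * \<beta>) = \<alpha> ^ Suc s + \<beta> ^ Suc s"
        using less[of "Suc s"] 3 by auto
      obtain Q where Q: "\<And>\<alpha> \<beta>. eval2 Q (\<alpha> + \<beta>) (\<alpha> * \<beta>) = \<alpha> ^ s + \<beta> ^ s"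
        using less[of s] 3 by auto
      show ?thesis
        by (rule exI[of _ "smult [:0, 1:] P - pCons 0 Q"])
          (simp only: 3 eval2_diff eval2_x1 eval2_x2 P Q, simp add: algebra_simps)
    qed
  qed
next
  fix P Q :: "int poly poly"
  assume P: "\<forall>\<alpha> \<beta>. eval2 P (\<alpha> + \<beta>) (\<alpha> * \<beta>) = \<alpha> ^ r + \<beta> ^ r"
    and Q: "\<forall>\<alpha> \<beta>. eval2 Q (\<alpha> + \<beta>) (\<alpha> * \<beta>) = \<alpha> ^ r + \<beta> ^ r"
  have "eval2 (P - Q) x y = 0" for x y
  proof -
    define d where "d = csqrt (x ^ 2 - 4 * y)"
    define \<alpha> where "\<alpha> = (x + d) / 2"
    define \<beta> where "\<beta> = (x - d) / 2"
    have "d ^ 2 = x ^ 2 - 4 * y" by (simp add: d_def)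
    hence "\<alpha> * \<beta> = y" by (simp add: \<alpha>_def \<beta>_def field_simps power2_eq_square)
    moreover have "\<alpha> + \<beta> = x" by (simp add: \<alpha>_def \<beta>_def field_simps)
    ultimately show ?thesis using P Q by (metis eval2_diff cancel_comm_monoid_add_class.diff_cancel)
  qed
  hence "P - Q = 0" by (rule eval2_eq_0D)
  thus "P = Q" by simp
qed

end

theory Submission imports Defs "HOL-Algebra.Algebraic_Closure_Type"
begin

text \<open>
  Write \<open>Q\<close> for the number of elements of the field under consideration, \<open>\<chi>\<close> for its quadratic
  character and \<open>t = 1 / \<lambda>\<^sup>4\<close>. The reason for the theorem is that the hypergeometric sum counts
  points on a K3 surface whose relevant cohomology has rank three: one class, on which Frobenius
  acts by \<open>\<chi> (1 - t) Q\<close>, and the other two Frobenius eigenvalues have product \<open>Q\<^sup>2\<close>. Everything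
  below is an elementary computation with character sums that makes this explicit.

  From characters to points. The substitution \<open>\<nu> \<mapsto> \<phi>\<^sub>4\<^sup>-\<^sup>m \<nu>\<close> in the defining sum removes the
  dependence on \<open>m\<close>, except for the constant \<open>g(\<phi>\<^sub>4\<^sup>m)\<^sup>4 = Q j(\<phi>\<^sub>4\<^sup>w)\<close>. The duplication formula for
  Gauss sums and orthogonality of characters then turn the sum into \<open>Q K(t) / g(\<phi>\<^sub>4\<^sup>m)\<^sup>4\<close>, where
  \<open>K(t)\<close> is the sum of \<open>\<chi> ((x - 1) v (v - t) (v - x\<^sup>2))\<close> over all \<open>x\<close> and \<open>v\<close>
  (\<open>hyp_F_eq_k3_sum\<close>). By the relation of Hasse and Davenport (\<open>jac_lift\<close>) the Jacobi sum over
  the extension is the \<open>r\<close>-th power of the one over the base field. It remains to find \<open>a\<close> and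
  \<open>b\<close> with \<open>a b = 1\<close> such that \<open>K(t) = q (\<kappa> + a + b)\<close> over the base field and
  \<open>K(t) = q\<^sup>r (\<kappa>\<^sup>r + a\<^sup>r + b\<^sup>r)\<close> over the extension, where \<open>\<kappa> = \<chi> (1 - t)\<close> is computed in the base
  field (\<open>k3_sum_eigenvalues\<close>); then \<open>P\<^sub>r\<close> evaluated at \<open>c a + c b\<close> and \<open>(c a) (c b)\<close>, with
  \<open>c = q / j(\<phi>\<^sub>4\<^sup>w)\<close>, is the stated one.

  From the K3 surface to elliptic curves. A 2-isogeny in the fibres over \<open>x\<close> relates \<open>K(t)\<close> to a
  sum over pairs of points on the conic \<open>x\<^sup>2 - t = D y\<^sup>2\<close>, where \<open>D = 1 - t\<close>
  (\<open>conic_pair_sum_eq\<close>). This conic is parametrised by the elements of the quadratic algebra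
  \<open>F[s]\<close> with \<open>s\<^sup>2 = D\<close>, and the sum becomes one over \<open>\<zeta>\<close> in \<open>F[s]\<close> of \<open>\<chi>\<close> at the norm of
  \<open>\<zeta> (2 \<zeta>\<^sup>2 - 4 \<zeta> + 1 - s)\<close> (\<open>norm_sum_eq_conic_pair_sum\<close>). If \<open>s\<close> lies in \<open>F\<close>, then \<open>F[s]\<close> is
  \<open>F \<times> F\<close> and the sum is the product of the sums of \<open>\<chi>\<close> at \<open>z (z\<^sup>2 - 2 z + (1 - s) / 2)\<close> and at
  its conjugate. The two elliptic curves are 2-isogenous up to a quadratic twist, so that
  \<open>K(t) = S\<^sup>2 - Q\<close> for the first of the sums, \<open>S\<close> (\<open>k3_sum_split\<close>). If \<open>s\<close> does not lie in \<open>F\<close>,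
  then \<open>F[s]\<close> is the field with \<open>Q\<^sup>2\<close> elements and \<open>K(t) = - \<chi>(2) S - Q\<close> for the sum \<open>S\<close> over
  that field (\<open>k3_sum_nonsplit\<close>).

  Variation with \<open>r\<close>. The sums attached to an elliptic curve over \<open>F\<^sub>q\<close> are \<open>- (\<alpha>\<^sup>r + \<beta>\<^sup>r)\<close> over
  the extension of degree \<open>r\<close>, with \<open>\<alpha> \<beta> = q\<close> (\<open>cubic_point_sum\<close>). This follows from the fact
  that the L-function is a polynomial of degree two, by Newton's identities for its coefficients
  (\<open>Lcoeff_recursion\<close>). Inserting it in the formulas for \<open>K(t)\<close>, over \<open>F\<^sub>q\<close> if \<open>1 - t\<close> is a
  square there and over the field with \<open>q\<^sup>2\<close> elements otherwise, gives \<open>a\<close> and \<open>b\<close>.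
\<close>

hide_const (open) Coset.order Divisibility.prime module.smult
  Polynomials.degree Polynomials.lead_coeff up_ring.coeff up_ring.monom

section \<open>The quadratic character of a finite subfield\<close>

text \<open>
  Euler's criterion is used as the definition because it refers to the number \<open>Q\<close> and not to the
  carrier: the same term then makes sense for a finite field, for its image in a larger field
  and for every finite subfield of an algebraically closed field.
\<close>

definition quad_char :: "nat \<Rightarrow> 'a::field \<Rightarrow> complex" where
  "quad_char Q x = (if x = 0 then 0 else if x ^ ((Q - 1) div 2) = 1 then 1 else -1)"

lemma quad_char_0 [simp]: "quad_char Q 0 = 0"
  by (simp add: quad_char_def)

lemma quad_char_1 [simp]: "quad_char Q 1 = 1"
  by (simp add: quad_char_def)

lemma quad_char_self_mult: "x \<noteq> 0 \<Longrightarrow> quad_char Q x * quad_char Q x = 1"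
  by (simp add: quad_char_def)

lemma card_power_eq_le:
  fixes c :: "'a::field"
  assumes "n > 0"
  shows "finite {x. x ^ n = c}" "card {x. x ^ n = c} \<le> n"
proof -
  define p where "p = monom 1 n - [:c:]"
  have deg: "degree p \<le> n" unfolding p_def
    by (rule degree_diff_le) (use assms in \<open>auto simp: degree_monom_eq\<close>)
  have "coeff p n = 1" using assms by (cases n) (auto simp: p_def)
  hence "p \<noteq> 0" by auto
  moreover have "{x. x ^ n = c} = {x. poly p x = 0}"
    by (auto simp: p_def poly_monom)
  ultimately show "finite {x. x ^ n = c}" "card {x. x ^ n = c} \<le> n"
    using card_poly_roots_bound[of p] deg poly_roots_finite[of p] by auto
qed

lemma sum_fibers:
  fixes f :: "'b \<Rightarrow> complex"
  assumes "finite A" "finite B" "\<And>x. x \<in> A \<Longrightarrow> h x \<in> B"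
  shows "(\<Sum>x\<in>A. f (h x)) = (\<Sum>y\<in>B. of_nat (card {x\<in>A. h x = y}) * f y)"
proof -
  have "(\<Sum>x\<in>A. f (h x)) = (\<Sum>y\<in>B. \<Sum>x\<in>{x\<in>A. h x = y}. f (h x))"
    by (rule sum.group[symmetric]) (use assms in auto)
  also have "\<dots> = (\<Sum>y\<in>B. of_nat (card {x\<in>A. h x = y}) * f y)"
    by (intro sum.cong refl) simp
  finally show ?thesis .
qed

text \<open>
  The instances are the universe of a finite type, its image under an embedding, and the field
  of fixed points of a power of Frobenius in an algebraically closed field.
\<close>

locale finite_subfield =
  fixes F :: "'a::field set" and Q :: nat
  assumes finite_F: "finite F" and card_F: "card F = Q"
    and zero_in [simp]: "0 \<in> F" and one_in [simp]: "1 \<in> F"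
    and add_in: "x \<in> F \<Longrightarrow> y \<in> F \<Longrightarrow> x + y \<in> F"
    and mult_in: "x \<in> F \<Longrightarrow> y \<in> F \<Longrightarrow> x * y \<in> F"
    and uminus_in: "x \<in> F \<Longrightarrow> - x \<in> F"
    and inverse_in: "x \<in> F \<Longrightarrow> inverse x \<in> F"
begin

lemma diff_in: "x \<in> F \<Longrightarrow> y \<in> F \<Longrightarrow> x - y \<in> F"
  using add_in[of x "- y"] uminus_in[of y] by simp

lemma divide_in: "x \<in> F \<Longrightarrow> y \<in> F \<Longrightarrow> x / y \<in> F"
  using mult_in[of x "inverse y"] inverse_in[of y] by (simp add: divide_inverse)

lemma power_in: "x \<in> F \<Longrightarrow> x ^ n \<in> F"
  by (induction n) (auto intro: mult_in)

lemma of_nat_in: "of_nat n \<in> F"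
  by (induction n) (auto intro: add_in)

lemma numeral_in: "numeral n \<in> F"
  using of_nat_in[of "numeral n"] by simp

lemmas closed_in = add_in mult_in uminus_in inverse_in diff_in divide_in power_in numeral_in

lemma Q_ge_2: "Q \<ge> 2"
proof -
  have "card {0, 1::'a} \<le> card F" using finite_F by (intro card_mono) auto
  thus ?thesis using card_F by simp
qed

lemma power_card_minus_1:
  assumes "x \<in> F" "x \<noteq> 0"
  shows "x ^ (Q - 1) = 1"
proof -
  define P where "P = (\<Prod>y\<in>F - {0}. y)"
  have "(\<Prod>y\<in>F - {0}. x * y) = P" unfolding P_def
    by (rule prod.reindex_bij_witness[of _ "\<lambda>y. y / x" "\<lambda>y. x * y"])
       (use assms in \<open>auto intro: closed_in\<close>)
  moreover have "(\<Prod>y\<in>F - {0}. x * y) = x ^ (Q - 1) * P"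
    using finite_F card_F by (simp add: prod.distrib P_def card_Diff_singleton)
  moreover have "P \<noteq> 0" using finite_F by (auto simp: P_def)
  ultimately show ?thesis by simp
qed

lemma power_card:
  assumes "x \<in> F"
  shows "x ^ Q = x"
proof (cases "x = 0")
  case False
  have "x ^ Q = x ^ Suc (Q - 1)" using Q_ge_2 by simp
  thus ?thesis using power_card_minus_1[OF assms False] by simp
qed (use Q_ge_2 in auto)

lemma F_eq_fixed: "F = {x. x ^ Q = x}"
proof (rule card_subset_eq)
  define p :: "'a poly" where "p = monom 1 Q - [:0, 1:]"
  have deg: "degree p \<le> Q" unfolding p_def
    by (rule degree_diff_le) (use Q_ge_2 in \<open>auto simp: degree_monom_eq\<close>)
  have "coeff p Q = 1" using Q_ge_2
    by (auto simp: p_def coeff_pCons split: nat.split)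
  hence "p \<noteq> 0" by auto
  moreover have *: "{x. x ^ Q = x} = {x. poly p x = 0}"
    by (auto simp: p_def poly_monom)
  ultimately have fin: "finite {x::'a. x ^ Q = x}" and le: "card {x::'a. x ^ Q = x} \<le> Q"
    using card_poly_roots_bound[of p] deg poly_roots_finite[of p] by auto
  show "finite {x::'a. x ^ Q = x}" by fact
  show "F \<subseteq> {x. x ^ Q = x}" using power_card by auto
  thus "card F = card {x::'a. x ^ Q = x}" using card_mono[OF fin, of F] le card_F by simp
qed

end

locale odd_finite_subfield = finite_subfield +
  assumes odd_Q: "odd Q"
begin

lemma half_pow:
  assumes "x \<in> F" "x \<noteq> 0"
  shows "x ^ ((Q - 1) div 2) = 1 \<or> x ^ ((Q - 1) div 2) = -1"
proof -
  have "(x ^ ((Q - 1) div 2)) ^ 2 = x ^ (Q - 1)"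
    using odd_Q by (simp flip: power_mult)
  hence "(x ^ ((Q - 1) div 2)) ^ 2 = 1" using power_card_minus_1[OF assms] by simp
  thus ?thesis by (simp add: power2_eq_1_iff)
qed

lemma Q_ge_3: "Q \<ge> 3"
  using Q_ge_2 odd_Q by (cases "Q = 2") auto

lemma ex_nonresidue: "\<exists>x\<in>F. x \<noteq> 0 \<and> x ^ ((Q - 1) div 2) \<noteq> 1"
proof (rule ccontr)
  assume "\<not> ?thesis"
  hence "F - {0} \<subseteq> {x. x ^ ((Q - 1) div 2) = 1}" by auto
  hence "card (F - {0}) \<le> card {x::'a. x ^ ((Q - 1) div 2) = 1}"
    using card_power_eq_le[of "(Q - 1) div 2" "1::'a"] Q_ge_3 by (intro card_mono) auto
  hence "Q - 1 \<le> (Q - 1) div 2"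
    using card_power_eq_le[of "(Q - 1) div 2" "1::'a"] Q_ge_3 card_F finite_F
    by (simp add: card_Diff_singleton)
  thus False using Q_ge_3 by simp
qed

lemma two_neq_0: "(2::'a) \<noteq> 0"
proof
  assume "(2::'a) = 0"
  hence "(1::'a) = -1" by (metis add_eq_0_iff2 one_add_one)
  thus False using ex_nonresidue half_pow by metis
qed

lemma four_neq_0: "(4::'a) \<noteq> 0"
proof -
  have "(4::'a) = 2 * 2" by simp
  thus ?thesis using two_neq_0 by (metis mult_eq_0_iff)
qed

lemma quad_char_mult:
  assumes "x \<in> F" "y \<in> F"
  shows "quad_char Q (x * y) = quad_char Q x * quad_char Q y"
proof -
  have neg: "(-1::'a) \<noteq> 1" using two_neq_0 by (metis add.left_inverse one_add_one)
  show ?thesis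
  proof (cases "x = 0 \<or> y = 0")
    case False
    thus ?thesis using half_pow[of x] half_pow[of y] assms neg
      unfolding quad_char_def power_mult_distrib by auto
  qed auto
qed

lemma quad_char_square:
  assumes "x \<in> F" "x \<noteq> 0"
  shows "quad_char Q (x ^ 2) = 1"
  using quad_char_mult[OF assms(1) assms(1)] quad_char_self_mult[OF assms(2)]
  by (simp add: power2_eq_square)

lemma sum_quad_char: "(\<Sum>x\<in>F. quad_char Q x) = 0"
proof -
  obtain a where a: "a \<in> F" "a \<noteq> 0" "a ^ ((Q - 1) div 2) \<noteq> 1"
    using ex_nonresidue by blast
  have "(\<Sum>x\<in>F. quad_char Q x) = (\<Sum>x\<in>F. quad_char Q (a * x))"
    by (rule sum.reindex_bij_witness[of _ "\<lambda>x. a * x" "\<lambda>x. x / a"])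
       (use a in \<open>auto intro: closed_in\<close>)
  also have "\<dots> = (\<Sum>x\<in>F. - quad_char Q x)"
    using a by (intro sum.cong refl) (simp add: quad_char_mult, simp add: quad_char_def)
  finally show ?thesis by (simp add: sum_negf)
qed

lemma sum_affine:
  fixes f :: "'a \<Rightarrow> complex"
  assumes "a \<in> F" "a \<noteq> 0" "b \<in> F"
  shows "(\<Sum>x\<in>F. f (a * x + b)) = (\<Sum>x\<in>F. f x)"
  by (rule sum.reindex_bij_witness[of _ "\<lambda>x. (x - b) / a" "\<lambda>x. a * x + b"])
     (use assms in \<open>auto intro: closed_in\<close>)

lemma sum_quad_char_affine:
  assumes "a \<in> F" "a \<noteq> 0" "b \<in> F"
  shows "(\<Sum>x\<in>F. quad_char Q (a * x + b)) = 0"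
  using sum_affine[OF assms, of "quad_char Q"] sum_quad_char by simp

lemma card_squares: "card {x\<in>F. x \<noteq> 0 \<and> (\<exists>w\<in>F. w ^ 2 = x)} = (Q - 1) div 2"
proof -
  let ?S = "{x\<in>F. x \<noteq> 0 \<and> (\<exists>w\<in>F. w ^ 2 = x)}"
  have fibre: "card {w\<in>F - {0}. w ^ 2 = x} = 2" if "x \<in> ?S" for x
  proof -
    obtain w where w: "w \<in> F" "w ^ 2 = x" "w \<noteq> 0" using \<open>x \<in> ?S\<close> by auto
    have "w \<noteq> - w" using two_neq_0 w(3)
      by (metis mult_2 mult_eq_0_iff add.right_inverse)
    have "{w\<in>F - {0}. w ^ 2 = x} = {w, - w}"
      using w by (auto simp: power2_eq_iff intro: uminus_in)
    thus ?thesis using \<open>w \<noteq> - w\<close> by simp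
  qed
  have "card (F - {0}) = card (\<Union>x\<in>?S. {w\<in>F - {0}. w ^ 2 = x})"
    by (rule arg_cong[where f = card]) (auto intro: closed_in)
  also have "\<dots> = (\<Sum>x\<in>?S. card {w\<in>F - {0}. w ^ 2 = x})"
    by (rule card_UN_disjoint) (use finite_F in auto)
  also have "\<dots> = 2 * card ?S" using fibre by simp
  finally show ?thesis using card_F finite_F by (simp add: card_Diff_singleton)
qed

text \<open>
  The squares are among the at most \<open>(Q - 1) / 2\<close> roots of \<open>x ^ ((Q - 1) / 2) = 1\<close>, and there
  are \<open>(Q - 1) / 2\<close> of them.
\<close>

lemma residue_iff_square:
  assumes "x \<in> F" "x \<noteq> 0"
  shows "x ^ ((Q - 1) div 2) = 1 \<longleftrightarrow> (\<exists>w\<in>F. w ^ 2 = x)"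
proof -
  let ?S = "{x\<in>F. x \<noteq> 0 \<and> (\<exists>w\<in>F. w ^ 2 = x)}"
  let ?E = "{x::'a. x ^ ((Q - 1) div 2) = 1}"
  have pos: "(Q - 1) div 2 > 0" using Q_ge_3 by simp
  have sub: "?S \<subseteq> ?E"
  proof
    fix x assume "x \<in> ?S"
    then obtain w where w: "w \<in> F" "w ^ 2 = x" "w \<noteq> 0" by auto
    have two: "2 * ((Q - 1) div 2) = Q - 1" using odd_Q by simp
    have "x ^ ((Q - 1) div 2) = w ^ (2 * ((Q - 1) div 2))"
      by (simp only: power_mult w(2))
    hence "x ^ ((Q - 1) div 2) = 1" by (simp only: two power_card_minus_1[OF w(1,3)])
    thus "x \<in> ?E" by simp
  qed
  have "?S = ?E"
  proof (rule card_seteq)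
    show "finite ?E" by (rule card_power_eq_le(1)[OF pos])
    show "card ?E \<le> card ?S" unfolding card_squares by (rule card_power_eq_le(2)[OF pos])
  qed (rule sub)
  hence "x \<in> ?S \<longleftrightarrow> x \<in> ?E" by (rule arg_cong)
  thus ?thesis using assms by simp
qed

lemma card_sqrt:
  assumes "x \<in> F"
  shows "of_nat (card {w\<in>F. w ^ 2 = x}) = 1 + quad_char Q x"
proof -
  consider "x = 0" | "x \<noteq> 0" "\<exists>w\<in>F. w ^ 2 = x" | "x \<noteq> 0" "\<not> (\<exists>w\<in>F. w ^ 2 = x)" by blast
  thus ?thesis
  proof cases
    case 1
    hence "{w\<in>F. w ^ 2 = x} = {0}" by auto
    thus ?thesis using 1 by simp
  next
    case 2
    then obtain w where w: "w \<in> F" "w ^ 2 = x" "w \<noteq> 0" by auto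
    have "w \<noteq> - w" using two_neq_0 w(3)
      by (metis mult_2 mult_eq_0_iff add.right_inverse)
    have "{w\<in>F. w ^ 2 = x} = {w, - w}"
      using w by (auto simp: power2_eq_iff intro: uminus_in)
    hence "card {w\<in>F. w ^ 2 = x} = 2" using \<open>w \<noteq> - w\<close> by simp
    moreover have "quad_char Q x = 1"
      using residue_iff_square[OF assms 2(1)] 2 by (simp add: quad_char_def)
    ultimately show ?thesis by simp
  next
    case 3
    hence "{w\<in>F. w ^ 2 = x} = {}" by auto
    moreover have "quad_char Q x = -1"
      using residue_iff_square[OF assms 3(1)] 3 by (simp add: quad_char_def)
    ultimately show ?thesis by (simp only: card.empty) simp
  qed
qed

lemma sum_over_squares:
  fixes f :: "'a \<Rightarrow> complex"
  shows "(\<Sum>y\<in>F. f (y ^ 2)) = (\<Sum>v\<in>F. (1 + quad_char Q v) * f v)"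
proof -
  have "(\<Sum>y\<in>F. f (y ^ 2)) = (\<Sum>v\<in>F. of_nat (card {y\<in>F. y ^ 2 = v}) * f v)"
    by (rule sum_fibers[where A = F and B = F and h = "\<lambda>y. y ^ 2" and f = f])
       (simp_all add: finite_F power_in)
  also have "\<dots> = (\<Sum>v\<in>F. (1 + quad_char Q v) * f v)"
    by (intro sum.cong refl) (simp only: card_sqrt)
  finally show ?thesis .
qed

lemma sum_quad_char_square_minus:
  assumes "d \<in> F" "d \<noteq> 0"
  shows "(\<Sum>w\<in>F. quad_char Q (w ^ 2 - d)) = -1"
proof -
  \<comment> \<open>Count the points of the hyperbola \<open>w\<^sup>2 - v\<^sup>2 = d\<close> via the coordinates \<open>w - v\<close> and \<open>w + v\<close>.\<close>
  have "(\<Sum>w\<in>F. 1 + quad_char Q (w ^ 2 - d)) = (\<Sum>w\<in>F. of_nat (card {v\<in>F. v ^ 2 = w ^ 2 - d}))"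
    by (intro sum.cong refl) (simp add: card_sqrt closed_in assms)
  also have "\<dots> = of_nat (card (SIGMA w:F. {v\<in>F. v ^ 2 = w ^ 2 - d}))"
    using finite_F by (subst card_SigmaI) auto
  also have "card (SIGMA w:F. {v\<in>F. v ^ 2 = w ^ 2 - d}) = card (F - {0})"
  proof (rule bij_betw_same_card[of "\<lambda>(w, v). w - v"],
         rule bij_betwI[where g = "\<lambda>a. ((a + d / a) / 2, (d / a - a) / 2)"])
    show "(\<lambda>(w, v). w - v) \<in> (SIGMA w:F. {v \<in> F. v\<^sup>2 = w\<^sup>2 - d}) \<rightarrow> F - {0}"
      using assms by (auto intro: closed_in)
    show "(\<lambda>a. ((a + d / a) / 2, (d / a - a) / 2)) \<in> F - {0} \<rightarrow> (SIGMA w:F. {v \<in> F. v\<^sup>2 = w\<^sup>2 - d})"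
      using assms two_neq_0 four_neq_0 by (auto intro!: closed_in simp: field_simps power2_eq_square)
    fix a assume "a \<in> F - {0}"
    have "(a + d / a) / 2 - (d / a - a) / 2 = (a + a) / 2"
      by (simp add: diff_divide_distrib[symmetric])
    thus "(case ((a + d / a) / 2, (d / a - a) / 2) of (w, v) \<Rightarrow> w - v) = a"
      using two_neq_0 by (simp flip: mult_2)
  next
    fix p assume "p \<in> (SIGMA w:F. {v \<in> F. v\<^sup>2 = w\<^sup>2 - d})"
    then obtain w v where p: "p = (w, v)" and wv: "d = w ^ 2 - v ^ 2" by (cases p) auto
    have "w - v \<noteq> 0" using wv assms(2) by (auto simp: )
    hence "d / (w - v) = w + v" unfolding wv by (simp add: field_simps power2_eq_square)
    thus "((((case p of (w, v) \<Rightarrow> w - v) + d / (case p of (w, v) \<Rightarrow> w - v))) / 2,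
          (d / (case p of (w, v) \<Rightarrow> w - v) - (case p of (w, v) \<Rightarrow> w - v)) / 2) = p"
      using two_neq_0 by (simp add: p field_simps)
  qed
  also have "of_nat (card (F - {0})) = (of_nat Q - 1 :: complex)"
    using finite_F card_F Q_ge_2 by (simp add: card_Diff_singleton of_nat_diff)
  finally show ?thesis using card_F by (simp add: sum.distrib)
qed

text \<open>
  Completing the square reduces a quadratic polynomial with nonzero discriminant to \<open>w\<^sup>2 - d\<close>.
\<close>

lemma sum_quad_char_quadratic:
  assumes "a \<in> F" "b \<in> F" "c \<in> F" "a \<noteq> 0" "b ^ 2 \<noteq> 4 * a * c"
  shows "(\<Sum>x\<in>F. quad_char Q (a * x ^ 2 + b * x + c)) = - quad_char Q a"
proof -
  have 4: "quad_char Q (4 * a) = quad_char Q a"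
    using quad_char_square[OF numeral_in, of "num.Bit0 num.One"] two_neq_0 assms
      quad_char_mult[of 4 a] numeral_in[of "num.Bit0 (num.Bit0 num.One)"] by simp
  have "(\<Sum>x\<in>F. quad_char Q (a * x ^ 2 + b * x + c)) =
        (\<Sum>x\<in>F. quad_char Q a * quad_char Q ((2 * a * x + b) ^ 2 - (b ^ 2 - 4 * a * c)))"
  proof (rule sum.cong[OF refl])
    fix x assume x: "x \<in> F"
    have "(2 * a * x + b) ^ 2 - (b ^ 2 - 4 * a * c) = (4 * a) * (a * x ^ 2 + b * x + c)"
      by (simp add: algebra_simps power2_eq_square)
    hence "quad_char Q ((2 * a * x + b) ^ 2 - (b ^ 2 - 4 * a * c)) =
           quad_char Q a * quad_char Q (a * x ^ 2 + b * x + c)"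
      using x assms 4 by (simp add: quad_char_mult[of "4 * a"] closed_in)
    thus "quad_char Q (a * x ^ 2 + b * x + c) =
       quad_char Q a * quad_char Q ((2 * a * x + b) ^ 2 - (b ^ 2 - 4 * a * c))"
      using quad_char_self_mult[OF assms(4), of Q] by (simp flip: mult.assoc)
  qed
  also have "\<dots> = quad_char Q a * (\<Sum>x\<in>F. quad_char Q (x ^ 2 - (b ^ 2 - 4 * a * c)))"
    using sum_affine[of "2 * a" b "\<lambda>x. quad_char Q (x ^ 2 - (b ^ 2 - 4 * a * c))"] assms two_neq_0
    by (simp add: closed_in flip: sum_distrib_left)
  also have "(\<Sum>x\<in>F. quad_char Q (x ^ 2 - (b ^ 2 - 4 * a * c))) = -1"
    using assms by (intro sum_quad_char_square_minus) (auto intro: closed_in)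
  finally show ?thesis by simp
qed

lemma sum_quad_char_quadratic_0:
  assumes "a \<in> F" "b \<in> F" "c \<in> F" "a \<noteq> 0" "b ^ 2 = 4 * a * c"
  shows "(\<Sum>x\<in>F. quad_char Q (a * x ^ 2 + b * x + c)) = (of_nat Q - 1) * quad_char Q a"
proof -
  define e where "e = b / (2 * a)"
  have e: "e \<in> F" using assms by (auto simp: e_def intro: closed_in)
  have c: "c = a * e ^ 2" using assms two_neq_0 four_neq_0
    by (simp add: e_def field_simps power2_eq_square)
  have b: "b = 2 * a * e" using assms two_neq_0 by (simp add: e_def)
  have "(\<Sum>x\<in>F. quad_char Q (a * x ^ 2 + b * x + c)) = (\<Sum>x\<in>F. quad_char Q (a * (1 * x + e) ^ 2))"
    by (intro sum.cong refl arg_cong[where f = "quad_char Q"])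
       (simp add: b c algebra_simps power2_eq_square)
  also have "\<dots> = (\<Sum>x\<in>F. quad_char Q (a * x ^ 2))"
    using sum_affine[of 1 e "\<lambda>x. quad_char Q (a * x ^ 2)"] e by simp
  also have "\<dots> = (\<Sum>x\<in>F - {0}. quad_char Q a)"
    using finite_F assms quad_char_square
    by (subst sum.remove[of F 0]) (auto intro!: sum.cong simp: quad_char_mult closed_in)
  also have "\<dots> = (of_nat Q - 1) * quad_char Q a"
    using finite_F card_F Q_ge_2 by (simp add: card_Diff_singleton of_nat_diff)
  finally show ?thesis .
qed

lemma card_quadratic_roots:
  assumes "a \<in> F" "b \<in> F" "c \<in> F" "a \<noteq> 0"
  shows "of_nat (card {x\<in>F. a * x ^ 2 + b * x + c = 0}) = 1 + quad_char Q (b ^ 2 - 4 * a * c)"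
proof -
  have iff: "a * x ^ 2 + b * x + c = 0 \<longleftrightarrow> (2 * a * x + b) ^ 2 = b ^ 2 - 4 * a * c" for x
  proof -
    have "(2 * a * x + b) ^ 2 - (b ^ 2 - 4 * a * c) = (4 * a) * (a * x ^ 2 + b * x + c)"
      by (simp add: algebra_simps power2_eq_square)
    thus ?thesis using four_neq_0 assms(4)
      by (metis eq_iff_diff_eq_0 mult_eq_0_iff)
  qed
  have "card {x\<in>F. a * x ^ 2 + b * x + c = 0} = card {w\<in>F. w ^ 2 = b ^ 2 - 4 * a * c}"
    by (rule bij_betw_same_card[of "\<lambda>x. 2 * a * x + b"],
        rule bij_betwI[where g = "\<lambda>w. (w - b) / (2 * a)"])
       (use assms two_neq_0 in \<open>auto simp: iff closed_in\<close>)
  also have "of_nat \<dots> = 1 + quad_char Q (b ^ 2 - 4 * a * c)"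
    by (rule card_sqrt) (use assms in \<open>auto intro: closed_in\<close>)
  finally show ?thesis .
qed

end

section \<open>A K3 surface and pairs of points on a conic\<close>

lemma odd_finite_subfield_UNIV:
  assumes "odd CARD('f::{finite,field})"
  shows "odd_finite_subfield (UNIV :: 'f set) CARD('f)"
  by unfold_locales (use assms in auto)

locale field_one_mod_four =
  fixes ty :: "'f::{finite,field} itself"
  assumes four_dvd: "4 dvd CARD('f) - 1"
begin

lemma odd_card: "odd CARD('f)"
proof -
  have "even (CARD('f) - 1)" using four_dvd by (meson dvd_trans even_numeral)
  thus ?thesis using zero_less_card_finite[where 'a = 'f] by (cases "CARD('f)") auto
qed

sublocale odd_finite_subfield "UNIV :: 'f set" "CARD('f)"
  by (rule odd_finite_subfield_UNIV[OF odd_card])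

abbreviation qc :: "'f \<Rightarrow> complex" where "qc \<equiv> quad_char CARD('f)"

lemma two_ne [simp]: "(2::'f) \<noteq> 0" and four_ne [simp]: "(4::'f) \<noteq> 0"
  using two_neq_0 four_neq_0 by auto

lemma eight_ne [simp]: "(8::'f) \<noteq> 0"
proof -
  have "(8::'f) = 2 * 4" by simp
  thus ?thesis by (metis two_ne four_ne mult_eq_0_iff)
qed

lemma qc_mult: "qc (x * y) = qc x * qc y"
  by (simp add: quad_char_mult)

lemma qc_sq [simp]: "x \<noteq> 0 \<Longrightarrow> qc (x ^ 2) = 1"
  by (simp add: quad_char_square)

lemma qc_self: "x \<noteq> 0 \<Longrightarrow> qc x * qc x = 1"
  by (rule quad_char_self_mult)

lemma qc_self_left: "x \<noteq> 0 \<Longrightarrow> qc x * (qc x * z) = z"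
  by (simp add: qc_self flip: mult.assoc)

lemma qc_minus_1 [simp]: "qc (-1) = 1"
proof -
  have "even ((CARD('f) - 1) div 2)" using four_dvd by auto
  thus ?thesis by (simp add: quad_char_def)
qed

lemma qc_minus: "qc (- x) = qc x"
  using qc_mult[of "-1" x] by simp

lemma qc_4 [simp]: "qc 4 = 1"
  using qc_sq[of 2] by simp

lemma qc_divide: "qc (x / y) = qc x * qc y"
proof (cases "y = 0")
  case False
  hence "qc x = qc (x / y) * qc y" by (simp flip: qc_mult)
  thus ?thesis using False by (simp add: qc_self mult.assoc)
qed auto

lemma qc_sq_mult: "z \<noteq> 0 \<Longrightarrow> qc (z ^ 2 * x) = qc x"
  by (simp add: qc_mult)

lemma qc_eqI: "x = z ^ 2 * y \<Longrightarrow> z \<noteq> 0 \<Longrightarrow> qc x = qc y"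
  by (simp add: qc_mult)

lemma sum_qc: "(\<Sum>x\<in>UNIV. qc x) = 0"
  by (rule sum_quad_char)

lemma sum_qc_affine: "a \<noteq> 0 \<Longrightarrow> (\<Sum>x\<in>UNIV. qc (a * x + b)) = 0"
  by (rule sum_quad_char_affine) auto

lemma sum_qc_shift: "(\<Sum>x\<in>UNIV. qc (x + b)) = 0" "(\<Sum>x\<in>UNIV. qc (x - b)) = 0"
  using sum_qc_affine[of 1 b] sum_qc_affine[of 1 "- b"] by auto

lemma sum_scale:
  fixes f :: "'f \<Rightarrow> complex"
  assumes "c \<noteq> 0" shows "(\<Sum>x\<in>UNIV. f (c * x)) = (\<Sum>x\<in>UNIV. f x)"
  using sum_affine[of c 0 f] assms by simp

lemma sum_shift:
  fixes f :: "'f \<Rightarrow> complex"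
  shows "(\<Sum>x\<in>UNIV. f (x + b)) = (\<Sum>x\<in>UNIV. f x)"
  using sum_affine[of 1 b f] by simp

lemma sum_uminus_UNIV:
  fixes f :: "'f \<Rightarrow> complex"
  shows "(\<Sum>x\<in>UNIV. f (- x)) = (\<Sum>x\<in>UNIV. f x)"
  using sum_affine[of "-1" 0 f] by simp

lemma sum_remove_0:
  fixes f :: "'f \<Rightarrow> complex"
  shows "(\<Sum>x\<in>UNIV. f x) = f 0 + (\<Sum>x\<in>UNIV - {0}. f x)"
  by (rule sum.remove) auto

text \<open>
  The equation \<open>v + b / v = s\<close> for \<open>v\<close> is quadratic with discriminant \<open>s\<^sup>2 - 4 b\<close>.
\<close>

lemma sum_quadratic_fibre:
  fixes f :: "'f \<Rightarrow> complex"
  assumes "b \<noteq> 0"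
  shows "(\<Sum>v\<in>UNIV - {0}. f (v + b / v)) = (\<Sum>s\<in>UNIV. (1 + qc (s ^ 2 - 4 * b)) * f s)"
proof -
  have "(\<Sum>v\<in>UNIV - {0}. f (v + b / v)) =
        (\<Sum>s\<in>UNIV. of_nat (card {v\<in>UNIV - {0}. v + b / v = s}) * f s)"
    by (rule sum_fibers[where h = "\<lambda>v. v + b / v" and f = f]) auto
  also have "\<dots> = (\<Sum>s\<in>UNIV. (1 + qc (s ^ 2 - 4 * b)) * f s)"
  proof (rule sum.cong[OF refl])
    fix s
    have "{v\<in>UNIV - {0}. v + b / v = s} = {v\<in>UNIV. 1 * v ^ 2 + (- s) * v + b = 0}"
    proof -
      have "(v \<noteq> 0 \<and> v + b / v = s) \<longleftrightarrow> 1 * v ^ 2 + (- s) * v + b = 0" for v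
      proof (cases "v = 0")
        case False
        have "v + b / v - s = (1 * v ^ 2 + (- s) * v + b) / v"
          using False by (simp add: divide_simps) (simp add: algebra_simps power2_eq_square)
        thus ?thesis using False by (metis divide_eq_0_iff eq_iff_diff_eq_0)
      qed (use assms in simp)
      thus ?thesis by simp
    qed
    thus "of_nat (card {v\<in>UNIV - {0}. v + b / v = s}) * f s = (1 + qc (s ^ 2 - 4 * b)) * f s"
      using card_quadratic_roots[of 1 "- s" b] by simp
  qed
  finally show ?thesis .
qed

text \<open>
  The elliptic curves \<open>y\<^sup>2 = v (v\<^sup>2 + a v + b)\<close> and \<open>y\<^sup>2 = v (v\<^sup>2 - 2 a v + a\<^sup>2 - 4 b)\<close> are
  2-isogenous and so have equally many points. The isogeny maps \<open>(v, y)\<close> to a point with first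
  coordinate \<open>y\<^sup>2 / v\<^sup>2 = a + v + b / v\<close>. On the level of sums, \<open>\<chi>\<close> at the first cubic is
  \<open>\<chi> (v + b / v + a)\<close>, and \<open>s = v + b / v\<close> is attained \<open>1 + \<chi> (s\<^sup>2 - 4 b)\<close> times; the term \<open>1\<close>
  contributes nothing, and the other one is the second curve in the coordinate \<open>s + a\<close>.
\<close>

lemma sum_2_isogeny:
  "(\<Sum>v\<in>UNIV. qc (v * (v ^ 2 + a * v + b))) =
   (\<Sum>v\<in>UNIV. qc (v * (v ^ 2 - 2 * a * v + (a ^ 2 - 4 * b))))"
proof (cases "b = 0")
  case True
  have "(\<Sum>v\<in>UNIV. qc (v * (v ^ 2 + a * v + b))) = (\<Sum>v\<in>UNIV - {0}. qc (v + a))"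
  proof -
    have "qc (v * (v ^ 2 + a * v + b)) = qc (v + a)" if "v \<noteq> 0" for v
      by (rule qc_eqI[OF _ that]) (simp add: True algebra_simps power2_eq_square)
    thus ?thesis by (subst sum_remove_0) auto
  qed
  also have "\<dots> = - qc a"
    using sum_remove_0[of "\<lambda>v. qc (v + a)"] sum_qc_shift(1)[of a] by (simp add: eq_neg_iff_add_eq_0 add.commute)
  also have "\<dots> = (\<Sum>v\<in>UNIV - {a}. qc v)"
    using sum.remove[of UNIV a qc] sum_qc by (simp add: add_eq_0_iff)
  also have "\<dots> = (\<Sum>v\<in>UNIV - {a}. qc (v * (v - a) ^ 2))"
    by (intro sum.cong) (auto simp: qc_mult)
  also have "\<dots> = (\<Sum>v\<in>UNIV. qc (v * (v - a) ^ 2))"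
    by (rule sum.mono_neutral_left) auto
  also have "\<dots> = (\<Sum>v\<in>UNIV. qc (v * (v ^ 2 - 2 * a * v + (a ^ 2 - 4 * b))))"
    by (intro sum.cong refl arg_cong[where f = qc]) (simp add: True algebra_simps power2_eq_square)
  finally show ?thesis .
next
  case False
  have "(\<Sum>v\<in>UNIV. qc (v * (v ^ 2 + a * v + b))) = (\<Sum>v\<in>UNIV - {0}. qc ((v + b / v) + a))"
  proof -
    have "qc (v * (v ^ 2 + a * v + b)) = qc ((v + b / v) + a)" if "v \<noteq> 0" for v
      using that by (intro qc_eqI[of _ v]) (simp_all add: field_simps power2_eq_square)
    thus ?thesis by (subst sum_remove_0) auto
  qed
  also have "\<dots> = (\<Sum>s\<in>UNIV. (1 + qc (s ^ 2 - 4 * b)) * qc (s + a))"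
    by (rule sum_quadratic_fibre[OF False, of "\<lambda>s. qc (s + a)"])
  also have "\<dots> = (\<Sum>s\<in>UNIV. qc (s + a)) + (\<Sum>s\<in>UNIV. qc ((s + a) * (s ^ 2 - 4 * b)))"
  proof -
    have "(1 + u) * w = w + w * u" for u w :: complex by (simp add: algebra_simps)
    thus ?thesis by (simp only: sum.distrib qc_mult)
  qed
  also have "(\<Sum>s\<in>UNIV. qc (s + a)) = 0" by (rule sum_qc_shift)
  also have "(\<Sum>s\<in>UNIV. qc ((s + a) * (s ^ 2 - 4 * b))) =
             (\<Sum>s\<in>UNIV. qc ((s + a) * ((s + a) ^ 2 - 2 * a * (s + a) + (a ^ 2 - 4 * b))))"
    by (intro sum.cong refl arg_cong[where f = qc]) (simp add: algebra_simps power2_eq_square)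
  also have "\<dots> = (\<Sum>v\<in>UNIV. qc (v * (v ^ 2 - 2 * a * v + (a ^ 2 - 4 * b))))"
    by (rule sum_shift[of "\<lambda>v. qc (v * (v ^ 2 - 2 * a * v + (a ^ 2 - 4 * b)))" a])
  finally show ?thesis by simp
qed

text \<open>
  The point count, without its trivial part, of the double plane
  \<open>y\<^sup>2 = (x - 1) v (v - t) (v - x\<^sup>2)\<close>, a K3 surface fibred over the \<open>x\<close>-line by elliptic curves.
\<close>

definition k3_sum :: "'f \<Rightarrow> complex" where
  "k3_sum t = (\<Sum>x\<in>UNIV. \<Sum>v\<in>UNIV. qc ((x - 1) * (v * (v - t) * (v - x ^ 2))))"

text \<open>
  A pair with sum \<open>s\<close> and product \<open>p\<close> is an ordering of the roots of \<open>X\<^sup>2 - s X + p\<close>.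
\<close>

lemma sum_symmetric_functions:
  fixes f :: "'f \<Rightarrow> 'f \<Rightarrow> complex"
  shows "(\<Sum>a\<in>UNIV. \<Sum>b\<in>UNIV. f (a + b) (a * b)) =
         (\<Sum>s\<in>UNIV. \<Sum>p\<in>UNIV. (1 + qc (s ^ 2 - 4 * p)) * f s p)"
proof -
  have "(\<Sum>a\<in>UNIV. \<Sum>b\<in>UNIV. f (a + b) (a * b)) = (\<Sum>a\<in>UNIV. \<Sum>s\<in>UNIV. f s (a * (s - a)))"
  proof (rule sum.cong[OF refl])
    fix a
    show "(\<Sum>b\<in>UNIV. f (a + b) (a * b)) = (\<Sum>s\<in>UNIV. f s (a * (s - a)))"
      using sum_shift[of "\<lambda>s. f s (a * (s - a))" a] by (simp add: add.commute)
  qed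
  also have "\<dots> = (\<Sum>s\<in>UNIV. \<Sum>a\<in>UNIV. f s (a * (s - a)))" by (rule sum.swap)
  also have "\<dots> = (\<Sum>s\<in>UNIV. \<Sum>p\<in>UNIV. (1 + qc (s ^ 2 - 4 * p)) * f s p)"
  proof (rule sum.cong[OF refl])
    fix s
    have "(\<Sum>a\<in>UNIV. f s (a * (s - a))) =
          (\<Sum>p\<in>UNIV. of_nat (card {a\<in>UNIV. a * (s - a) = p}) * f s p)"
      by (rule sum_fibers[where h = "\<lambda>a. a * (s - a)" and f = "f s"]) auto
    also have "\<dots> = (\<Sum>p\<in>UNIV. (1 + qc (s ^ 2 - 4 * p)) * f s p)"
    proof (rule sum.cong[OF refl])
      fix p
      have "{a\<in>UNIV. a * (s - a) = p} = {a\<in>UNIV. 1 * a ^ 2 + (- s) * a + p = 0}"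
      proof -
        have "a * (s - a) = p \<longleftrightarrow> 1 * a ^ 2 + (- s) * a + p = 0" for a
        proof -
          have "a * (s - a) - p = - (1 * a ^ 2 + (- s) * a + p)"
            by (simp add: algebra_simps power2_eq_square)
          thus ?thesis by (metis eq_iff_diff_eq_0 neg_equal_0_iff_equal)
        qed
        thus ?thesis by simp
      qed
      thus "of_nat (card {a\<in>UNIV. a * (s - a) = p}) * f s p = (1 + qc (s ^ 2 - 4 * p)) * f s p"
        using card_quadratic_roots[of 1 "- s" p] by simp
    qed
    finally show "(\<Sum>a\<in>UNIV. f s (a * (s - a))) = (\<Sum>p\<in>UNIV. (1 + qc (s ^ 2 - 4 * p)) * f s p)" .
  qed
  finally show ?thesis .
qed

text \<open>
  The summand on the left depends only on \<open>s = a + b\<close> and \<open>p = a b\<close>, and the surface is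
  recovered in the coordinates \<open>x = - s\<close> and \<open>v = 4 p\<close>.
\<close>

lemma k3_sum_symmetric_form:
  assumes "L \<noteq> 0"
  shows "(\<Sum>a\<in>UNIV. \<Sum>b\<in>UNIV. qc (a * b * (a + b + 1) * (4 * L ^ 2 * a * b - 1))) = k3_sum (1 / L ^ 2)"
proof -
  define f where "f = (\<lambda>s p. qc (p * (s + 1) * (4 * L ^ 2 * p - 1)))"
  have "(\<Sum>a\<in>UNIV. \<Sum>b\<in>UNIV. qc (a * b * (a + b + 1) * (4 * L ^ 2 * a * b - 1))) =
        (\<Sum>a\<in>UNIV. \<Sum>b\<in>UNIV. f (a + b) (a * b))"
    by (simp add: f_def mult.assoc)
  also have "\<dots> = (\<Sum>s\<in>UNIV. \<Sum>p\<in>UNIV. (1 + qc (s ^ 2 - 4 * p)) * f s p)"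
    by (rule sum_symmetric_functions)
  also have "\<dots> = (\<Sum>s\<in>UNIV. \<Sum>p\<in>UNIV. f s p) + (\<Sum>s\<in>UNIV. \<Sum>p\<in>UNIV. qc (s ^ 2 - 4 * p) * f s p)"
    by (simp add: algebra_simps sum.distrib)
  also have "(\<Sum>s\<in>UNIV. \<Sum>p\<in>UNIV. f s p) = (\<Sum>p\<in>UNIV. qc (p * (4 * L ^ 2 * p - 1)) * (\<Sum>s\<in>UNIV. qc (s + 1)))"
    unfolding sum_distrib_left
    by (subst sum.swap, intro sum.cong refl) (simp only: f_def qc_mult mult_ac)
  also have "\<dots> = 0" by (simp add: sum_qc_shift)
  also have "(\<Sum>s\<in>UNIV. \<Sum>p\<in>UNIV. qc (s ^ 2 - 4 * p) * f s p) =
             (\<Sum>x\<in>UNIV. \<Sum>v\<in>UNIV. qc ((- x) ^ 2 - v) * f (- x) (v / 4))"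
  proof (rule trans[OF sum_uminus_UNIV[symmetric]], rule sum.cong[OF refl])
    fix x
    show "(\<Sum>p\<in>UNIV. qc ((- x) ^ 2 - 4 * p) * f (- x) p) =
          (\<Sum>v\<in>UNIV. qc ((- x) ^ 2 - v) * f (- x) (v / 4))"
      using sum_scale[of "1 / 4" "\<lambda>p. qc ((- x) ^ 2 - 4 * p) * f (- x) p"] by simp
  qed
  also have "\<dots> = k3_sum (1 / L ^ 2)"
    unfolding k3_sum_def
  proof (intro sum.cong refl)
    fix x v
    have "(x - 1) * (v * (v - 1 / L ^ 2) * (v - x ^ 2)) =
          (2 / L) ^ 2 * ((x ^ 2 - v) * (v / 4 * (- x + 1) * (4 * L ^ 2 * (v / 4) - 1)))"
      using assms by (simp add: divide_simps) (simp add: algebra_simps power2_eq_square)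
    hence "qc ((x - 1) * (v * (v - 1 / L ^ 2) * (v - x ^ 2))) =
           qc ((x ^ 2 - v) * (v / 4 * (- x + 1) * (4 * L ^ 2 * (v / 4) - 1)))"
      by (rule qc_eqI) (use assms in simp)
    thus "qc ((- x) ^ 2 - v) * f (- x) (v / 4) = qc ((x - 1) * (v * (v - 1 / L ^ 2) * (v - x ^ 2)))"
      unfolding f_def by (simp only: qc_mult[symmetric] power2_minus)
  qed
  finally show ?thesis by simp
qed

text \<open>
  Each factor \<open>x\<^sup>2 - t\<close> belongs to a conic \<open>x\<^sup>2 - t = c u\<^sup>2\<close>; the two copies of the conic are
  coupled only by the linear form \<open>x + y - 2\<close>.
\<close>

definition conic_pair_sum :: "'f \<Rightarrow> complex" where
  "conic_pair_sum t = (\<Sum>x\<in>UNIV. \<Sum>y\<in>UNIV. qc ((x ^ 2 - t) * (y ^ 2 - t) * (x + y - 2)))"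

text \<open>
  With \<open>w = y\<^sup>2\<close> the left-hand side becomes the sum over \<open>w\<close> of \<open>(1 + \<chi>(w))\<close> times \<open>\<chi>\<close> at a
  quadratic polynomial in \<open>w\<close>. The term \<open>1\<close> gives the elementary part, and the term \<open>\<chi>(w)\<close>
  belongs to an elliptic curve, whose 2-isogenous curve is the fibre of the K3 surface.
\<close>

lemma sum_isogenous_fibre:
  assumes "t \<noteq> 0"
  shows "(\<Sum>y\<in>UNIV. qc ((y ^ 2) ^ 2 - 2 * (x ^ 2 + t) * y ^ 2 + (x ^ 2 - t) ^ 2)) =
         (if x = 0 then of_nat CARD('f) - 1 else -1) + (\<Sum>v\<in>UNIV. qc (v * (v - t) * (v - x ^ 2)))"
proof -
  define f where "f = (\<lambda>v. qc (v ^ 2 - 2 * (x ^ 2 + t) * v + (x ^ 2 - t) ^ 2))"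
  have "(\<Sum>y\<in>UNIV. f (y ^ 2)) = (\<Sum>v\<in>UNIV. (1 + qc v) * f v)" by (rule sum_over_squares)
  also have "\<dots> = (\<Sum>v\<in>UNIV. f v) + (\<Sum>v\<in>UNIV. qc v * f v)" by (simp add: algebra_simps sum.distrib)
  also have "(\<Sum>v\<in>UNIV. f v) = (if x = 0 then of_nat CARD('f) - 1 else -1)"
  proof -
    have disc: "(- (2 * (x ^ 2 + t))) ^ 2 - 4 * 1 * (x ^ 2 - t) ^ 2 = 4 ^ 2 * t * x ^ 2"
      by (simp add: algebra_simps power2_eq_square)
    have f: "f v = qc (1 * v ^ 2 + (- (2 * (x ^ 2 + t))) * v + (x ^ 2 - t) ^ 2)" for v
      by (simp only: f_def mult_minus_left mult_1 diff_conv_add_uminus)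
    show ?thesis
    proof (cases "x = 0")
      case True
      show ?thesis unfolding f
        by (subst sum_quad_char_quadratic_0) (use disc True in auto)
    next
      case False
      have "(4::'f) ^ 2 * t * x ^ 2 \<noteq> 0" using assms False by (simp del: power_numeral)
      hence "(- (2 * (x ^ 2 + t))) ^ 2 \<noteq> 4 * 1 * (x ^ 2 - t) ^ 2"
        using disc by (metis diff_self)
      thus ?thesis unfolding f
        by (subst sum_quad_char_quadratic) (use False in auto)
    qed
  qed
  also have "(\<Sum>v\<in>UNIV. qc v * f v) =
      (\<Sum>v\<in>UNIV. qc (v * (v ^ 2 + (- (2 * (x ^ 2 + t))) * v + (x ^ 2 - t) ^ 2)))"
    by (simp only: f_def qc_mult mult_minus_left diff_conv_add_uminus)
  also have "\<dots> = (\<Sum>v\<in>UNIV. qc ((2 ^ 2) ^ 2 * 2 ^ 2 * (v * (v + t) * (v + x ^ 2))))"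
  proof (subst sum_2_isogeny, subst sum_scale[of 4, symmetric], simp, intro sum.cong refl arg_cong[where f = qc])
    fix v
    show "4 * v * ((4 * v) ^ 2 - 2 * (- (2 * (x ^ 2 + t))) * (4 * v) +
            ((- (2 * (x ^ 2 + t))) ^ 2 - 4 * (x ^ 2 - t) ^ 2)) =
          (2 ^ 2) ^ 2 * 2 ^ 2 * (v * (v + t) * (v + x ^ 2))"
      by (simp add: algebra_simps power2_eq_square)
  qed
  also have "\<dots> = (\<Sum>v\<in>UNIV. qc (v * (v + t) * (v + x ^ 2)))"
    by (intro sum.cong refl qc_eqI[of _ "2 ^ 2 * 2"]) simp_all
  also have "\<dots> = (\<Sum>v\<in>UNIV. qc (- (v * (v - t) * (v - x ^ 2))))"
    by (subst sum_uminus_UNIV[symmetric], intro sum.cong refl arg_cong[where f = qc])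
       (simp add: algebra_simps)
  also have "\<dots> = (\<Sum>v\<in>UNIV. qc (v * (v - t) * (v - x ^ 2)))" by (simp only: qc_minus)
  finally show ?thesis by (simp only: f_def)
qed

text \<open>
  In the coordinates \<open>(x + y) / 2\<close> and \<open>(x - y) / 2\<close> the product \<open>(x\<^sup>2 - t) (y\<^sup>2 - t)\<close> is even in
  the second coordinate, and the sum over the latter is an isogenous fibre of the K3 surface.
\<close>

lemma conic_pair_sum_eq:
  assumes "t \<noteq> 0"
  shows "conic_pair_sum t = qc 2 * (k3_sum t + of_nat CARD('f))"
proof -
  define g where "g = (\<lambda>x y. qc ((x ^ 2 - t) * (y ^ 2 - t) * (x + y - 2)))"
  have "conic_pair_sum t = (\<Sum>p\<in>UNIV \<times> UNIV. g (fst p) (snd p))"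
    unfolding conic_pair_sum_def g_def by (simp add: sum.cartesian_product case_prod_beta)
  also have "\<dots> = (\<Sum>p\<in>UNIV \<times> UNIV. g (fst p + snd p) (fst p - snd p))"
    by (rule sum.reindex_bij_witness[of _ "\<lambda>p. (fst p + snd p, fst p - snd p)"
               "\<lambda>p. ((fst p + snd p) / 2, (fst p - snd p) / 2)"])
       (auto simp: divide_simps)
  also have "\<dots> = (\<Sum>x\<in>UNIV. \<Sum>y\<in>UNIV. g (x + y) (x - y))"
    by (simp add: sum.cartesian_product case_prod_beta)
  also have "\<dots> = (\<Sum>x\<in>UNIV. qc 2 * qc (x - 1) *
      (\<Sum>y\<in>UNIV. qc ((y ^ 2) ^ 2 - 2 * (x ^ 2 + t) * y ^ 2 + (x ^ 2 - t) ^ 2)))"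
    unfolding sum_distrib_left g_def qc_mult[symmetric]
    by (intro sum.cong refl arg_cong[where f = qc]) (simp add: algebra_simps power2_eq_square)
  also have "\<dots> = (\<Sum>x\<in>UNIV. qc 2 * qc (x - 1) * (if x = 0 then of_nat CARD('f) - 1 else -1)) +
                   qc 2 * k3_sum t"
    unfolding sum_isogenous_fibre[OF assms] k3_sum_def
    unfolding distrib_left sum.distrib
    by (simp only: qc_mult sum_distrib_left mult_ac)
  also have "(\<Sum>x\<in>UNIV. qc 2 * qc (x - 1) * (if x = 0 then of_nat CARD('f) - 1 else -1)) =
             (\<Sum>x\<in>UNIV. (if x = 0 then qc 2 * of_nat CARD('f) else 0) - qc 2 * qc (x - 1))"
    by (intro sum.cong refl) (auto simp: algebra_simps)
  also have "\<dots> = qc 2 * of_nat CARD('f)"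
    by (simp add: sum_subtractf sum_qc_shift flip: sum_distrib_left)
  finally show ?thesis by (simp add: algebra_simps)
qed

section \<open>A sum over a quadratic algebra\<close>

lemma q_minus_1_ne: "of_nat CARD('f) - 1 \<noteq> (0 :: complex)"
proof -
  have "CARD('f) \<noteq> 1" using Q_ge_2 by simp
  hence "of_nat CARD('f) \<noteq> (1 :: complex)" by (metis of_nat_1 of_nat_eq_iff)
  thus ?thesis by simp
qed

lemma sum_const_nonzero:
  fixes c :: complex
  shows "(\<Sum>x\<in>UNIV. if x = (0::'f) then 0 else c) = (of_nat CARD('f) - 1) * c"
proof -
  have "(\<Sum>x\<in>UNIV. if x = (0::'f) then 0 else c) = (\<Sum>x\<in>UNIV - {0::'f}. c)"
    by (rule sum.mono_neutral_cong_right) auto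
  thus ?thesis using Q_ge_2 by (simp add: card_Diff_singleton of_nat_diff)
qed

text \<open>
  The norm of \<open>a + b s\<close> in the algebra \<open>F[s]\<close> with \<open>s\<^sup>2 = D\<close>. Working with pairs \<open>(a, b)\<close> treats
  the split algebra, where \<open>D\<close> is a square, and the quadratic extension of \<open>F\<close> at the same time.
\<close>

definition nrm :: "'f \<Rightarrow> 'f \<Rightarrow> 'f \<Rightarrow> 'f" where
  "nrm D a b = a ^ 2 - D * b ^ 2"

lemma nrm_scale: "nrm D (k * a) (k * b) = k ^ 2 * nrm D a b"
  by (simp add: nrm_def algebra_simps power2_eq_square)

lemma sum_qc_nrm:
  assumes "D \<noteq> 0"
  shows "(\<Sum>a\<in>UNIV. \<Sum>b\<in>UNIV. qc (nrm D a b)) = 0"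
proof -
  have *: "(\<Sum>b\<in>UNIV. qc (nrm D a b)) = (if a = 0 then of_nat CARD('f) * qc D else 0) - qc D" for a
  proof -
    have f: "nrm D a b = (- D) * b ^ 2 + 0 * b + a ^ 2" for b by (simp add: nrm_def)
    show ?thesis
    proof (cases "a = 0")
      case True
      thus ?thesis unfolding f using assms
        by (subst sum_quad_char_quadratic_0) (auto simp: qc_minus algebra_simps)
    next
      case False
      thus ?thesis unfolding f using assms
        by (subst sum_quad_char_quadratic) (auto simp: qc_minus)
    qed
  qed
  show ?thesis unfolding * by (simp add: sum_subtractf)
qed

text \<open>
  Elements of \<open>F[s]\<close> on the same line through the origin have norms that differ by a square, so
  \<open>\<chi>\<close> of the norm of a point can be written as an average over the line through it. The
  condition of lying on the line is bilinear, which makes a later exchange of summations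
  possible. For the zero vector the line is replaced by the whole plane, and both sides vanish.
\<close>

lemma sum_line:
  assumes "D \<noteq> 0"
  shows "(\<Sum>c\<in>UNIV. \<Sum>d\<in>UNIV. if d * x = c * y then qc (nrm D c d) else 0) = (of_nat CARD('f) - 1) * qc (nrm D x y)"
proof (cases "x = 0 \<and> y = 0")
  case True
  thus ?thesis using sum_qc_nrm[OF assms] by (simp add: nrm_def)
next
  case False
  have "(\<Sum>c\<in>UNIV. \<Sum>d\<in>UNIV. if d * x = c * y then qc (nrm D c d) else 0) =
        (\<Sum>p\<in>UNIV \<times> UNIV. if snd p * x = fst p * y then qc (nrm D (fst p) (snd p)) else 0)"
    by (simp add: sum.cartesian_product case_prod_beta)
  also have "\<dots> = (\<Sum>p\<in>{p. snd p * x = fst p * y}. qc (nrm D (fst p) (snd p)))"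
    by (rule sum.mono_neutral_cong_right) auto
  also have "\<dots> = (\<Sum>k\<in>UNIV. qc (nrm D (k * x) (k * y)))"
  proof (rule sum.reindex_bij_witness[of _ "\<lambda>k. (k * x, k * y)"
              "\<lambda>p. if x = 0 then snd p / y else fst p / x"])
    fix p :: "'f \<times> 'f" assume "p \<in> {p. snd p * x = fst p * y}"
    hence e: "(if x = 0 then snd p / y else fst p / x) * x = fst p"
             "(if x = 0 then snd p / y else fst p / x) * y = snd p"
      using False by (auto simp: field_simps)
    show "((if x = 0 then snd p / y else fst p / x) * x, (if x = 0 then snd p / y else fst p / x) * y) = p"
      by (simp only: e prod.collapse)
    show "qc (nrm D ((if x = 0 then snd p / y else fst p / x) * x) ((if x = 0 then snd p / y else fst p / x) * y)) =
          qc (nrm D (fst p) (snd p))"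
      by (simp only: e)
  qed (use False in auto)
  also have "\<dots> = (\<Sum>k\<in>UNIV. if k = (0::'f) then 0 else qc (nrm D x y))"
    by (intro sum.cong refl) (auto simp: nrm_scale qc_mult)
  also have "\<dots> = (of_nat CARD('f) - 1) * qc (nrm D x y)" by (rule sum_const_nonzero)
  finally show ?thesis .
qed

text \<open>
  Over a field, the zeros of a nonzero binary quadratic form are two lines, one line or the
  origin, according to the quadratic character of its discriminant.
\<close>

lemma sum_zeros_binary_form:
  assumes "A \<noteq> 0 \<or> B \<noteq> 0 \<or> C \<noteq> 0"
  shows "(\<Sum>r\<in>UNIV. \<Sum>h\<in>UNIV. of_bool (A * r ^ 2 + B * (r * h) + C * h ^ 2 = 0)) =
         of_nat CARD('f) + (of_nat CARD('f) - 1) * qc (B ^ 2 - 4 * A * C)"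
proof (cases "A = 0")
  case False
  have *: "(\<Sum>r\<in>UNIV. of_bool (A * r ^ 2 + B * (r * h) + C * h ^ 2 = 0)) =
        1 + (if h = 0 then 0 else qc (B ^ 2 - 4 * A * C))" for h
  proof -
    have "(\<Sum>r\<in>UNIV. of_bool (A * r ^ 2 + B * (r * h) + C * h ^ 2 = 0)) =
          (of_nat (card {r\<in>UNIV. A * r ^ 2 + (B * h) * r + C * h ^ 2 = 0}) :: complex)"
      by (simp add: mult_ac)
    also have "\<dots> = 1 + qc ((B * h) ^ 2 - 4 * A * (C * h ^ 2))"
      by (rule card_quadratic_roots) (use False in auto)
    also have "(B * h) ^ 2 - 4 * A * (C * h ^ 2) = h ^ 2 * (B ^ 2 - 4 * A * C)"
      by (simp add: algebra_simps power2_eq_square)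
    finally show ?thesis by (simp add: qc_mult)
  qed
  show ?thesis by (subst sum.swap) (simp only: * sum.distrib sum_const_nonzero, simp)
next
  case True
  have *: "(\<Sum>r\<in>UNIV. of_bool (A * r ^ 2 + B * (r * h) + C * h ^ 2 = 0)) =
        (if h = 0 then of_nat CARD('f) else qc (B ^ 2 - 4 * A * C))" for h
  proof (cases "h = 0")
    case False
    have iff: "A * r ^ 2 + B * (r * h) + C * h ^ 2 = 0 \<longleftrightarrow> B * r + C * h = 0" for r
    proof -
      have "A * r ^ 2 + B * (r * h) + C * h ^ 2 = h * (B * r + C * h)"
        by (simp add: True algebra_simps power2_eq_square)
      thus ?thesis using False by simp
    qed
    show ?thesis
    proof (cases "B = 0")
      case True
      thus ?thesis using assms \<open>A = 0\<close> False unfolding iff by simp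
    next
      case B: False
      hence "{r. B * r + C * h = 0} = {- (C * h) / B}"
        by (auto simp: field_simps add_eq_0_iff)
      thus ?thesis using B \<open>A = 0\<close> False unfolding iff by simp
    qed
  qed (simp add: True)
  have "(\<Sum>r\<in>UNIV. \<Sum>h\<in>UNIV. of_bool (A * r ^ 2 + B * (r * h) + C * h ^ 2 = 0)) =
        (\<Sum>h\<in>UNIV. if h = (0::'f) then of_nat CARD('f) else qc (B ^ 2 - 4 * A * C))"
    by (subst sum.swap) (simp only: *)
  also have "\<dots> = (\<Sum>h\<in>UNIV. (if h = (0::'f) then of_nat CARD('f) else 0) + (if h = (0::'f) then 0 else qc (B ^ 2 - 4 * A * C)))"
    by (intro sum.cong) auto
  also have "\<dots> = of_nat CARD('f) + (of_nat CARD('f) - 1) * qc (B ^ 2 - 4 * A * C)"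
    by (simp only: sum.distrib sum_const_nonzero) simp
  finally show ?thesis .
qed

text \<open>
  The components, with respect to \<open>1\<close> and \<open>s\<close>, of \<open>2 r\<^sup>2 \<zeta>\<^sup>2 - 4 r h \<zeta> + (1 - s) h\<^sup>2\<close> at
  \<open>\<zeta> = a + b s\<close>. The variables \<open>r\<close> and \<open>h\<close> homogenise the polynomial \<open>2 \<zeta>\<^sup>2 - 4 \<zeta> + 1 - s\<close>.
\<close>

definition quad_re :: "'f \<Rightarrow> 'f \<Rightarrow> 'f \<Rightarrow> 'f \<Rightarrow> 'f \<Rightarrow> 'f" where
  "quad_re D a b r h = 2 * r ^ 2 * (a ^ 2 + D * b ^ 2) - 4 * r * h * a + h ^ 2"

definition quad_im :: "'f \<Rightarrow> 'f \<Rightarrow> 'f \<Rightarrow> 'f \<Rightarrow> 'f" where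
  "quad_im a b r h = 4 * r ^ 2 * a * b - 4 * r * h * b - h ^ 2"

text \<open>
  The sum over all \<open>\<zeta>\<close> in \<open>F[s]\<close> of \<open>\<chi>\<close> at the norm of \<open>\<zeta> (2 \<zeta>\<^sup>2 - 4 \<zeta> + 1 - s)\<close>.
\<close>

definition norm_sum :: "'f \<Rightarrow> complex" where
  "norm_sum D = (\<Sum>a\<in>UNIV. \<Sum>b\<in>UNIV. qc (nrm D a b) * qc (nrm D (quad_re D a b 1 1) (quad_im a b 1 1)))"

text \<open>
  The discriminant of the binary quadratic form \<open>d * quad_re - c * quad_im\<close> in \<open>r\<close> and \<open>h\<close>.
\<close>

definition pencil_disc :: "'f \<Rightarrow> 'f \<Rightarrow> 'f \<Rightarrow> 'f \<Rightarrow> 'f \<Rightarrow> 'f" where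
  "pencil_disc D a b c d = (4 * b * c - 4 * a * d) ^ 2 -
     4 * (2 * d * (a ^ 2 + D * b ^ 2) - 4 * a * b * c) * (c + d)"

lemma sum_UNIV_pair:
  fixes f :: "'f \<Rightarrow> 'f \<Rightarrow> complex"
  shows "(\<Sum>a\<in>UNIV. \<Sum>b\<in>UNIV. f a b) = (\<Sum>p\<in>UNIV. f (fst p) (snd p))"
  by (simp add: sum.cartesian_product case_prod_beta)

lemma sum_swap_pairs:
  fixes f :: "'f \<Rightarrow> 'f \<Rightarrow> 'f \<Rightarrow> 'f \<Rightarrow> complex"
  shows "(\<Sum>a\<in>UNIV. \<Sum>b\<in>UNIV. \<Sum>c\<in>UNIV. \<Sum>d\<in>UNIV. f a b c d) =
         (\<Sum>c\<in>UNIV. \<Sum>d\<in>UNIV. \<Sum>a\<in>UNIV. \<Sum>b\<in>UNIV. f a b c d)"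
  unfolding sum_UNIV_pair by (rule sum.swap)

text \<open>
  By averaging over lines (\<open>sum_line\<close>), \<open>\<chi>\<close> at the norm of the point \<open>(quad_re, quad_im)\<close> is
  replaced by a sum over the points \<open>(c, d)\<close> proportional to it. For fixed \<open>(c, d)\<close> the
  proportionality is a binary quadratic equation in \<open>r\<close> and \<open>h\<close>, whose number of solutions is
  determined by its discriminant.
\<close>

lemma sum_pencil:
  assumes D: "D \<noteq> 0" "D \<noteq> 1" and n: "nrm D a b \<noteq> 0"
  shows "(\<Sum>r\<in>UNIV. \<Sum>h\<in>UNIV. qc (nrm D (quad_re D a b r h) (quad_im a b r h))) =
         (\<Sum>c\<in>UNIV. \<Sum>d\<in>UNIV. qc (nrm D c d) * qc (pencil_disc D a b c d))"
proof -
  have "(of_nat CARD('f) - 1) * (\<Sum>r\<in>UNIV. \<Sum>h\<in>UNIV. qc (nrm D (quad_re D a b r h) (quad_im a b r h))) =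
        (\<Sum>r\<in>UNIV. \<Sum>h\<in>UNIV. \<Sum>c\<in>UNIV. \<Sum>d\<in>UNIV.
           if d * quad_re D a b r h = c * quad_im a b r h then qc (nrm D c d) else 0)"
    by (simp only: sum_line[OF D(1)] sum_distrib_left)
  also have "\<dots> = (\<Sum>c\<in>UNIV. \<Sum>d\<in>UNIV. \<Sum>r\<in>UNIV. \<Sum>h\<in>UNIV.
           if d * quad_re D a b r h = c * quad_im a b r h then qc (nrm D c d) else 0)"
    by (rule sum_swap_pairs)
  also have "\<dots> = (\<Sum>c\<in>UNIV. \<Sum>d\<in>UNIV. of_nat CARD('f) * qc (nrm D c d) + (of_nat CARD('f) - 1) * (qc (nrm D c d) * qc (pencil_disc D a b c d)))"
  proof (intro sum.cong refl)
    fix c d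
    define A where "A = 2 * d * (a ^ 2 + D * b ^ 2) - 4 * a * b * c"
    define B where "B = 4 * b * c - 4 * a * d"
    show "(\<Sum>r\<in>UNIV. \<Sum>h\<in>UNIV. if d * quad_re D a b r h = c * quad_im a b r h then qc (nrm D c d) else 0) =
          of_nat CARD('f) * qc (nrm D c d) + (of_nat CARD('f) - 1) * (qc (nrm D c d) * qc (pencil_disc D a b c d))"
    proof (cases "c = 0 \<and> d = 0")
      case True
      thus ?thesis by (simp add: nrm_def)
    next
      case False
      have ne: "A \<noteq> 0 \<or> B \<noteq> 0 \<or> c + d \<noteq> 0"
      proof (rule ccontr)
        assume "\<not> ?thesis"
        hence A: "A = 0" and B: "B = 0" and "c + d = 0" by auto
        hence c: "c = - d" by (simp add: add_eq_0_iff2)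
        with False have d: "d \<noteq> 0" by auto
        have "B = - (4 * d) * (a + b)" by (simp add: B_def c algebra_simps)
        hence "a + b = 0" using B d by simp
        hence b: "b = - a" by (simp add: add_eq_0_iff)
        have "A = 2 * d * a ^ 2 * (D - 1)" by (simp add: A_def c b algebra_simps power2_eq_square)
        hence "a = 0" using A d D by simp
        thus False using n b by (simp add: nrm_def)
      qed
      have iff: "d * quad_re D a b r h = c * quad_im a b r h \<longleftrightarrow> A * r ^ 2 + B * (r * h) + (c + d) * h ^ 2 = 0" for r h
      proof -
        have "d * quad_re D a b r h - c * quad_im a b r h = A * r ^ 2 + B * (r * h) + (c + d) * h ^ 2"
          by (simp add: quad_re_def quad_im_def A_def B_def algebra_simps power2_eq_square)
        thus ?thesis by (metis eq_iff_diff_eq_0)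
      qed
      have "(\<Sum>r\<in>UNIV. \<Sum>h\<in>UNIV. if d * quad_re D a b r h = c * quad_im a b r h then qc (nrm D c d) else 0) =
        qc (nrm D c d) * (\<Sum>r\<in>UNIV. \<Sum>h\<in>UNIV. of_bool (A * r ^ 2 + B * (r * h) + (c + d) * h ^ 2 = 0))"
        unfolding iff sum_distrib_left by (intro sum.cong refl) simp
      also have "\<dots> = qc (nrm D c d) * (of_nat CARD('f) + (of_nat CARD('f) - 1) * qc (B ^ 2 - 4 * A * (c + d)))"
        by (simp only: sum_zeros_binary_form[OF ne])
      also have "B ^ 2 - 4 * A * (c + d) = pencil_disc D a b c d" by (simp add: pencil_disc_def A_def B_def)
      finally show ?thesis by (simp add: algebra_simps)
    qed
  qed
  also have "\<dots> = of_nat CARD('f) * (\<Sum>c\<in>UNIV. \<Sum>d\<in>UNIV. qc (nrm D c d)) +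
      (of_nat CARD('f) - 1) * (\<Sum>c\<in>UNIV. \<Sum>d\<in>UNIV. qc (nrm D c d) * qc (pencil_disc D a b c d))"
    by (simp only: sum.distrib sum_distrib_left)
  finally show ?thesis using q_minus_1_ne by (simp add: sum_qc_nrm[OF D(1)])
qed

lemma sum_pairs_scale:
  fixes f :: "'f \<Rightarrow> 'f \<Rightarrow> complex"
  assumes "k \<noteq> 0"
  shows "(\<Sum>a\<in>UNIV. \<Sum>b\<in>UNIV. f (k * a) (k * b)) = (\<Sum>a\<in>UNIV. \<Sum>b\<in>UNIV. f a b)"
  using sum_scale[OF assms, of "\<lambda>a. \<Sum>b\<in>UNIV. f a b"] sum_scale[OF assms] by simp

text \<open>
  On a finite set an injective change of variables is a permutation, so that invertibility of
  the linear substitutions below can be checked by injectivity alone.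
\<close>

lemma sum_inj_pairs:
  fixes g :: "'f \<times> 'f \<Rightarrow> complex" and T :: "'f \<times> 'f \<Rightarrow> 'f \<times> 'f"
  assumes "inj T"
  shows "(\<Sum>p\<in>UNIV. g (T p)) = (\<Sum>p\<in>UNIV. g p)"
  using sum.reindex_bij_betw[of T UNIV UNIV g] finite_UNIV_inj_surj[OF finite assms] assms
  by (simp add: bij_def)

text \<open>
  Multiplication by an element of \<open>F[s]\<close> with nonzero norm permutes \<open>F[s]\<close>.
\<close>

lemma sum_twist_pairs:
  fixes g :: "'f \<times> 'f \<Rightarrow> complex"
  assumes "nrm D a b \<noteq> 0"
  shows "(\<Sum>e\<in>UNIV. \<Sum>f\<in>UNIV. g (e * a + D * f * b, e * b + f * a)) = (\<Sum>c\<in>UNIV. \<Sum>d\<in>UNIV. g (c, d))"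
proof -
  define T where "T = (\<lambda>p. (fst p * a + D * snd p * b, fst p * b + snd p * a))"
  have inv: "fst p = (a * fst (T p) - D * b * snd (T p)) / nrm D a b \<and>
             snd p = (a * snd (T p) - b * fst (T p)) / nrm D a b" for p
    using assms by (simp add: T_def eq_divide_eq) (simp add: nrm_def algebra_simps power2_eq_square)
  hence "inj T" by (metis injI prod_eqI)
  hence "(\<Sum>p\<in>UNIV. g (T p)) = (\<Sum>p\<in>UNIV. g p)" by (rule sum_inj_pairs)
  thus ?thesis by (simp add: sum_UNIV_pair T_def)
qed

text \<open>
  If \<open>r\<close> and \<open>h\<close> are nonzero, then scaling \<open>\<zeta>\<close> by \<open>h / r\<close> reduces the inner sum to the
  inhomogeneous one. If \<open>r\<close> or \<open>h\<close> is zero, the second factor is constant wherever the first one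
  does not vanish, and what remains is a multiple of the vanishing sum of \<open>\<chi>\<close> over all norms.
\<close>

lemma norm_sum_homogeneous:
  assumes D: "D \<noteq> 0" "D \<noteq> 1"
  shows "(\<Sum>a\<in>UNIV. \<Sum>b\<in>UNIV. \<Sum>r\<in>UNIV. \<Sum>h\<in>UNIV.
            qc (nrm D a b) * qc (nrm D (quad_re D a b r h) (quad_im a b r h))) = (of_nat CARD('f) - 1) ^ 2 * norm_sum D"
proof -
  have inner: "(\<Sum>a\<in>UNIV. \<Sum>b\<in>UNIV. qc (nrm D a b) * qc (nrm D (quad_re D a b r h) (quad_im a b r h))) =
     (if r = 0 then 0 else if h = 0 then 0 else norm_sum D)" for r h
  proof -
    consider "r = 0" | "r \<noteq> 0" "h = 0" | "r \<noteq> 0" "h \<noteq> 0" by blast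
    thus ?thesis
    proof cases
      case 1
      hence "quad_re D a b r h = h ^ 2" "quad_im a b r h = - (h ^ 2)" for a b by (auto simp: quad_re_def quad_im_def)
      thus ?thesis using 1 sum_qc_nrm[OF D(1)] by (simp flip: sum_distrib_right)
    next
      case 2
      have eq: "qc (nrm D a b) * qc (nrm D (quad_re D a b r h) (quad_im a b r h)) = qc (nrm D a b)" for a b
      proof (cases "nrm D a b = 0")
        case False
        have "nrm D (quad_re D a b r h) (quad_im a b r h) = (2 * r ^ 2 * nrm D a b) ^ 2 * 1"
          using 2 by (simp add: nrm_def quad_re_def quad_im_def algebra_simps power2_eq_square)
        hence "qc (nrm D (quad_re D a b r h) (quad_im a b r h)) = qc 1"
          by (rule qc_eqI) (use False 2 in simp)
        thus ?thesis by simp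
      qed auto
      show ?thesis unfolding eq using 2 sum_qc_nrm[OF D(1)] by simp
    next
      case 3
      define k where "k = h / r"
      have k: "k \<noteq> 0" "r * k = h" using 3 by (auto simp: k_def)
      have "qc (nrm D (k * a) (k * b)) * qc (nrm D (quad_re D (k * a) (k * b) r h) (quad_im (k * a) (k * b) r h))
          = qc (nrm D a b) * qc (nrm D (quad_re D a b 1 1) (quad_im a b 1 1))" for a b
      proof -
        have "quad_re D (k * a) (k * b) r h = h ^ 2 * quad_re D a b 1 1"
             "quad_im (k * a) (k * b) r h = h ^ 2 * quad_im a b 1 1"
          unfolding k(2)[symmetric] by (simp_all add: quad_re_def quad_im_def algebra_simps power2_eq_square)
        moreover have h: "h ^ 2 \<noteq> 0" using 3 by simp
        ultimately show ?thesis by (simp only: nrm_scale qc_sq_mult[OF k(1)] qc_sq_mult[OF h])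
      qed
      thus ?thesis
        using sum_pairs_scale[OF k(1), of "\<lambda>a b. qc (nrm D a b) * qc (nrm D (quad_re D a b r h) (quad_im a b r h))"] 3
        by (simp add: norm_sum_def)
    qed
  qed
  have "(\<Sum>a\<in>UNIV. \<Sum>b\<in>UNIV. \<Sum>r\<in>UNIV. \<Sum>h\<in>UNIV.
            qc (nrm D a b) * qc (nrm D (quad_re D a b r h) (quad_im a b r h))) =
        (\<Sum>r\<in>UNIV. \<Sum>h\<in>UNIV. if r = (0::'f) then 0 else if h = (0::'f) then 0 else norm_sum D)"
    by (subst sum_swap_pairs) (simp only: inner)
  also have "\<dots> = (\<Sum>r\<in>UNIV. if r = (0::'f) then 0 else (of_nat CARD('f) - 1) * norm_sum D)"
    by (intro sum.cong refl) (simp add: sum_const_nonzero)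
  also have "\<dots> = (of_nat CARD('f) - 1) ^ 2 * norm_sum D"
    by (simp only: sum_const_nonzero power2_eq_square mult.assoc)
  finally show ?thesis .
qed

text \<open>
  The argument of \<open>g\<close> is half the trace of \<open>w = (1 + c s) \<zeta> / \<zeta>'\<close>, where \<open>\<zeta> = a + b s\<close> and \<open>\<zeta>'\<close>
  is its conjugate. As \<open>\<zeta>\<close> varies, \<open>\<zeta> / \<zeta>'\<close> runs \<open>Q - 1\<close> times through the elements of norm \<open>1\<close>
  (Hilbert 90), so \<open>w\<close> runs through the elements \<open>x + y s\<close> of norm \<open>1 - D\<close>. A given \<open>x\<close> arises
  from the solutions \<open>y\<close> of \<open>D y\<^sup>2 = x\<^sup>2 - (1 - D)\<close>. The proof counts directly the \<open>(a, b)\<close> with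
  given \<open>x\<close>: they are the nontrivial zeros of a binary quadratic form.
\<close>

lemma sum_twisted_trace:
  fixes g :: "'f \<Rightarrow> complex"
  assumes D: "D \<noteq> 0" "D \<noteq> 1" and c: "c ^ 2 = 1"
  shows "(\<Sum>a\<in>UNIV. \<Sum>b\<in>UNIV. if nrm D a b = 0 then 0
            else g ((a ^ 2 + D * b ^ 2 + 2 * c * D * a * b) / nrm D a b)) =
         (of_nat CARD('f) - 1) * (\<Sum>s\<in>UNIV. (1 + qc D * qc (s ^ 2 - (1 - D))) * g s)"
proof -
  define R where "R = (\<lambda>a b. a ^ 2 + D * b ^ 2 + 2 * c * D * a * b)"
  define S where "S = {p. nrm D (fst p) (snd p) \<noteq> 0}"
  define h where "h = (\<lambda>p. R (fst p) (snd p) / nrm D (fst p) (snd p))"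
  have "(\<Sum>a\<in>UNIV. \<Sum>b\<in>UNIV. if nrm D a b = 0 then 0 else g (R a b / nrm D a b)) =
        (\<Sum>p\<in>UNIV \<times> UNIV. if nrm D (fst p) (snd p) = 0 then 0 else g (h p))"
    unfolding h_def by (simp add: sum.cartesian_product case_prod_beta)
  also have "\<dots> = (\<Sum>p\<in>S. g (h p))"
    by (rule sum.mono_neutral_cong_right) (auto simp: S_def)
  also have "\<dots> = (\<Sum>s\<in>UNIV. of_nat (card {p\<in>S. h p = s}) * g s)"
    by (rule sum_fibers) auto
  also have "\<dots> = (\<Sum>s\<in>UNIV. (of_nat CARD('f) - 1) * (1 + qc D * qc (s ^ 2 - (1 - D))) * g s)"
  proof (intro sum.cong refl arg_cong2[where f = "(*)"])
    fix s
    define Z where "Z = {p. (1 - s) * fst p ^ 2 + (2 * c * D) * (fst p * snd p) + (D * (1 + s)) * snd p ^ 2 = 0}"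
    have eq: "R a b - s * nrm D a b = (1 - s) * a ^ 2 + (2 * c * D) * (a * b) + (D * (1 + s)) * b ^ 2" for a b
      by (simp add: R_def nrm_def algebra_simps)
    have zero: "a = 0 \<and> b = 0" if "nrm D a b = 0" "R a b = 0" for a b
    proof -
      have "2 * D * b * (b + c * a) = R a b - nrm D a b" by (simp add: R_def nrm_def algebra_simps power2_eq_square)
      hence b: "b = 0 \<or> b = - (c * a)" using that D by (auto simp: add_eq_0_iff2)
      have "nrm D a (- (c * a)) = a ^ 2 * (1 - D * c ^ 2)" by (simp add: nrm_def algebra_simps power2_eq_square)
      hence "nrm D a (- (c * a)) = a ^ 2 * (1 - D)" by (simp add: c)
      moreover have "nrm D a 0 = a ^ 2" by (simp add: nrm_def)
      ultimately show ?thesis using b that(1) D by auto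
    qed
    have "insert (0, 0) {p\<in>S. h p = s} = Z"
    proof -
      have "p = (0, 0) \<or> (p \<in> S \<and> h p = s) \<longleftrightarrow> p \<in> Z" for p
      proof (cases "nrm D (fst p) (snd p) = 0")
        case True
        hence "p \<in> Z \<longleftrightarrow> R (fst p) (snd p) = 0" using eq[of "fst p" "snd p"] by (simp add: Z_def)
        also have "\<dots> \<longleftrightarrow> p = (0, 0)" using zero[OF True] by (auto simp: prod_eq_iff R_def)
        finally show ?thesis using True by (auto simp: S_def)
      next
        case False
        hence "p \<noteq> (0, 0)" by (auto simp: nrm_def)
        moreover have "h p = s \<longleftrightarrow> R (fst p) (snd p) - s * nrm D (fst p) (snd p) = 0"
          using False by (simp add: h_def divide_eq_eq)
        ultimately show ?thesis using False by (simp add: S_def Z_def eq)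
      qed
      thus ?thesis by auto
    qed
    moreover have "(0, 0) \<notin> {p\<in>S. h p = s}" by (simp add: S_def nrm_def)
    ultimately have "card Z = Suc (card {p\<in>S. h p = s})" by (metis card_insert_disjoint finite)
    moreover have "of_nat (card Z) = of_nat CARD('f) + (of_nat CARD('f) - 1) * qc ((2 * c * D) ^ 2 - 4 * (1 - s) * (D * (1 + s)))"
    proof -
      have "of_nat (card Z) = (\<Sum>p\<in>UNIV \<times> UNIV. of_bool (p \<in> Z) :: complex)" by simp
      also have "\<dots> = (\<Sum>a\<in>UNIV. \<Sum>b\<in>UNIV. of_bool
           ((1 - s) * a ^ 2 + (2 * c * D) * (a * b) + (D * (1 + s)) * b ^ 2 = 0))"
        unfolding sum.cartesian_product by (intro sum.cong) (auto simp: Z_def)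
      also have "\<dots> = of_nat CARD('f) + (of_nat CARD('f) - 1) * qc ((2 * c * D) ^ 2 - 4 * (1 - s) * (D * (1 + s)))"
        by (rule sum_zeros_binary_form) (use D c in auto)
      finally show ?thesis .
    qed
    moreover have "(2 * c * D) ^ 2 - 4 * (1 - s) * (D * (1 + s)) = 2 ^ 2 * (D * (s ^ 2 - (1 - D)))"
    proof -
      have "(2 * c * D) ^ 2 - 4 * (1 - s) * (D * (1 + s)) = 4 * c ^ 2 * D ^ 2 - 4 * (1 - s) * (D * (1 + s))"
        by (simp add: power_mult_distrib)
      thus ?thesis unfolding c by (simp add: algebra_simps power2_eq_square)
    qed
    hence "qc ((2 * c * D) ^ 2 - 4 * (1 - s) * (D * (1 + s))) = qc D * qc (s ^ 2 - (1 - D))"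
      by (simp only: qc_sq_mult[OF two_ne]) (simp only: qc_mult)
    ultimately have "of_nat (Suc (card {p\<in>S. h p = s})) = of_nat CARD('f) + (of_nat CARD('f) - 1) * (qc D * qc (s ^ 2 - (1 - D)))"
      by simp
    thus "of_nat (card {p\<in>S. h p = s}) = (of_nat CARD('f) - 1) * (1 + qc D * qc (s ^ 2 - (1 - D)))"
      by (simp add: algebra_simps)
  qed
  finally show ?thesis unfolding R_def sum_distrib_left by (simp only: mult.assoc)
qed

text \<open>
  The discriminant separates the variables once \<open>(c, d)\<close> is written as a product of \<open>a + b s\<close>
  and \<open>e + f s\<close>: up to squares, \<open>D\<close> times the discriminant is the norm of \<open>e + f s\<close> times
  \<open>x + y - 2\<close>, where \<open>x\<close> depends only on \<open>(a, b)\<close> and \<open>y\<close> only on \<open>(e, f)\<close>.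
\<close>

lemma pencil_disc_product:
  assumes "D \<noteq> 0" "nrm D a b \<noteq> 0"
  shows "qc (nrm D a b) * (qc (nrm D (e * a + D * f * b) (e * b + f * a)) *
           qc (pencil_disc D a b (e * a + D * f * b) (e * b + f * a))) =
         (if nrm D e f = 0 then 0 else
           qc D * qc ((a ^ 2 + D * b ^ 2 + 2 * 1 * D * a * b) / nrm D a b +
                      (e ^ 2 + D * f ^ 2 + 2 * (-1) * D * e * f) / nrm D e f - 2))"
proof -
  define n where "n = nrm D a b"
  define k where "k = nrm D e f"
  define R where "R = a ^ 2 + D * b ^ 2 + 2 * 1 * D * a * b"
  define P where "P = e ^ 2 + D * f ^ 2 + 2 * (-1) * D * e * f"
  have n: "n \<noteq> 0" using assms by (simp add: n_def)
  have kn: "nrm D (e * a + D * f * b) (e * b + f * a) = k * n"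
    by (simp add: nrm_def k_def n_def algebra_simps power2_eq_square)
  have "D * pencil_disc D a b (e * a + D * f * b) (e * b + f * a) = 2 ^ 2 * (n * (k * R + n * P - 2 * n * k))"
    by (simp add: pencil_disc_def nrm_def k_def n_def R_def P_def algebra_simps power2_eq_square)
  hence "qc (D * pencil_disc D a b (e * a + D * f * b) (e * b + f * a)) = qc (n * (k * R + n * P - 2 * n * k))"
    by (rule qc_eqI) simp
  hence d: "qc (pencil_disc D a b (e * a + D * f * b) (e * b + f * a)) = qc D * (qc n * qc (k * R + n * P - 2 * n * k))"
    using qc_self_left[OF assms(1)] by (metis qc_mult)
  have "qc n * (qc (k * n) * (qc D * (qc n * qc (k * R + n * P - 2 * n * k)))) =
        qc D * (qc (k * n) * qc (k * R + n * P - 2 * n * k))"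
    using qc_self[OF n] by (simp add: mult_ac)
  also have "\<dots> = (if k = 0 then 0 else qc D * qc (R / n + P / k - 2))"
  proof (cases "k = 0")
    case False
    have "k * n * (k * R + n * P - 2 * n * k) = (k * n) ^ 2 * (R / n + P / k - 2)"
      using n False by (simp add: field_simps power2_eq_square)
    hence "qc (k * n * (k * R + n * P - 2 * n * k)) = qc (R / n + P / k - 2)"
      by (rule qc_eqI) (use n False in simp)
    thus ?thesis using False by (simp only: qc_mult if_False)
  qed simp
  finally show ?thesis unfolding kn d n_def[symmetric] k_def[symmetric] R_def[symmetric] P_def[symmetric] .
qed

text \<open>
  After passing to the homogeneous sum and to discriminants, the variables \<open>(a, b)\<close> and \<open>(e, f)\<close>
  separate: they enter only through the first coordinates, \<open>x\<close> and \<open>s\<close>, of two points on the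
  conic \<open>x\<^sup>2 - D y\<^sup>2 = 1 - D\<close>. Counting how often these values occur introduces the factors
  \<open>1 + \<chi>(D) \<chi>(x\<^sup>2 - (1 - D))\<close>; after multiplying out, the sums in which one of the variables
  occurs only in \<open>\<chi> (x + s - 2)\<close> vanish.
\<close>

theorem norm_sum_eq_conic_pair_sum:
  assumes D: "D \<noteq> 0" "D \<noteq> 1"
  shows "norm_sum D = qc D * conic_pair_sum (1 - D)"
proof -
  define R where "R = (\<lambda>c a b. (a ^ 2 + D * b ^ 2 + 2 * c * D * a * b) / nrm D a b)"
  have "(of_nat CARD('f) - 1) ^ 2 * norm_sum D = (\<Sum>a\<in>UNIV. \<Sum>b\<in>UNIV. qc (nrm D a b) *
          (\<Sum>r\<in>UNIV. \<Sum>h\<in>UNIV. qc (nrm D (quad_re D a b r h) (quad_im a b r h))))"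
    by (simp only: norm_sum_homogeneous[OF D, symmetric] sum_distrib_left)
  also have "\<dots> = (\<Sum>a\<in>UNIV. \<Sum>b\<in>UNIV. if nrm D a b = 0 then 0 else
      (\<Sum>e\<in>UNIV. \<Sum>f\<in>UNIV. if nrm D e f = 0 then 0 else qc D * qc (R 1 a b + R (-1) e f - 2)))"
  proof (intro sum.cong refl)
    fix a b
    show "qc (nrm D a b) * (\<Sum>r\<in>UNIV. \<Sum>h\<in>UNIV. qc (nrm D (quad_re D a b r h) (quad_im a b r h))) =
      (if nrm D a b = 0 then 0 else
      (\<Sum>e\<in>UNIV. \<Sum>f\<in>UNIV. if nrm D e f = 0 then 0 else qc D * qc (R 1 a b + R (-1) e f - 2)))"
    proof (cases "nrm D a b = 0")
      case False
      define g where "g = (\<lambda>p. qc (nrm D a b) * (qc (nrm D (fst p) (snd p)) * qc (pencil_disc D a b (fst p) (snd p))))"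
      have "qc (nrm D a b) * (\<Sum>r\<in>UNIV. \<Sum>h\<in>UNIV. qc (nrm D (quad_re D a b r h) (quad_im a b r h))) =
            (\<Sum>c\<in>UNIV. \<Sum>d\<in>UNIV. g (c, d))"
        unfolding sum_pencil[OF D False] g_def sum_distrib_left by simp
      also have "\<dots> = (\<Sum>e\<in>UNIV. \<Sum>f\<in>UNIV. g (e * a + D * f * b, e * b + f * a))"
        by (rule sum_twist_pairs[OF False, symmetric])
      also have "\<dots> = (\<Sum>e\<in>UNIV. \<Sum>f\<in>UNIV. if nrm D e f = 0 then 0 else qc D * qc (R 1 a b + R (-1) e f - 2))"
        unfolding g_def fst_conv snd_conv pencil_disc_product[OF D(1) False] R_def ..
      finally show ?thesis using False by simp
    qed simp
  qed
  also have "\<dots> = (\<Sum>a\<in>UNIV. \<Sum>b\<in>UNIV. if nrm D a b = 0 then 0 else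
      (of_nat CARD('f) - 1) * (\<Sum>s\<in>UNIV. (1 + qc D * qc (s ^ 2 - (1 - D))) * (qc D * qc (R 1 a b + s - 2))))"
  proof (intro sum.cong refl if_cong)
    fix a b
    show "(\<Sum>e\<in>UNIV. \<Sum>f\<in>UNIV. if nrm D e f = 0 then 0 else qc D * qc (R 1 a b + R (-1) e f - 2)) =
      (of_nat CARD('f) - 1) * (\<Sum>s\<in>UNIV. (1 + qc D * qc (s ^ 2 - (1 - D))) * (qc D * qc (R 1 a b + s - 2)))"
      unfolding R_def by (rule sum_twisted_trace[OF D, of "-1"]) simp
  qed
  also have "\<dots> = (of_nat CARD('f) - 1) * (\<Sum>x\<in>UNIV. (1 + qc D * qc (x ^ 2 - (1 - D))) *
      ((of_nat CARD('f) - 1) * (\<Sum>s\<in>UNIV. (1 + qc D * qc (s ^ 2 - (1 - D))) * (qc D * qc (x + s - 2)))))"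
    unfolding R_def by (rule sum_twisted_trace[OF D, of 1]) simp
  also have "\<dots> = (of_nat CARD('f) - 1) ^ 2 * (\<Sum>x\<in>UNIV. (1 + qc D * qc (x ^ 2 - (1 - D))) *
      (\<Sum>s\<in>UNIV. (1 + qc D * qc (s ^ 2 - (1 - D))) * (qc D * qc (x + s - 2))))"
    by (simp add: sum_distrib_left power2_eq_square mult_ac)
  finally have "norm_sum D = (\<Sum>x\<in>UNIV. (1 + qc D * qc (x ^ 2 - (1 - D))) *
      (\<Sum>s\<in>UNIV. (1 + qc D * qc (s ^ 2 - (1 - D))) * (qc D * qc (x + s - 2))))"
    using q_minus_1_ne by simp
  also have "\<dots> = (\<Sum>x\<in>UNIV. (1 + qc D * qc (x ^ 2 - (1 - D))) *
      (\<Sum>s\<in>UNIV. qc (s ^ 2 - (1 - D)) * qc (x + s - 2)))"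
  proof (rule sum.cong[OF refl], rule arg_cong2[where f = "(*)", OF refl])
    fix x
    have "(\<Sum>s\<in>UNIV. (1 + qc D * qc (s ^ 2 - (1 - D))) * (qc D * qc (x + s - 2))) =
          (\<Sum>s\<in>UNIV. qc D * qc (s + (x - 2)) + (qc D * qc D) * (qc (s ^ 2 - (1 - D)) * qc (x + s - 2)))"
      by (intro sum.cong refl) (simp add: algebra_simps)
    also have "\<dots> = (\<Sum>s\<in>UNIV. qc (s ^ 2 - (1 - D)) * qc (x + s - 2))"
      by (simp only: sum.distrib sum_distrib_left[symmetric] sum_qc_shift qc_self[OF D(1)]) simp
    finally show "(\<Sum>s\<in>UNIV. (1 + qc D * qc (s ^ 2 - (1 - D))) * (qc D * qc (x + s - 2))) =
          (\<Sum>s\<in>UNIV. qc (s ^ 2 - (1 - D)) * qc (x + s - 2))" .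
  qed
  also have "\<dots> = (\<Sum>x\<in>UNIV. \<Sum>s\<in>UNIV. qc (s ^ 2 - (1 - D)) * qc (x + s - 2)) + qc D * conic_pair_sum (1 - D)"
  proof -
    have "(1 + u) * w = w + u * w" for u w :: complex by (simp add: algebra_simps)
    thus ?thesis
      by (simp only: sum.distrib conic_pair_sum_def sum_distrib_left qc_mult mult.assoc)
  qed
  also have "(\<Sum>x\<in>UNIV. \<Sum>s\<in>UNIV. qc (s ^ 2 - (1 - D)) * qc (x + s - 2)) =
             (\<Sum>s\<in>UNIV. qc (s ^ 2 - (1 - D)) * (\<Sum>x\<in>UNIV. qc (x + (s - 2))))"
    by (subst sum.swap) (simp only: sum_distrib_left add_diff_eq)
  also have "\<dots> = 0" by (simp only: sum_qc_shift) simp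
  finally show ?thesis by simp
qed

section \<open>The K3 sum in terms of elliptic curves\<close>

definition cubic_sum :: "'f \<Rightarrow> complex" where
  "cubic_sum u = (\<Sum>z\<in>UNIV. qc (z * (z ^ 2 - 2 * z + u)))"

text \<open>
  The 2-isogenous curve of \<open>y\<^sup>2 = z (z\<^sup>2 - 2 z + u)\<close> is \<open>y\<^sup>2 = v (v\<^sup>2 + 4 v + 4 (1 - u))\<close>, and the
  substitution \<open>v = - 2 z\<close> brings it back to the original shape, twisted by \<open>2\<close>.
\<close>

lemma cubic_sum_isogeny: "cubic_sum (1 - u) = qc 2 * cubic_sum u"
proof -
  have "cubic_sum u = (\<Sum>v\<in>UNIV. qc (v * (v ^ 2 + (-2) * v + u)))"
    by (simp add: cubic_sum_def)
  also have "\<dots> = (\<Sum>v\<in>UNIV. qc (v * (v ^ 2 - 2 * (-2) * v + ((-2) ^ 2 - 4 * u))))"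
    by (rule sum_2_isogeny)
  also have "\<dots> = (\<Sum>v\<in>UNIV. qc ((-2) * v * (((-2) * v) ^ 2 - 2 * (-2) * ((-2) * v) + ((-2) ^ 2 - 4 * u))))"
    by (rule sum_scale[of "-2" "\<lambda>v. qc (v * (v ^ 2 - 2 * (-2) * v + ((-2) ^ 2 - 4 * u)))", symmetric]) simp
  also have "\<dots> = (\<Sum>v\<in>UNIV. qc (2 ^ 2 * (- (2 * (v * (v ^ 2 - 2 * v + (1 - u)))))))"
    by (intro sum.cong refl arg_cong[where f = qc]) (simp add: algebra_simps power2_eq_square)
  also have "\<dots> = qc 2 * cubic_sum (1 - u)"
    unfolding cubic_sum_def sum_distrib_left
    by (intro sum.cong refl) (simp only: qc_sq_mult[OF two_ne] qc_minus, simp only: qc_mult)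
  finally show ?thesis using qc_self_left[OF two_ne] by simp
qed

text \<open>
  If \<open>D = s\<^sup>2\<close> with \<open>s\<close> in \<open>F\<close>, then \<open>a + b s \<mapsto> (a + s b, a - s b)\<close> identifies the algebra with
  \<open>F \<times> F\<close> and the norm with the product of the two components.
\<close>

lemma norm_sum_split:
  assumes "s \<noteq> 0"
  shows "norm_sum (s ^ 2) = cubic_sum ((1 - s) / 2) * cubic_sum ((1 + s) / 2)"
proof -
  define h :: "'f \<Rightarrow> 'f \<Rightarrow> 'f" where "h = (\<lambda>s z. z * (z ^ 2 - 2 * z + (1 - s) / 2))"
  define g where "g = (\<lambda>p. qc (h s (fst p)) * qc (h (- s) (snd p)))"
  have "norm_sum (s ^ 2) = (\<Sum>a\<in>UNIV. \<Sum>b\<in>UNIV. g (a + s * b, a - s * b))"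
    unfolding norm_sum_def
  proof (intro sum.cong refl)
    fix a b :: 'f
    have half: "2 * (x / 2) = x" for x :: 'f by simp
    define G where "G = (\<lambda>s. (a + s * b) ^ 2 - 2 * (a + s * b) + (1 - s) / 2)"
    have G: "quad_re (s ^ 2) a b 1 1 + s * quad_im a b 1 1 = 2 * G s" for s
      unfolding G_def distrib_left half by (simp add: quad_re_def quad_im_def algebra_simps power2_eq_square)
    have h: "h s (a + s * b) = (a + s * b) * G s" "h (- s) (a - s * b) = (a + (- s) * b) * G (- s)"
      by (simp_all add: h_def G_def)
    have "nrm (s ^ 2) x y = (x + s * y) * (x + (- s) * y)" for x y
      by (simp add: nrm_def algebra_simps power2_eq_square)
    hence "nrm (s ^ 2) a b * nrm (s ^ 2) (quad_re (s ^ 2) a b 1 1) (quad_im a b 1 1) =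
       (a + s * b) * (a + (- s) * b) * ((quad_re (s ^ 2) a b 1 1 + s * quad_im a b 1 1) *
         (quad_re ((- s) ^ 2) a b 1 1 + (- s) * quad_im a b 1 1))"
      by (simp only: power2_minus)
    also have "\<dots> = 2 ^ 2 * (h s (a + s * b) * h (- s) (a - s * b))"
      unfolding G h by (simp only: power2_eq_square mult_ac)
    finally show "qc (nrm (s ^ 2) a b) * qc (nrm (s ^ 2) (quad_re (s ^ 2) a b 1 1) (quad_im a b 1 1)) =
       g (a + s * b, a - s * b)"
      unfolding g_def by (simp only: qc_mult[symmetric] qc_sq_mult[OF two_ne] fst_conv snd_conv)
  qed
  also have "\<dots> = (\<Sum>p\<in>UNIV. g (fst p + s * snd p, fst p - s * snd p))"
    by (rule sum_UNIV_pair)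
  also have "\<dots> = (\<Sum>p\<in>UNIV. g p)"
  proof (rule sum_inj_pairs, rule injI)
    fix x y :: "'f \<times> 'f"
    assume "(fst x + s * snd x, fst x - s * snd x) = (fst y + s * snd y, fst y - s * snd y)"
    hence e: "fst x + s * snd x = fst y + s * snd y" "fst x - s * snd x = fst y - s * snd y" by auto
    have "2 * fst z = (fst z + s * snd z) + (fst z - s * snd z)" for z :: "'f \<times> 'f" by simp
    hence "2 * fst x = 2 * fst y" by (simp only: e)
    thus "x = y" using e assms by (simp add: prod_eq_iff)
  qed
  also have "\<dots> = (\<Sum>a\<in>UNIV. \<Sum>b\<in>UNIV. g (a, b))" by (simp add: sum_UNIV_pair)
  also have "\<dots> = cubic_sum ((1 - s) / 2) * cubic_sum ((1 + s) / 2)"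
    by (simp add: g_def h_def cubic_sum_def sum_product)
  finally show ?thesis .
qed

text \<open>
  The two elliptic curves in \<open>norm_sum_split\<close> have parameters \<open>u\<close> and \<open>1 - u\<close>, so they are
  isogenous up to the twist by \<open>2\<close> and the product of their sums is a square up to \<open>\<chi>(2)\<close>.
\<close>

theorem k3_sum_split:
  assumes "t \<noteq> 0" "s ^ 2 = 1 - t" "s \<noteq> 0"
  shows "k3_sum t = cubic_sum ((1 - s) / 2) ^ 2 - of_nat CARD('f)"
proof -
  have "1 - (1 - s) / 2 = (2 - (1 - s)) / 2" by (simp only: diff_divide_distrib) simp
  hence half: "1 - (1 - s) / 2 = (1 + s) / 2" by (simp only: diff_diff_eq2) (simp add: add.commute)
  have i: "cubic_sum ((1 + s) / 2) = qc 2 * cubic_sum ((1 - s) / 2)"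
    using cubic_sum_isogeny[of "(1 - s) / 2"] unfolding half .
  have "qc 2 * (k3_sum t + of_nat CARD('f)) = conic_pair_sum (1 - s ^ 2)"
    using conic_pair_sum_eq[OF assms(1)] by (simp add: assms(2))
  also have "\<dots> = qc (s ^ 2) * conic_pair_sum (1 - s ^ 2)" using assms(3) by simp
  also have "\<dots> = norm_sum (s ^ 2)"
    by (rule norm_sum_eq_conic_pair_sum[symmetric]) (use assms in auto)
  also have "\<dots> = qc 2 * cubic_sum ((1 - s) / 2) ^ 2"
    unfolding norm_sum_split[OF assms(3)] i by (simp add: power2_eq_square mult_ac)
  finally have "qc 2 * (qc 2 * (k3_sum t + of_nat CARD('f))) = qc 2 * (qc 2 * cubic_sum ((1 - s) / 2) ^ 2)"
    by (simp only:)
  hence "k3_sum t + of_nat CARD('f) = cubic_sum ((1 - s) / 2) ^ 2"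
    by (simp only: qc_self_left[OF two_ne])
  thus ?thesis by (simp add: algebra_simps)
qed

theorem k3_sum_nonsplit:
  assumes "t \<noteq> 0" "t \<noteq> 1" "qc (1 - t) = -1"
  shows "k3_sum t = - qc 2 * norm_sum (1 - t) - of_nat CARD('f)"
proof -
  have "norm_sum (1 - t) = - (qc 2 * (k3_sum t + of_nat CARD('f)))"
    using norm_sum_eq_conic_pair_sum[of "1 - t"] conic_pair_sum_eq[of t] assms by simp
  hence "qc 2 * norm_sum (1 - t) = - (qc 2 * (qc 2 * (k3_sum t + of_nat CARD('f))))" by simp
  hence "qc 2 * norm_sum (1 - t) = - (k3_sum t + of_nat CARD('f))"
    by (simp only: qc_self_left[OF two_ne])
  thus ?thesis by (simp only: mult_minus_left) simp
qed

end

section \<open>L-functions of characters on monic polynomials\<close>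

text \<open>
  All finite extensions of the field with \<open>q\<close> elements live in one algebraically closed field,
  in which \<open>fixed r\<close> is the subfield with \<open>q\<^sup>r\<close> elements. Polynomials over the base field are
  polynomials whose coefficients are fixed by Frobenius.
\<close>

locale frobenius_field =
  fixes ty :: "'a::alg_closed_field itself" and q :: nat
  assumes q_ge_2: "q \<ge> 2"
    and frob_add: "(x + y) ^ q = (x ^ q + y ^ q :: 'a)"
begin

definition fixed :: "nat \<Rightarrow> 'a set" where
  "fixed r = {x. x ^ (q ^ r) = x}"

lemma q_pow_pos: "q ^ r > 0"
  using q_ge_2 by simp

lemma frob_pow_add: "(x + y :: 'a) ^ (q ^ r) = x ^ (q ^ r) + y ^ (q ^ r)"
  by (induction r) (simp_all add: power_mult frob_add mult.commute[of q])

lemma frob_pow_0: "(0::'a) ^ (q ^ r) = 0"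
  using q_pow_pos by simp

lemma frob_pow_uminus: "(- x :: 'a) ^ (q ^ r) = - (x ^ (q ^ r))"
  using frob_pow_add[of x "- x" r] by (simp add: frob_pow_0 add_eq_0_iff)

lemma frob_pow_sum: "(\<Sum>i\<in>A. f i :: 'a) ^ (q ^ r) = (\<Sum>i\<in>A. f i ^ (q ^ r))"
  by (induction A rule: infinite_finite_induct) (simp_all add: frob_pow_0 frob_pow_add)

lemma frob_uminus: "(- x :: 'a) ^ q = - (x ^ q)"
  using frob_pow_uminus[of x 1] by simp

lemma frob_sum: "(\<Sum>i\<in>A. f i :: 'a) ^ q = (\<Sum>i\<in>A. f i ^ q)"
  using frob_pow_sum[of f A 1] by simp

lemma frob_0: "(0::'a) ^ q = 0"
  using q_ge_2 by simp

lemma frob_inj: "x ^ (q ^ r) = y ^ (q ^ r) \<Longrightarrow> x = (y::'a)"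
proof -
  assume "x ^ (q ^ r) = y ^ (q ^ r)"
  hence "(x + - y) ^ (q ^ r) = 0" by (simp only: frob_pow_add frob_pow_uminus) simp
  thus "x = y" using q_pow_pos by simp
qed

lemma fixed_closed:
  "0 \<in> fixed r" "1 \<in> fixed r"
  "x \<in> fixed r \<Longrightarrow> y \<in> fixed r \<Longrightarrow> x + y \<in> fixed r"
  "x \<in> fixed r \<Longrightarrow> y \<in> fixed r \<Longrightarrow> x * y \<in> fixed r"
  "x \<in> fixed r \<Longrightarrow> - x \<in> fixed r"
  "x \<in> fixed r \<Longrightarrow> inverse x \<in> fixed r"
  by (simp_all add: fixed_def frob_pow_0 frob_pow_add frob_pow_uminus power_mult_distrib power_inverse)

lemma finite_fixed: "r > 0 \<Longrightarrow> finite (fixed r)"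
proof -
  assume r: "r > 0"
  define p :: "'a poly" where "p = monom 1 (q ^ r) - [:0, 1:]"
  have "q ^ r > 1" using q_ge_2 r by (intro one_less_power) auto
  hence "coeff p (q ^ r) = 1" using r by (auto simp: p_def coeff_pCons split: nat.split)
  hence "p \<noteq> 0" by auto
  moreover have "fixed r = {x. poly p x = 0}" by (auto simp: p_def fixed_def poly_monom)
  ultimately show ?thesis by (simp add: poly_roots_finite)
qed

lemma fixed_mult: "x \<in> fixed d \<Longrightarrow> x ^ (q ^ (d * e)) = x"
proof (induction e)
  case (Suc e)
  have "x ^ (q ^ (d * Suc e)) = (x ^ (q ^ d)) ^ (q ^ (d * e))"
    by (simp add: power_add power_mult[symmetric])
  thus ?case using Suc by (simp add: fixed_def)
qed simp

lemma frob_mod: "x \<in> fixed d \<Longrightarrow> x ^ (q ^ i) = x ^ (q ^ (i mod d))"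
proof -
  assume x: "x \<in> fixed d"
  have "x ^ (q ^ i) = x ^ (q ^ (d * (i div d) + i mod d))" by simp
  also have "\<dots> = (x ^ (q ^ (d * (i div d)))) ^ (q ^ (i mod d))"
    by (simp only: power_add power_mult)
  finally show ?thesis using fixed_mult[OF x] by simp
qed

definition frob_poly :: "'a poly \<Rightarrow> 'a poly" where
  "frob_poly g = map_poly (\<lambda>x. x ^ q) g"

lemma coeff_frob_poly [simp]: "coeff (frob_poly g) i = coeff g i ^ q"
  by (simp add: frob_poly_def coeff_map_poly frob_0)

lemma frob_poly_mult: "frob_poly (g * h) = frob_poly g * frob_poly h"
  by (rule poly_eqI) (simp add: coeff_mult frob_sum power_mult_distrib)

lemma frob_poly_1: "frob_poly 1 = 1"
  by (rule poly_eqI) (simp add: frob_0)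

lemma frob_poly_linear: "frob_poly [:- x, 1:] = [:- (x ^ q), 1:]"
  by (rule poly_eqI) (auto simp: coeff_pCons frob_uminus frob_0 split: nat.split)

lemma frob_poly_prod: "frob_poly (\<Prod>i\<in>A. f i) = (\<Prod>i\<in>A. frob_poly (f i))"
  by (induction A rule: infinite_finite_induct) (simp_all add: frob_poly_1 frob_poly_mult)

lemma poly_frob_poly: "poly (frob_poly g) (x ^ q) = poly g x ^ q"
proof -
  have "degree (frob_poly g) = degree g"
    unfolding frob_poly_def by (rule degree_map_poly) simp
  hence "poly (frob_poly g) (x ^ q) = (\<Sum>i\<le>degree g. coeff (frob_poly g) i * (x ^ q) ^ i)"
    by (simp only: poly_altdef)
  also have "\<dots> = (\<Sum>i\<le>degree g. (coeff g i * x ^ i) ^ q)"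
    by (intro sum.cong refl) (simp add: power_mult_distrib mult.commute flip: power_mult)
  also have "\<dots> = poly g x ^ q" by (simp add: poly_altdef frob_sum)
  finally show ?thesis .
qed

text \<open>The monic polynomials of degree \<open>n\<close> over the base field.\<close>

definition Mon :: "nat \<Rightarrow> 'a poly set" where
  "Mon n = {g. degree g = n \<and> lead_coeff g = 1 \<and> frob_poly g = g}"

lemma Mon_nonzero: "g \<in> Mon n \<Longrightarrow> g \<noteq> 0"
  by (auto simp: Mon_def)

lemma Mon_0: "Mon 0 = {1}"
proof -
  have "g = 1" if "g \<in> Mon 0" for g
    using that by (auto simp: Mon_def elim!: degree_eq_zeroE)
  moreover have "1 \<in> Mon 0" by (simp add: Mon_def frob_poly_1)
  ultimately show ?thesis by auto
qed

lemma finite_Mon: "finite (Mon n)"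
proof -
  have "Mon n \<subseteq> (\<lambda>xs. Poly xs) ` {xs. set xs \<subseteq> fixed 1 \<and> length xs = Suc n}"
  proof
    fix g assume g: "g \<in> Mon n"
    have "set (coeffs g) \<subseteq> fixed 1"
    proof
      fix c assume "c \<in> set (coeffs g)"
      then obtain i where "c = coeff g i" by (auto simp: coeffs_def split: if_splits)
      moreover have "coeff (frob_poly g) i = coeff g i" using g by (simp add: Mon_def)
      ultimately show "c \<in> fixed 1" by (simp add: fixed_def)
    qed
    moreover have "length (coeffs g) = Suc n" using g Mon_nonzero[OF g]
      by (auto simp: Mon_def length_coeffs)
    ultimately show "g \<in> (\<lambda>xs. Poly xs) ` {xs. set xs \<subseteq> fixed 1 \<and> length xs = Suc n}"
      by (intro image_eqI[of _ _ "coeffs g"]) auto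
  qed
  thus ?thesis by (rule finite_subset) (intro finite_imageI finite_lists_length_eq finite_fixed, simp)
qed

lemma Mon_mult:
  assumes "g \<in> Mon m" "h \<in> Mon n"
  shows "g * h \<in> Mon (m + n)"
  using assms Mon_nonzero[OF assms(1)] Mon_nonzero[OF assms(2)]
  by (auto simp: Mon_def degree_mult_eq frob_poly_mult coeff_mult_degree_sum)

lemma Mon_cofactor:
  assumes "g \<in> Mon n" "h \<in> Mon r" "g = h * k"
  shows "r \<le> n" "k \<in> Mon (n - r)"
proof -
  have nz: "h \<noteq> 0" "k \<noteq> 0" using Mon_nonzero[OF assms(1)] assms(3) by auto
  have deg: "n = r + degree k" using assms nz by (auto simp: Mon_def degree_mult_eq)
  thus "r \<le> n" by simp
  have "h * frob_poly k = h * k" using assms frob_poly_mult[of h k] by (auto simp: Mon_def)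
  hence "frob_poly k = k" using nz by simp
  moreover have "lead_coeff k = 1" using assms lead_coeff_mult[of h k] by (auto simp: Mon_def)
  ultimately show "k \<in> Mon (n - r)" using deg by (simp add: Mon_def)
qed

text \<open>
  The characteristic polynomial over the base field of the element \<open>x\<close> of its extension of
  degree \<open>r\<close>: a power of the minimal polynomial.
\<close>

definition conj_poly :: "nat \<Rightarrow> 'a \<Rightarrow> 'a poly" where
  "conj_poly r x = (\<Prod>i<r. [:- (x ^ (q ^ i)), 1:])"

lemma conj_poly_in_Mon:
  assumes "x \<in> fixed r"
  shows "conj_poly r x \<in> Mon r"
proof -
  have "degree (conj_poly r x) = (\<Sum>i<r. degree [:- (x ^ (q ^ i)), 1:])" unfolding conj_poly_def
    by (rule degree_prod_eq_sum_degree) auto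
  hence "degree (conj_poly r x) = r" by simp
  moreover have "lead_coeff (conj_poly r x) = 1" unfolding conj_poly_def lead_coeff_prod by simp
  moreover have "frob_poly (conj_poly r x) = conj_poly r x"
  proof (cases r)
    case (Suc s)
    have "frob_poly (conj_poly r x) = (\<Prod>i<r. [:- (x ^ (q ^ Suc i)), 1:])"
      unfolding conj_poly_def frob_poly_prod frob_poly_linear
      by (simp only: power_mult[symmetric] power_Suc2)
    also have "\<dots> = (\<Prod>i<s. [:- (x ^ (q ^ Suc i)), 1:]) * [:- (x ^ (q ^ r)), 1:]"
      unfolding Suc by (simp only: prod.lessThan_Suc)
    also have "x ^ (q ^ r) = x ^ (q ^ 0)" using assms by (simp add: fixed_def)
    also have "(\<Prod>i<s. [:- (x ^ (q ^ Suc i)), 1:]) * [:- (x ^ (q ^ 0)), 1:] = conj_poly r x"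
      unfolding conj_poly_def Suc prod.lessThan_Suc_shift by (simp only: mult.commute)
    finally show ?thesis .
  qed (simp add: conj_poly_def frob_poly_1)
  ultimately show ?thesis by (simp add: Mon_def)
qed

lemma conj_poly_mult:
  assumes "x \<in> fixed d"
  shows "conj_poly (e * d) x = conj_poly d x ^ e"
proof -
  have "(\<Prod>i\<in>{m * d..<m * d + d}. [:- (x ^ (q ^ i)), 1:]) = conj_poly d x" for m
  proof -
    have "(\<Prod>i\<in>{m * d..<m * d + d}. [:- (x ^ (q ^ i)), 1:]) = (\<Prod>i<d. [:- (x ^ (q ^ (i + m * d))), 1:])"
      by (rule prod.reindex_bij_witness[of _ "\<lambda>i. i + m * d" "\<lambda>i. i - m * d"]) auto
    also have "\<dots> = conj_poly d x" unfolding conj_poly_def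
      by (intro prod.cong refl) (simp add: frob_mod[OF assms, of "_ + m * d"] frob_mod[OF assms, symmetric])
    finally show ?thesis .
  qed
  thus ?thesis using prod.nat_group[of "\<lambda>i. [:- (x ^ (q ^ i)), 1:]" d e]
    by (simp add: conj_poly_def)
qed

lemma linear_dvd_conj_poly: "r > 0 \<Longrightarrow> [:- x, 1:] dvd conj_poly r x"
proof -
  assume "r > 0"
  hence "[:- (x ^ (q ^ 0)), 1:] dvd conj_poly r x" unfolding conj_poly_def by (intro dvd_prodI) auto
  thus ?thesis by simp
qed

text \<open>
  Frobenius fixes \<open>g\<close> and sends the factor \<open>X - y\<close> to \<open>X - y\<^sup>q\<close>.
\<close>

lemma order_frob_le:
  assumes "g \<in> Mon n"
  shows "order x g \<le> order (x ^ (q ^ i)) g"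
proof (induction i)
  case (Suc i)
  let ?y = "x ^ (q ^ i)"
  have g: "g \<noteq> 0" "frob_poly g = g" using assms Mon_nonzero by (auto simp: Mon_def)
  have "[:- ?y, 1:] ^ order ?y g dvd g" by (rule order_1)
  then obtain k where k: "g = [:- ?y, 1:] ^ order ?y g * k" by (elim dvdE)
  have "frob_poly ([:- ?y, 1:] ^ m) = [:- (?y ^ q), 1:] ^ m" for m
    by (induction m) (simp_all only: power_0 power_Suc frob_poly_1 frob_poly_mult frob_poly_linear)
  hence "g = [:- (?y ^ q), 1:] ^ order ?y g * frob_poly k"
    using g(2) k by (metis frob_poly_mult)
  hence "[:- (?y ^ q), 1:] ^ order ?y g dvd g" by (metis dvd_triv_left)
  hence "order ?y g \<le> order (?y ^ q) g" using g(1) by (simp add: order_divides)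
  moreover have "?y ^ q = x ^ (q ^ Suc i)" by (simp only: power_mult[symmetric] power_Suc2)
  ultimately show ?case using Suc by simp
qed simp

lemma prod_linear_power_dvd:
  fixes g :: "'a poly"
  assumes "finite S" "g \<noteq> 0" "\<And>y. y \<in> S \<Longrightarrow> e \<le> order y g"
  shows "(\<Prod>y\<in>S. [:- y, 1:] ^ e) dvd g"
  using assms
proof (induction S arbitrary: g)
  case (insert y S)
  have "[:- y, 1:] ^ e dvd g" using insert.prems(2)[of y] by (simp add: order_divides)
  then obtain k where k: "g = [:- y, 1:] ^ e * k" by (elim dvdE)
  have k0: "k \<noteq> 0" using insert.prems k by auto
  have "e \<le> order z k" if "z \<in> S" for z
  proof -
    have "z \<noteq> y" using that insert by auto
    hence "poly ([:- y, 1:] ^ e) z \<noteq> 0" by simp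
    hence "order z ([:- y, 1:] ^ e) = 0" by (rule order_0I)
    hence "order z g = order z k" using insert.prems(1) unfolding k by (simp add: order_mult)
    thus ?thesis using insert.prems(2)[of z] that by simp
  qed
  hence "(\<Prod>y\<in>S. [:- y, 1:] ^ e) dvd k" by (rule insert.IH[OF k0])
  thus ?case using insert.hyps unfolding k by (simp add: mult_dvd_mono)
qed simp

lemma sum_order_alg_closed:
  fixes g :: "'a poly"
  assumes "g \<noteq> 0"
  shows "(\<Sum>x | poly g x = 0. order x g) = degree g"
  using assms
proof (induction "degree g" arbitrary: g)
  case 0
  then obtain c where "g = [:c:]" "c \<noteq> 0" by (metis degree_eq_zeroE pCons_eq_0_iff)
  thus ?case by simp
next
  case (Suc n)
  have "degree g > 0" using Suc.hyps by simp
  then obtain a where a: "poly g a = 0" using alg_closed_imp_poly_has_root by blast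
  then obtain k where k: "g = [:- a, 1:] * k" by (metis dvdE poly_eq_0_iff_dvd)
  have k0: "k \<noteq> 0" using Suc.prems k by auto
  have deg: "degree g = Suc (degree k)" unfolding k using k0 by (subst degree_mult_eq) auto
  have ord: "order x g = (if x = a then 1 else 0) + order x k" for x
  proof -
    have "order x [:- a, 1:] = (if x = a then 1 else 0)"
      using order_power_n_n[of a 1] order_0I[of "[:- a, 1:]" x] by auto
    moreover have "order x ([:- a, 1:] * k) = order x [:- a, 1:] + order x k"
      by (rule order_mult) (use Suc.prems k in metis)
    ultimately show ?thesis unfolding k by (simp only:)
  qed
  have fin: "finite {x. poly g x = 0}" using Suc.prems by (rule poly_roots_finite)
  have "(\<Sum>x | poly g x = 0. order x g) = (\<Sum>x | poly g x = 0. if x = a then 1 else 0) + (\<Sum>x | poly g x = 0. order x k)"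
    by (simp only: ord sum.distrib)
  also have "(\<Sum>x | poly g x = 0. if x = a then 1 else 0) = (1::nat)"
    using a fin by simp
  also have "(\<Sum>x | poly g x = 0. order x k) = (\<Sum>x | poly k x = 0. order x k)"
    using fin by (intro sum.mono_neutral_right) (auto simp: k order_eq_0_iff[OF k0])
  also have "\<dots> = degree k" using Suc deg k0 by (intro Suc.hyps) auto
  finally show ?case using deg by simp
qed

text \<open>
  Let \<open>d\<close> be the degree of \<open>x\<close> over the base field. Then \<open>x\<close> lies in \<open>fixed r\<close> precisely if \<open>d\<close>
  divides \<open>r\<close>, and for \<open>r = e d\<close> its characteristic polynomial is the \<open>e\<close>-th power of the
  minimal polynomial. This power divides \<open>g\<close> precisely if \<open>e\<close> is at most the multiplicity of the
  root \<open>x\<close> of \<open>g\<close>.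
\<close>

lemma card_conj_poly_dvd:
  assumes g: "g \<in> Mon n" and x: "poly g x = 0"
  shows "card {r\<in>{1..n}. x \<in> fixed r \<and> conj_poly r x dvd g} = order x g"
proof -
  have g0: "g \<noteq> 0" and deg: "degree g = n" using g Mon_nonzero by (auto simp: Mon_def)
  have root: "poly g (x ^ (q ^ i)) = 0" for i
    using order_frob_le[OF g, of x i] x g0 by (simp add: order_root)
  have "\<exists>d>0. x \<in> fixed d"
  proof -
    have "\<not> inj_on (\<lambda>i. x ^ (q ^ i)) (UNIV :: nat set)"
    proof
      assume "inj_on (\<lambda>i. x ^ (q ^ i)) (UNIV :: nat set)"
      moreover have "finite (range (\<lambda>i. x ^ (q ^ i)))"
        by (rule finite_subset[OF _ poly_roots_finite[OF g0]]) (auto simp: root)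
      ultimately show False using finite_imageD by auto
    qed
    then obtain i j where "x ^ (q ^ i) = x ^ (q ^ j)" "i < j"
      by (auto simp: inj_on_def) (metis linorder_neqE_nat)
    moreover from this have "x ^ (q ^ j) = (x ^ (q ^ (j - i))) ^ (q ^ i)"
      by (simp flip: power_mult power_add)
    ultimately have "x ^ (q ^ (j - i)) = x" using frob_inj by metis
    thus ?thesis using \<open>i < j\<close> by (intro exI[of _ "j - i"]) (simp add: fixed_def)
  qed
  \<comment> \<open>The degree of \<open>x\<close> over the base field.\<close>
  then obtain d where d: "d > 0" "x \<in> fixed d" and least: "\<And>e. e > 0 \<Longrightarrow> x \<in> fixed e \<Longrightarrow> d \<le> e"
    using exists_least_iff[of "\<lambda>d. d > 0 \<and> x \<in> fixed d"] by (metis not_le_imp_less)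
  have dvd: "x \<in> fixed r \<longleftrightarrow> d dvd r" for r
  proof
    assume "x \<in> fixed r"
    hence "x ^ (q ^ (r mod d)) = x" using frob_mod[OF d(2), of r] by (simp add: fixed_def)
    hence "x \<in> fixed (r mod d)" by (simp add: fixed_def)
    hence "r mod d = 0" using least[of "r mod d"] mod_less_divisor[OF d(1), of r] by linarith
    thus "d dvd r" by auto
  next
    assume "d dvd r"
    thus "x \<in> fixed r" using fixed_mult[OF d(2)] by (auto simp: fixed_def)
  qed
  have inj: "inj_on (\<lambda>i. x ^ (q ^ i)) {..<d}"
  proof -
    have False if "i < j" "j < d" "x ^ (q ^ i) = x ^ (q ^ j)" for i j
    proof -
      have "x ^ (q ^ j) = (x ^ (q ^ (j - i))) ^ (q ^ i)" using that by (simp flip: power_mult power_add)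
      hence "x ^ (q ^ (j - i)) = x" using that(3) frob_inj by metis
      thus False using least[of "j - i"] that by (simp add: fixed_def)
    qed
    thus ?thesis by (auto simp: inj_on_def) (metis linorder_neqE_nat)
  qed
  have ord_eq: "order (x ^ (q ^ i)) g = order x g" if "i < d" for i
  proof -
    have "(x ^ (q ^ i)) ^ (q ^ (d - i)) = x"
      using d(2) that by (simp add: fixed_def flip: power_mult power_add)
    thus ?thesis using order_frob_le[OF g, of x i] order_frob_le[OF g, of "x ^ (q ^ i)" "d - i"] by simp
  qed
  have pow: "conj_poly d x ^ e dvd g \<longleftrightarrow> e \<le> order x g" for e
  proof
    assume "conj_poly d x ^ e dvd g"
    moreover have "[:- x, 1:] ^ e dvd conj_poly d x ^ e" using linear_dvd_conj_poly[OF d(1)] by (rule dvd_power_same)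
    ultimately show "e \<le> order x g" using g0 by (metis dvd_trans order_divides)
  next
    assume e: "e \<le> order x g"
    have "conj_poly d x ^ e = (\<Prod>i<d. [:- (x ^ (q ^ i)), 1:] ^ e)" by (simp only: conj_poly_def prod_power_distrib)
    also have "\<dots> = (\<Prod>y\<in>(\<lambda>i. x ^ (q ^ i)) ` {..<d}. [:- y, 1:] ^ e)"
      using prod.reindex[OF inj, of "\<lambda>y. [:- y, 1:] ^ e"] by (simp add: o_def)
    finally show "conj_poly d x ^ e dvd g" using e ord_eq by (auto intro!: prod_linear_power_dvd g0)
  qed
  have le: "order x g * d \<le> n"
  proof -
    have "degree (conj_poly d x ^ order x g) \<le> degree g" by (rule dvd_imp_degree_le) (use pow g0 in auto)
    moreover have "degree (conj_poly d x) = d" using conj_poly_in_Mon[OF d(2)] by (simp add: Mon_def)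
    ultimately show ?thesis using deg Mon_nonzero[OF conj_poly_in_Mon[OF d(2)]] by (simp add: degree_power_eq)
  qed
  have "{r\<in>{1..n}. x \<in> fixed r \<and> conj_poly r x dvd g} = (\<lambda>e. e * d) ` {1..order x g}"
  proof (rule subset_antisym; rule subsetI)
    fix r assume r: "r \<in> {r\<in>{1..n}. x \<in> fixed r \<and> conj_poly r x dvd g}"
    then obtain e where e: "r = e * d" using dvd by (metis (no_types, lifting) dvdE mem_Collect_eq mult.commute)
    have "e \<le> order x g" using r unfolding e by (simp add: conj_poly_mult[OF d(2)] pow)
    moreover have "e \<ge> 1" using r e by (cases e) auto
    ultimately show "r \<in> (\<lambda>e. e * d) ` {1..order x g}" using e by auto
  next
    fix r assume "r \<in> (\<lambda>e. e * d) ` {1..order x g}"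
    then obtain e where e: "r = e * d" "1 \<le> e" "e \<le> order x g"
      by (metis (no_types, lifting) atLeastAtMost_iff imageE)
    have "e * d \<le> order x g * d" using e by simp
    hence "e * d \<le> n" using le by (rule order_trans)
    thus "r \<in> {r\<in>{1..n}. x \<in> fixed r \<and> conj_poly r x dvd g}"
      using e d by (simp add: dvd conj_poly_mult[OF d(2)] pow)
  qed
  moreover have "inj_on (\<lambda>e. e * d) {1..order x g}" using d(1) by (auto simp: inj_on_def)
  ultimately show ?thesis by (simp add: card_image)
qed

text \<open>Adding the multiplicities of all roots of \<open>g\<close> gives its degree.\<close>

lemma sum_card_conj_poly_dvd:
  assumes g: "g \<in> Mon n"
  shows "(\<Sum>r=1..n. card {x\<in>fixed r. conj_poly r x dvd g}) = n"
proof -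
  have g0: "g \<noteq> 0" and deg: "degree g = n" using g Mon_nonzero by (auto simp: Mon_def)
  let ?R = "{x. poly g x = 0}"
  have fin: "finite ?R" using g0 by (rule poly_roots_finite)
  have "(\<Sum>r=1..n. card {x\<in>fixed r. conj_poly r x dvd g}) = (\<Sum>r=1..n. \<Sum>x\<in>?R. of_bool (x \<in> fixed r \<and> conj_poly r x dvd g))"
  proof (intro sum.cong refl)
    fix r assume r: "r \<in> {1..n}"
    have "{x\<in>fixed r. conj_poly r x dvd g} = ?R \<inter> {x. x \<in> fixed r \<and> conj_poly r x dvd g}"
    proof -
      have "poly g x = 0" if "conj_poly r x dvd g" for x
        using linear_dvd_conj_poly[of r x] that r by (meson atLeastAtMost_iff dvd_trans poly_eq_0_iff_dvd less_le_trans zero_less_one)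
      thus ?thesis by auto
    qed
    thus "card {x\<in>fixed r. conj_poly r x dvd g} = (\<Sum>x\<in>?R. of_bool (x \<in> fixed r \<and> conj_poly r x dvd g))"
      using fin by simp
  qed
  also have "\<dots> = (\<Sum>x\<in>?R. \<Sum>r=1..n. of_bool (x \<in> fixed r \<and> conj_poly r x dvd g))" by (rule sum.swap)
  also have "\<dots> = (\<Sum>x\<in>?R. order x g)"
  proof (intro sum.cong refl)
    fix x assume "x \<in> ?R"
    hence "card {r\<in>{1..n}. x \<in> fixed r \<and> conj_poly r x dvd g} = order x g" using card_conj_poly_dvd[OF g] by simp
    moreover have "{r\<in>{1..n}. x \<in> fixed r \<and> conj_poly r x dvd g} = {1..n} \<inter> {r. x \<in> fixed r \<and> conj_poly r x dvd g}" by auto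
    ultimately show "(\<Sum>r=1..n. of_bool (x \<in> fixed r \<and> conj_poly r x dvd g)) = order x g" by simp
  qed
  also have "\<dots> = n" using sum_order_alg_closed[OF g0] deg by simp
  finally show ?thesis .
qed

text \<open>
  For a completely multiplicative \<open>W\<close> these are the coefficients of its L-function, the sum over
  all monic \<open>g\<close> of \<open>W(g) T ^ deg g\<close>.
\<close>

definition Lcoeff :: "('a poly \<Rightarrow> complex) \<Rightarrow> nat \<Rightarrow> complex" where
  "Lcoeff W n = (\<Sum>g\<in>Mon n. W g)"

definition point_sum :: "('a poly \<Rightarrow> complex) \<Rightarrow> nat \<Rightarrow> complex" where
  "point_sum W r = (\<Sum>x\<in>fixed r. W (conj_poly r x))"

text \<open>
  This is the identity \<open>T L'(T) = L(T) S(T)\<close> for the power series with coefficients \<open>Lcoeff W n\<close>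
  and \<open>point_sum W r\<close>, usually derived from the Euler product. A direct argument counts, with
  weight \<open>W(g)\<close>, the divisors of \<open>g\<close> of the form \<open>conj_poly r x\<close>: for each \<open>g\<close> there are \<open>deg g\<close>
  of them.
\<close>

theorem Lcoeff_recursion:
  assumes W: "\<And>g h m n. g \<in> Mon m \<Longrightarrow> h \<in> Mon n \<Longrightarrow> W (g * h) = W g * W h"
  shows "of_nat n * Lcoeff W n = (\<Sum>r=1..n. point_sum W r * Lcoeff W (n - r))"
proof -
  have "(\<Sum>r=1..n. point_sum W r * Lcoeff W (n - r)) =
        (\<Sum>r=1..n. \<Sum>x\<in>fixed r. \<Sum>g\<in>Mon n. of_bool (conj_poly r x dvd g) * W g)"
  proof (intro sum.cong refl)
    fix r assume r: "r \<in> {1..n}"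
    have "W (conj_poly r x) * Lcoeff W (n - r) = (\<Sum>g\<in>Mon n. of_bool (conj_poly r x dvd g) * W g)" if x: "x \<in> fixed r" for x
    proof -
      have c: "conj_poly r x \<in> Mon r" by (rule conj_poly_in_Mon[OF x])
      have "W (conj_poly r x) * Lcoeff W (n - r) = (\<Sum>h\<in>Mon (n - r). W (conj_poly r x * h))"
        unfolding Lcoeff_def sum_distrib_left by (intro sum.cong refl) (simp add: W[OF c])
      also have "\<dots> = (\<Sum>g\<in>{g\<in>Mon n. conj_poly r x dvd g}. W g)"
      proof (rule sum.reindex_bij_witness[of _ "\<lambda>g. g div conj_poly r x" "\<lambda>h. conj_poly r x * h"])
        fix h assume h: "h \<in> Mon (n - r)"
        show "conj_poly r x * h div conj_poly r x = h" using Mon_nonzero[OF c] by simp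
        show "conj_poly r x * h \<in> {g\<in>Mon n. conj_poly r x dvd g}" using Mon_mult[OF c h] r by simp
      next
        fix g assume g: "g \<in> {g\<in>Mon n. conj_poly r x dvd g}"
        thus e: "conj_poly r x * (g div conj_poly r x) = g" by simp
        show "g div conj_poly r x \<in> Mon (n - r)" using Mon_cofactor(2)[OF _ c e[symmetric]] g by simp
      qed auto
      also have "\<dots> = (\<Sum>g\<in>Mon n. of_bool (conj_poly r x dvd g) * W g)"
        using finite_Mon by (intro sum.mono_neutral_cong_left) auto
      finally show ?thesis .
    qed
    thus "point_sum W r * Lcoeff W (n - r) = (\<Sum>x\<in>fixed r. \<Sum>g\<in>Mon n. of_bool (conj_poly r x dvd g) * W g)"
      by (simp add: point_sum_def sum_distrib_right)
  qed
  also have "\<dots> = (\<Sum>r=1..n. \<Sum>g\<in>Mon n. \<Sum>x\<in>fixed r. of_bool (conj_poly r x dvd g) * W g)"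
    by (intro sum.cong refl sum.swap)
  also have "\<dots> = (\<Sum>g\<in>Mon n. \<Sum>r=1..n. \<Sum>x\<in>fixed r. of_bool (conj_poly r x dvd g) * W g)"
    by (rule sum.swap)
  also have "\<dots> = (\<Sum>g\<in>Mon n. of_nat n * W g)"
  proof (intro sum.cong refl)
    fix g assume g: "g \<in> Mon n"
    have "(\<Sum>r=1..n. \<Sum>x\<in>fixed r. of_bool (conj_poly r x dvd g) * W g) =
          (\<Sum>r=1..n. of_nat (card {x\<in>fixed r. conj_poly r x dvd g})) * W g"
      unfolding sum_distrib_right
    proof (intro sum.cong refl)
      fix r assume "r \<in> {1..n}"
      hence "finite (fixed r)" by (intro finite_fixed) simp
      moreover have "{x\<in>fixed r. conj_poly r x dvd g} = fixed r \<inter> {x. conj_poly r x dvd g}" by auto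
      ultimately show "(\<Sum>x\<in>fixed r. of_bool (conj_poly r x dvd g) * W g) = of_nat (card {x\<in>fixed r. conj_poly r x dvd g}) * W g"
        by (simp flip: sum_distrib_right)
    qed
    also have "(\<Sum>r=1..n. of_nat (card {x\<in>fixed r. conj_poly r x dvd g})) = (of_nat n :: complex)"
      using arg_cong[OF sum_card_conj_poly_dvd[OF g], of "of_nat :: nat \<Rightarrow> complex"] by simp
    finally show "(\<Sum>r=1..n. \<Sum>x\<in>fixed r. of_bool (conj_poly r x dvd g) * W g) = of_nat n * W g" .
  qed
  also have "\<dots> = of_nat n * Lcoeff W n" by (simp add: Lcoeff_def sum_distrib_left)
  finally show ?thesis ..
qed

lemma Lcoeff_0: "W 1 = 1 \<Longrightarrow> Lcoeff W 0 = 1"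
  by (simp add: Lcoeff_def Mon_0)

text \<open>
  If \<open>L(T) = (1 - \<alpha> T) (1 - \<beta> T)\<close>, the recursion is Newton's identity for power sums in two
  variables.
\<close>

theorem point_sum_quadratic_L:
  fixes W :: "'a poly \<Rightarrow> complex" and \<alpha> \<beta> :: complex
  assumes W: "\<And>g h m n. g \<in> Mon m \<Longrightarrow> h \<in> Mon n \<Longrightarrow> W (g * h) = W g * W h" and W1: "W 1 = 1"
    and vanish: "\<And>n. n \<ge> 3 \<Longrightarrow> Lcoeff W n = 0"
    and ab: "\<alpha> + \<beta> = - Lcoeff W 1" "\<alpha> * \<beta> = Lcoeff W 2"
    and r: "r \<ge> 1"
  shows "point_sum W r = - (\<alpha> ^ r + \<beta> ^ r)"
  using r
proof (induction r rule: less_induct)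
  case (less r)
  have rec: "of_nat n * Lcoeff W n = (\<Sum>r=1..n. point_sum W r * Lcoeff W (n - r))" for n
    by (rule Lcoeff_recursion[OF W])
  have S1: "point_sum W 1 = Lcoeff W 1" using rec[of 1] Lcoeff_0[of W] W1 by simp
  have c1: "Lcoeff W 1 = - (\<alpha> + \<beta>)" using ab(1) by simp
  consider "r = 1" | "r = 2" | s where "r = Suc (Suc (Suc s))"
    using less.prems by (metis One_nat_def Suc_1 not0_implies_Suc not_one_le_zero)
  thus ?case
  proof cases
    case 1
    thus ?thesis using S1 c1 by simp
  next
    case 2
    have "2 * Lcoeff W 2 = point_sum W 1 * Lcoeff W 1 + point_sum W 2"
      using rec[of 2] Lcoeff_0[of W] W1 by (simp add: numeral_2_eq_2)
    hence "2 * (\<alpha> * \<beta>) = (\<alpha> + \<beta>) * (\<alpha> + \<beta>) + point_sum W 2"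
      by (simp only: S1 c1 ab(2) minus_mult_minus)
    hence "point_sum W 2 = 2 * (\<alpha> * \<beta>) - (\<alpha> + \<beta>) * (\<alpha> + \<beta>)"
      by simp
    thus ?thesis using 2 by (simp add: algebra_simps power2_eq_square)
  next
    case (3 s)
    have "0 = (\<Sum>i=1..r. point_sum W i * Lcoeff W (r - i))" using rec[of r] vanish[of r] 3 by simp
    also have "\<dots> = (\<Sum>i\<in>{r, r - 1, r - 2}. point_sum W i * Lcoeff W (r - i))"
    proof (rule sum.mono_neutral_right)
      \<comment> \<open>Only the three terms with \<open>r - i \<le> 2\<close> survive.\<close>
      show "\<forall>i\<in>{1..r} - {r, r - 1, r - 2}. point_sum W i * Lcoeff W (r - i) = 0"
      proof
        fix i assume "i \<in> {1..r} - {r, r - 1, r - 2}"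
        hence "r - i \<ge> 3" using 3 by auto
        thus "point_sum W i * Lcoeff W (r - i) = 0" using vanish by simp
      qed
    qed (use 3 in auto)
    also have "\<dots> = point_sum W r + point_sum W (r - 1) * Lcoeff W 1 + point_sum W (r - 2) * Lcoeff W 2"
      using 3 Lcoeff_0[of W] W1 by (simp add: numeral_2_eq_2)
    finally have "point_sum W r = - (point_sum W (r - 1) * Lcoeff W 1 + point_sum W (r - 2) * Lcoeff W 2)"
      by (simp add: algebra_simps add_eq_0_iff)
    moreover have "point_sum W (r - 1) = - (\<alpha> ^ Suc (Suc s) + \<beta> ^ Suc (Suc s))"
      using less.IH[of "r - 1"] 3 by simp
    moreover have "point_sum W (r - 2) = - (\<alpha> ^ Suc s + \<beta> ^ Suc s)"
      using less.IH[of "r - 2"] 3 by simp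
    ultimately have "point_sum W r = (\<alpha> ^ Suc s + \<beta> ^ Suc s) * (\<alpha> * \<beta>) -
        (\<alpha> ^ Suc (Suc s) + \<beta> ^ Suc (Suc s)) * (\<alpha> + \<beta>)"
      using c1 ab(2) by (simp only:) (simp add: algebra_simps)
    thus ?thesis using 3 by (simp add: algebra_simps)
  qed
qed

text \<open>The case \<open>\<beta> = 0\<close> of a quadratic L-function.\<close>

theorem point_sum_linear_L:
  fixes W :: "'a poly \<Rightarrow> complex"
  assumes W: "\<And>g h m n. g \<in> Mon m \<Longrightarrow> h \<in> Mon n \<Longrightarrow> W (g * h) = W g * W h" and W1: "W 1 = 1"
    and vanish: "\<And>n. n \<ge> 2 \<Longrightarrow> Lcoeff W n = 0"
    and r: "r \<ge> 1"
  shows "point_sum W r = - ((- point_sum W 1) ^ r)"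
proof -
  have "of_nat 1 * Lcoeff W 1 = (\<Sum>r=1..1. point_sum W r * Lcoeff W (1 - r))"
    by (rule Lcoeff_recursion[OF W])
  hence S1: "point_sum W 1 = Lcoeff W 1" using Lcoeff_0[of W] W1 by simp
  have "point_sum W r = - ((- Lcoeff W 1) ^ r + 0 ^ r)"
    by (rule point_sum_quadratic_L[OF W W1 _ _ _ r]) (use vanish in auto)
  thus ?thesis using r S1 by (simp add: power_0_left)
qed

end

section \<open>Jacobi sums and elliptic curves over extensions\<close>

lemma four_dvd_power_minus_1:
  fixes q :: nat
  assumes "4 dvd q - 1" "q \<ge> 1"
  shows "4 dvd q ^ r - 1"
proof -
  from assms obtain k where k: "q = Suc (4 * k)" by (metis Suc_pred' dvdE less_le_trans zero_less_one One_nat_def)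
  show ?thesis
  proof (induction r)
    case (Suc r)
    have "q ^ Suc r - 1 = (q ^ r - 1) + 4 * (k * q ^ r)" by (simp add: k)
    thus ?case using Suc by (simp only: dvd_add dvd_triv_left)
  qed simp
qed

text \<open>
  The exponents multiply: \<open>(1 + q + \<dots> + q\<^sup>r\<^sup>-\<^sup>1) (q - 1) / 2 = (q\<^sup>r - 1) / 2\<close>.
\<close>

lemma quad_char_norm:
  fixes y :: "'a::field" and q r :: nat
  assumes "odd q" and "r \<ge> 1"
  shows "quad_char q (\<Prod>i<r. y ^ (q ^ i)) = quad_char (q ^ r) y"
proof -
  obtain k where k: "q = Suc (2 * k)" using \<open>odd q\<close> by (metis oddE Suc_eq_plus1)
  have geo: "q ^ r - 1 = 2 * k * (\<Sum>i<r. q ^ i)"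
  proof (induction r)
    case (Suc r)
    have "q ^ Suc r - 1 = (q ^ r - 1) + 2 * k * q ^ r" by (simp add: k)
    thus ?case using Suc by (simp add: algebra_simps)
  qed simp
  have "(\<Prod>i<r. y ^ (q ^ i)) = y ^ (\<Sum>i<r. q ^ i)" by (simp add: power_sum)
  moreover have "(q ^ r - 1) div 2 = (\<Sum>i<r. q ^ i) * ((q - 1) div 2)"
    using geo by (simp add: k)
  moreover have "(\<Sum>i<r. q ^ i) > 0" using assms by (intro sum_pos) (auto simp: lessThan_empty_iff k)
  ultimately show ?thesis by (simp add: quad_char_def power_mult)
qed

text \<open>
  The base field is written \<open>fixed (Suc 0)\<close>, as \<open>1\<close> is rewritten to \<open>Suc 0\<close> in this position by
  the simplifier.
\<close>

locale frobenius_field_one_mod_four = frobenius_field ty q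
  for ty :: "'a::alg_closed_field itself" and q +
  assumes card_fixed: "card (fixed (Suc 0) :: 'a set) = q" and four_dvd_q: "4 dvd q - 1"
begin

lemma odd_q: "odd q"
proof -
  have "even (q - 1)" using four_dvd_q by (meson dvd_trans even_numeral)
  thus ?thesis using q_ge_2 by (cases q) auto
qed

sublocale F: odd_finite_subfield "fixed (Suc 0)" q
  by unfold_locales (use finite_fixed[of 1] fixed_closed card_fixed odd_q in auto)

lemma poly_in_fixed: "g \<in> Mon n \<Longrightarrow> x \<in> fixed (Suc 0) \<Longrightarrow> poly g x \<in> fixed (Suc 0)"
  using poly_frob_poly[of g x] by (simp add: fixed_def Mon_def)

lemma Mon_shift:
  assumes g: "g \<in> Mon n" and h: "degree h < n" "frob_poly h = h"
  shows "g + h \<in> Mon n"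
proof -
  have deg: "degree (g + h) = n" using g h by (simp add: Mon_def degree_add_eq_left)
  moreover have "coeff (g + h) n = 1" using g h by (auto simp: Mon_def coeff_eq_0)
  moreover have "frob_poly (g + h) = g + h"
  proof (rule poly_eqI)
    fix i
    have "coeff (frob_poly g) i = coeff g i" "coeff (frob_poly h) i = coeff h i" using g h by (auto simp: Mon_def)
    thus "coeff (frob_poly (g + h)) i = coeff (g + h) i" by (simp add: frob_add)
  qed
  ultimately show ?thesis by (simp add: Mon_def)
qed

lemma frob_poly_uminus: "frob_poly (- h) = - frob_poly h"
  by (rule poly_eqI) (simp add: frob_uminus)

lemma frob_poly_smult: "e \<in> fixed (Suc 0) \<Longrightarrow> frob_poly h = h \<Longrightarrow> frob_poly (smult e h) = smult e h"
proof (rule poly_eqI)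
  fix i assume "e \<in> fixed (Suc 0)" "frob_poly h = h"
  hence "e ^ q = e" "coeff (frob_poly h) i = coeff h i" by (auto simp: fixed_def)
  thus "coeff (frob_poly (smult e h)) i = coeff (smult e h) i" by (simp add: power_mult_distrib)
qed

text \<open>
  The monic polynomials of degree \<open>n\<close> are permuted by the translations \<open>g \<mapsto> g + e h\<close>. Averaging
  over \<open>e\<close> shows that the coefficient vanishes as soon as \<open>W\<close> sums to zero over every orbit.
\<close>

lemma Lcoeff_vanish:
  assumes h: "degree h < n" "frob_poly h = h"
    and zero: "\<And>g. g \<in> Mon n \<Longrightarrow> (\<Sum>e\<in>fixed (Suc 0). W (g + smult e h)) = 0"
  shows "Lcoeff W n = 0"
proof -
  have "(\<Sum>g\<in>Mon n. W (g + smult e h)) = Lcoeff W n" if e: "e \<in> fixed (Suc 0)" for e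
  proof -
    have in1: "g + smult e h \<in> Mon n" if "g \<in> Mon n" for g
      using that by (rule Mon_shift) (use h e frob_poly_smult in auto)
    have in2: "g + - smult e h \<in> Mon n" if "g \<in> Mon n" for g
      using that by (rule Mon_shift) (use h e frob_poly_smult in \<open>auto simp: frob_poly_uminus\<close>)
    show ?thesis unfolding Lcoeff_def
      by (rule sum.reindex_bij_witness[of _ "\<lambda>g. g + - smult e h" "\<lambda>g. g + smult e h"])
         (use in1 in2 in \<open>auto simp del: add_uminus_conv_diff\<close>)
  qed
  hence "of_nat q * Lcoeff W n = (\<Sum>e\<in>fixed (Suc 0). \<Sum>g\<in>Mon n. W (g + smult e h))"
    using card_fixed by simp
  also have "\<dots> = (\<Sum>g\<in>Mon n. \<Sum>e\<in>fixed (Suc 0). W (g + smult e h))" by (rule sum.swap)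
  also have "\<dots> = 0" using zero by simp
  finally show ?thesis using q_ge_2 by simp
qed

lemma poly_conj_poly: "poly (conj_poly r x) y = (\<Prod>i<r. y - x ^ (q ^ i))"
  by (simp add: conj_poly_def poly_prod)

lemma frob_pow_diff: "(x - y :: 'a) ^ (q ^ i) = x ^ (q ^ i) - y ^ (q ^ i)"
  using frob_pow_add[of x "- y" i] by (simp add: frob_pow_uminus)

text \<open>
  The weight \<open>W(g) = \<chi> ((-1) ^ deg g g(0) g(1))\<close> takes the value of the summand at
  characteristic polynomials. Adding multiples of \<open>X - 1\<close> to \<open>g\<close> leaves \<open>g(1)\<close> fixed and moves
  \<open>g(0)\<close> through the whole base field, provided that \<open>g\<close> has degree at least two; so the
  L-function is linear.
\<close>

lemma jacobi_point_sum:
  fixes \<chi> :: "'a \<Rightarrow> complex"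
  assumes mult: "\<And>x y. x \<in> fixed (Suc 0) \<Longrightarrow> y \<in> fixed (Suc 0) \<Longrightarrow> \<chi> (x * y) = \<chi> x * \<chi> y"
    and one: "\<chi> 1 = 1" and nontriv: "(\<Sum>x\<in>fixed (Suc 0). \<chi> x) = 0" and r: "r \<ge> 1"
  shows "(\<Sum>x\<in>fixed r. \<chi> (\<Prod>i<r. (x * (1 - x)) ^ (q ^ i))) =
         - ((- (\<Sum>x\<in>fixed (Suc 0). \<chi> (x * (1 - x)))) ^ r)"
proof -
  define W where "W = (\<lambda>g. \<chi> ((-1) ^ degree g * (poly g 0 * poly g 1)))"
  have val: "poly g 0 \<in> fixed (Suc 0)" "poly g 1 \<in> fixed (Suc 0)" "(-1) ^ k \<in> fixed (Suc 0)" if "g \<in> Mon n" for g n k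
    using poly_in_fixed[OF that] fixed_closed(1,2)[of 1] F.power_in[OF F.uminus_in[OF F.one_in]] by auto
  have cong: "point_sum W r = (\<Sum>x\<in>fixed r. \<chi> (\<Prod>i<r. (x * (1 - x)) ^ (q ^ i)))" for r
    unfolding point_sum_def
  proof (intro sum.cong refl)
    fix x assume x: "x \<in> fixed r"
    have "(-1) ^ degree (conj_poly r x) * (poly (conj_poly r x) 0 * poly (conj_poly r x) 1) =
          (\<Prod>i<r. (-1) * ((0 - x ^ (q ^ i)) * (1 - x ^ (q ^ i))))"
    proof -
      have "(-1) ^ degree (conj_poly r x) = (\<Prod>i<r. (-1::'a))" using conj_poly_in_Mon[OF x] by (simp add: Mon_def)
      thus ?thesis by (simp only: poly_conj_poly prod.distrib)
    qed
    also have "\<dots> = (\<Prod>i<r. (x * (1 - x)) ^ (q ^ i))"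
      by (intro prod.cong refl) (simp add: power_mult_distrib frob_pow_diff)
    finally show "W (conj_poly r x) = \<chi> (\<Prod>i<r. (x * (1 - x)) ^ (q ^ i))" by (simp add: W_def)
  qed
  have "point_sum W r = - ((- point_sum W 1) ^ r)"
  proof (rule point_sum_linear_L[OF _ _ _ r])
    fix g h m n assume gh: "g \<in> Mon m" "h \<in> Mon n"
    have "degree (g * h) = degree g + degree h" using Mon_mult[OF gh] gh by (simp add: Mon_def)
    hence "(-1) ^ degree (g * h) * (poly (g * h) 0 * poly (g * h) 1) =
          ((-1) ^ degree g * (poly g 0 * poly g 1)) * ((-1) ^ degree h * (poly h 0 * poly h 1))"
      by (simp add: power_add)
    thus "W (g * h) = W g * W h" unfolding W_def
      using mult val[OF gh(1)] val[OF gh(2)] by (simp only: F.mult_in)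
  next
    show "W 1 = 1" by (simp add: W_def one)
  next
    fix n :: nat assume n: "n \<ge> 2"
    show "Lcoeff W n = 0"
    proof (rule Lcoeff_vanish[where h = "[:- 1, 1:]"])
      show "degree [:- 1, 1 :: 'a:] < n" using n by simp
      show "frob_poly [:- 1, 1:] = [:- 1, 1:]" using frob_poly_linear[of 1] by simp
      fix g assume g: "g \<in> Mon n"
      have "(\<Sum>e\<in>fixed (Suc 0). W (g + smult e [:- 1, 1:])) =
            (\<Sum>e\<in>fixed (Suc 0). \<chi> ((-1) ^ n * poly g 1) * \<chi> ((-1) * e + poly g 0))"
      proof (intro sum.cong refl)
        fix e assume e: "e \<in> fixed (Suc 0)"
        have "g + smult e [:- 1, 1:] \<in> Mon n"
        proof (rule Mon_shift[OF g])
          show "degree (smult e [:- 1, 1:]) < n" using n degree_smult_le[of e "[:- 1, 1:]"] by simp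
          show "frob_poly (smult e [:- 1, 1:]) = smult e [:- 1, 1:]"
            by (rule frob_poly_smult[OF e]) (use frob_poly_linear[of 1] in simp)
        qed
        hence "degree (g + smult e [:- 1, 1:]) = n" by (simp add: Mon_def)
        hence "W (g + smult e [:- 1, 1:]) = \<chi> (((-1) ^ n * poly g 1) * ((-1) * e + poly g 0))"
          by (simp add: W_def algebra_simps)
        also have "\<dots> = \<chi> ((-1) ^ n * poly g 1) * \<chi> ((-1) * e + poly g 0)"
          by (rule mult) (intro F.mult_in F.add_in F.uminus_in F.one_in val[OF g] e)+
        finally show "W (g + smult e [:- 1, 1:]) = \<chi> ((-1) ^ n * poly g 1) * \<chi> ((-1) * e + poly g 0)" .
      qed
      also have "\<dots> = 0"
        using F.sum_affine[of "-1" "poly g 0" \<chi>] val[OF g] nontriv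
        by (simp add: F.uminus_in flip: sum_distrib_left)
      finally show "(\<Sum>e\<in>fixed (Suc 0). W (g + smult e [:- 1, 1:])) = 0" .
    qed
  qed
  thus ?thesis unfolding cong by simp
qed

text \<open>
  Let \<open>a\<close> and \<open>b\<close> be the roots of \<open>X\<^sup>2 - 2 X + u\<close>. The weight \<open>W(g) = \<chi> (g(0) g(a) g(b))\<close> takes
  the value of the summand at characteristic polynomials, because \<open>-1\<close> is a square. Adding
  multiples of \<open>X\<^sup>2 - 2 X + u\<close> to \<open>g\<close> leaves \<open>g(a) g(b)\<close> fixed and moves \<open>g(0)\<close> through the whole
  base field, as \<open>u\<close> is not zero; so the L-function has degree at most two. Its second
  coefficient is computed by writing \<open>g = (X\<^sup>2 - 2 X + u) + x X + y\<close>, so that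
  \<open>g(a) g(b) = u x\<^sup>2 + 2 x y + y\<^sup>2\<close> is a quadratic form with discriminant \<open>4 (1 - u) y\<^sup>2\<close>, nonzero
  if \<open>y\<close> is.
\<close>

lemma cubic_point_sum:
  fixes u :: 'a
  assumes u: "u \<in> fixed (Suc 0)" "u \<noteq> 0" "u \<noteq> 1"
  obtains \<alpha> \<beta> :: complex where "\<alpha> * \<beta> = of_nat q"
    "\<And>r. r \<ge> 1 \<Longrightarrow> (\<Sum>x\<in>fixed r. quad_char (q ^ r) (x * (x ^ 2 - 2 * x + u))) = - (\<alpha> ^ r + \<beta> ^ r)"
proof -
  obtain w where w: "w ^ 2 = 1 - u" using nth_root_exists[of 2 "1 - u"] by auto
  define a b where "a = 1 + w" and "b = 1 - w"
  have ab: "a + b = 2" "a * b = u" using w by (simp_all add: a_def b_def algebra_simps power2_eq_square)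
  have sq: "z ^ 2 = 2 * z - u" if "z \<in> {a, b}" for z
    using that w by (auto simp: a_def b_def power2_sum power2_diff)
  have split: "(a - x) * (b - x) = x ^ 2 - 2 * x + u" for x
    using w by (simp add: a_def b_def algebra_simps power2_eq_square)
  have uq: "u ^ q = u" using u by (simp add: fixed_def)
  have two: "(2::'a) ^ q = 2" using F.numeral_in[of "num.Bit0 num.One"] by (simp add: fixed_def)
  \<comment> \<open>Frobenius permutes the roots, so that \<open>P g\<close> lies in the base field.\<close>
  have conj: "a ^ q = a \<and> b ^ q = b \<or> a ^ q = b \<and> b ^ q = a"
  proof -
    have s: "a ^ q + b ^ q = 2" using frob_add[of a b] two ab(1) by simp
    have p: "a ^ q * b ^ q = u" using uq ab(2) by (simp flip: power_mult_distrib)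
    have "(a - a ^ q) * (b - a ^ q) = (a ^ q) ^ 2 - (a ^ q + b ^ q) * a ^ q + a ^ q * b ^ q"
      unfolding split s p by simp
    also have "\<dots> = 0" by (simp add: algebra_simps power2_eq_square)
    finally have "a ^ q = a \<or> a ^ q = b" by auto
    thus ?thesis using s ab(1) by (metis add.commute add_left_cancel)
  qed
  define P where "P = (\<lambda>g. poly g a * poly g b)"
  define W where "W = (\<lambda>g. quad_char q (poly g 0 * P g))"
  have val: "poly g 0 \<in> fixed (Suc 0)" "P g \<in> fixed (Suc 0)" if g: "g \<in> Mon n" for g n
  proof -
    show "poly g 0 \<in> fixed (Suc 0)" by (rule poly_in_fixed[OF g F.zero_in])
    have "poly g z ^ q = poly g (z ^ q)" for z using poly_frob_poly[of g z] g by (simp add: Mon_def)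
    thus "P g \<in> fixed (Suc 0)" using conj unfolding P_def by (auto simp: fixed_def power_mult_distrib mult.commute)
  qed
  have Wg: "W g = quad_char q (poly g 0) * quad_char q (P g)" if "g \<in> Mon n" for g n
    unfolding W_def using val[OF that] by (rule F.quad_char_mult)
  have W_mult: "W (g * h) = W g * W h" if gh: "g \<in> Mon m" "h \<in> Mon n" for g h m n
  proof -
    have "P (g * h) = P g * P h" "poly (g * h) 0 = poly g 0 * poly h 0" by (simp_all add: P_def mult_ac)
    thus ?thesis unfolding Wg[OF gh(1)] Wg[OF gh(2)] Wg[OF Mon_mult[OF gh]]
      by (simp add: F.quad_char_mult val[OF gh(1)] val[OF gh(2)])
  qed
  have W1: "W 1 = 1" by (simp add: W_def P_def)
  have vanish: "Lcoeff W n = 0" if n: "n \<ge> 3" for n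
  proof (rule Lcoeff_vanish[where h = "[:u, - 2, 1:]"])
    define h where "h = [:u, - 2, 1:]"
    show deg: "degree [:u, - 2, 1:] < n" using n by simp
    show fr: "frob_poly [:u, - 2, 1:] = [:u, - 2, 1:]"
      by (rule poly_eqI) (auto simp: coeff_pCons uq two frob_uminus frob_0 split: nat.split)
    fix g assume g: "g \<in> Mon n"
    have "(\<Sum>e\<in>fixed (Suc 0). W (g + smult e h)) = (\<Sum>e\<in>fixed (Suc 0). quad_char q (u * e + poly g 0) * quad_char q (P g))"
    proof (intro sum.cong refl)
      fix e assume e: "e \<in> fixed (Suc 0)"
      have "g + smult e h \<in> Mon n" unfolding h_def
        by (rule Mon_shift[OF g]) (use deg frob_poly_smult[OF e fr] degree_smult_le[of e "[:u, - 2, 1:]"] in linarith, rule frob_poly_smult[OF e fr])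
      hence "W (g + smult e h) = quad_char q (poly (g + smult e h) 0) * quad_char q (P (g + smult e h))"
        by (rule Wg)
      moreover have "poly h a = 0" "poly h b = 0" using sq[of a] sq[of b]
        by (simp_all add: h_def algebra_simps power2_eq_square)
      hence "P (g + smult e h) = P g" by (simp add: P_def)
      moreover have "poly (g + smult e h) 0 = u * e + poly g 0" by (simp add: h_def)
      ultimately show "W (g + smult e h) = quad_char q (u * e + poly g 0) * quad_char q (P g)" by (simp only:)
    qed
    also have "\<dots> = 0"
      using F.sum_quad_char_affine[OF u(1,2) val(1)[OF g]] by (simp flip: sum_distrib_right)
    finally show "(\<Sum>e\<in>fixed (Suc 0). W (g + smult e [:u, - 2, 1:])) = 0" unfolding h_def .
  qed
  have L2: "Lcoeff W 2 = of_nat q"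
  proof -
    have "Lcoeff W 2 = (\<Sum>p\<in>fixed (Suc 0) \<times> fixed (Suc 0). W [:fst p + u, snd p - 2, 1:])"
      unfolding Lcoeff_def
    proof (rule sum.reindex_bij_witness[of _ "\<lambda>p. [:fst p + u, snd p - 2, 1:]"
               "\<lambda>g. (coeff g 0 - u, coeff g 1 + 2)"])
      fix g assume g: "g \<in> Mon 2"
      hence c: "coeff g i \<in> fixed (Suc 0)" for i
        using coeff_frob_poly[of g i] by (simp add: Mon_def fixed_def)
      thus "(coeff g 0 - u, coeff g 1 + 2) \<in> fixed (Suc 0) \<times> fixed (Suc 0)"
        using u(1) by (auto intro!: F.add_in F.diff_in F.numeral_in)
      have "g = [:coeff g 0, coeff g 1, coeff g 2:]"
        by (rule poly_eqI) (use g in \<open>auto simp: Mon_def coeff_pCons coeff_eq_0 numeral_2_eq_2 split: nat.split\<close>)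
      moreover have "coeff g 2 = 1" using g by (auto simp: Mon_def)
      ultimately show eq: "[:fst (coeff g 0 - u, coeff g 1 + 2) + u, snd (coeff g 0 - u, coeff g 1 + 2) - 2, 1:] = g"
        by simp
      show "W [:fst (coeff g 0 - u, coeff g 1 + 2) + u, snd (coeff g 0 - u, coeff g 1 + 2) - 2, 1:] = W g"
        unfolding eq ..
    next
      fix p assume p: "p \<in> fixed (Suc 0) \<times> fixed (Suc 0)"
      show "(coeff [:fst p + u, snd p - 2, 1:] 0 - u, coeff [:fst p + u, snd p - 2, 1:] 1 + 2) = p"
        by simp
      have "(fst p + u) ^ q = fst p + u" "(snd p - 2) ^ q = snd p - 2"
        using p F.add_in[of "fst p" u] F.diff_in[of "snd p" 2] u(1) F.numeral_in[of "num.Bit0 num.One"]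
        by (auto simp: fixed_def)
      thus "[:fst p + u, snd p - 2, 1:] \<in> Mon 2"
        by (auto simp: Mon_def numeral_2_eq_2 intro!: poly_eqI simp: coeff_pCons frob_0 split: nat.split)
    qed
    also have "\<dots> = (\<Sum>b'\<in>fixed (Suc 0). \<Sum>a'\<in>fixed (Suc 0). W [:b' + u, a' - 2, 1:])"
      by (simp add: sum.cartesian_product case_prod_beta)
    also have "\<dots> = (\<Sum>y\<in>fixed (Suc 0). quad_char q (y + u) * (\<Sum>x\<in>fixed (Suc 0). quad_char q (u * x ^ 2 + (2 * y) * x + y ^ 2)))"
      unfolding sum_distrib_left
    proof (intro sum.cong refl)
      fix y x :: 'a assume xy: "y \<in> fixed (Suc 0)" "x \<in> fixed (Suc 0)"
      have lin: "poly [:y + u, x - 2, 1:] z = x * z + y" if "z \<in> {a, b}" for z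
        using sq[OF that] by (simp add: algebra_simps power2_eq_square)
      have "P [:y + u, x - 2, 1:] = (x * a + y) * (x * b + y)"
        unfolding P_def by (simp only: lin insertI1 insertI2 singletonI)
      also have "\<dots> = (a * b) * x ^ 2 + (a + b) * y * x + y ^ 2"
        by (simp add: algebra_simps power2_eq_square)
      finally have "P [:y + u, x - 2, 1:] = u * x ^ 2 + (2 * y) * x + y ^ 2" by (simp only: ab)
      moreover have "quad_char q ((y + u) * (u * x ^ 2 + (2 * y) * x + y ^ 2)) =
            quad_char q (y + u) * quad_char q (u * x ^ 2 + (2 * y) * x + y ^ 2)"
        by (rule F.quad_char_mult) (use xy u(1) in \<open>auto intro!: F.closed_in\<close>)
      ultimately show "W [:y + u, x - 2, 1:] = quad_char q (y + u) * quad_char q (u * x ^ 2 + (2 * y) * x + y ^ 2)"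
        by (simp add: W_def)
    qed
    also have "\<dots> = (\<Sum>y\<in>fixed (Suc 0). quad_char q (y + u) * (if y = 0 then (of_nat q - 1) * quad_char q u else - quad_char q u))"
    proof (intro sum.cong refl arg_cong2[where f = "\<lambda>x y :: complex. x * y"], goal_cases)
      case (1 y)
      show ?case
      proof (cases "y = 0")
        case True
        thus ?thesis using F.sum_quad_char_quadratic_0[of u "2 * y" "y ^ 2"] u 1
          by (simp add: F.closed_in)
      next
        case False
        have "(2 * y) ^ 2 - 4 * u * y ^ 2 = 4 * y ^ 2 * (1 - u)" by (simp add: algebra_simps power2_eq_square)
        hence "(2 * y) ^ 2 \<noteq> 4 * u * y ^ 2" using False u F.four_neq_0 by auto
        thus ?thesis using F.sum_quad_char_quadratic[of u "2 * y" "y ^ 2"] u 1 False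
          by (simp add: F.closed_in)
      qed
    qed
    also have "\<dots> = (\<Sum>y\<in>fixed (Suc 0). (if y = 0 then of_nat q * quad_char q u * quad_char q u else 0) - quad_char q u * quad_char q (1 * y + u))"
      by (intro sum.cong refl) (auto simp: algebra_simps)
    also have "\<dots> = of_nat q * (quad_char q u * quad_char q u)"
      using F.sum_quad_char_affine[of 1 u] u F.finite_F
      by (simp add: sum_subtractf flip: sum_distrib_left)
    finally show ?thesis using quad_char_self_mult[OF u(2)] by simp
  qed
  have S: "point_sum W r = (\<Sum>x\<in>fixed r. quad_char (q ^ r) (x * (x ^ 2 - 2 * x + u)))" if r: "r \<ge> 1" for r
    unfolding point_sum_def
  proof (intro sum.cong refl)
    fix x assume x: "x \<in> fixed r"
    define y where "y = x * (x ^ 2 - 2 * x + u)"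
    have fix_pow: "z ^ (q ^ i) = z" if "z \<in> fixed (Suc 0)" for i and z :: 'a
      using fixed_mult[OF that, of i] by simp
    have "poly (conj_poly r x) 0 * P (conj_poly r x) = (\<Prod>i<r. (0 - x ^ (q ^ i)) * ((a - x ^ (q ^ i)) * (b - x ^ (q ^ i))))"
      unfolding P_def poly_conj_poly by (simp only: prod.distrib)
    also have "\<dots> = (\<Prod>i<r. (- y) ^ (q ^ i))"
    proof (intro prod.cong refl)
      fix i
      have "(- y) ^ (q ^ i) = - (x ^ (q ^ i) * ((x ^ 2) ^ (q ^ i) - (2 * x) ^ (q ^ i) + u ^ (q ^ i)))"
        by (simp only: y_def frob_pow_uminus power_mult_distrib[of x] frob_pow_add frob_pow_diff)
      also have "\<dots> = - (x ^ (q ^ i) * ((x ^ (q ^ i)) ^ 2 - 2 * x ^ (q ^ i) + u))"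
        using fix_pow[OF u(1)] fix_pow[OF F.numeral_in[of "num.Bit0 num.One"]]
        by (simp add: power_mult_distrib mult.commute flip: power_mult)
      finally show "(0 - x ^ (q ^ i)) * ((a - x ^ (q ^ i)) * (b - x ^ (q ^ i))) = (- y) ^ (q ^ i)"
        unfolding split by simp
    qed
    finally have "W (conj_poly r x) = quad_char q (\<Prod>i<r. (- y) ^ (q ^ i))" by (simp add: W_def)
    also have "\<dots> = quad_char (q ^ r) (- y)" by (rule quad_char_norm[OF odd_q r])
    also have "\<dots> = quad_char (q ^ r) y"
    proof -
      have "4 dvd q ^ r - 1" using four_dvd_q q_ge_2 by (intro four_dvd_power_minus_1) auto
      hence "even ((q ^ r - 1) div 2)" by auto
      thus ?thesis by (simp add: quad_char_def)
    qed
    finally show "W (conj_poly r x) = quad_char (q ^ r) (x * (x ^ 2 - 2 * x + u))" by (simp add: y_def)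
  qed
  define c where "c = Lcoeff W 1"
  \<comment> \<open>The eigenvalues are the roots of \<open>X\<^sup>2 + c X + q\<close>.\<close>
  define d where "d = csqrt (c ^ 2 - 4 * of_nat q)"
  have d2: "d ^ 2 = c ^ 2 - 4 * of_nat q" by (simp add: d_def)
  have eig: "(- c + d) / 2 + (- c - d) / 2 = - Lcoeff W 1"
    by (simp add: c_def field_simps)
  have "(- c + d) / 2 * ((- c - d) / 2) = (c ^ 2 - d ^ 2) / 4"
    by (simp add: algebra_simps power2_eq_square)
  hence prod: "(- c + d) / 2 * ((- c - d) / 2) = of_nat q" using d2 by simp
  show thesis
  proof (rule that[OF prod])
    fix r :: nat assume r: "r \<ge> 1"
    have "point_sum W r = - (((- c + d) / 2) ^ r + ((- c - d) / 2) ^ r)"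
      by (rule point_sum_quadratic_L[OF W_mult W1 vanish eig _ r]) (use prod L2 in auto)
    thus "(\<Sum>x\<in>fixed r. quad_char (q ^ r) (x * (x ^ 2 - 2 * x + u))) = - (((- c + d) / 2) ^ r + ((- c - d) / 2) ^ r)"
      using S[OF r] by simp
  qed
qed

end

section \<open>Characters and Gauss sums\<close>

lemma mult_charsD:
  assumes "\<mu> \<in> mult_chars"
  shows "\<mu> 0 = 0" "\<mu> 1 = 1" "\<mu> (x * y) = \<mu> x * \<mu> y"
  using assms by (auto simp: mult_chars_def)

lemma mult_chars_power: "\<mu> \<in> mult_chars \<Longrightarrow> \<mu> (x ^ n) = \<mu> x ^ n"
  by (induction n) (simp_all add: mult_charsD)

lemma mult_chars_inverse: "\<mu> \<in> mult_chars \<Longrightarrow> \<mu> (inverse x) = inverse (\<mu> x)"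
proof (cases "x = 0")
  case False
  assume m: "\<mu> \<in> mult_chars"
  have "\<mu> x * \<mu> (inverse x) = 1" using mult_charsD(3)[OF m, of x "inverse x"] False mult_charsD[OF m] by simp
  thus ?thesis by (metis inverse_unique)
qed (simp add: mult_charsD)

lemma mult_chars_nonzero: "\<mu> \<in> mult_chars \<Longrightarrow> x \<noteq> 0 \<Longrightarrow> \<mu> x \<noteq> 0"
  using mult_charsD(3)[of \<mu> x "inverse x"] mult_charsD(2)[of \<mu>] by auto

lemma triv_char_in: "triv_char \<in> mult_chars"
  by (auto simp: mult_chars_def triv_char_def)

lemma char_mult_in: "\<mu> \<in> mult_chars \<Longrightarrow> \<nu> \<in> mult_chars \<Longrightarrow> char_mult \<mu> \<nu> \<in> mult_chars"
  by (auto simp: mult_chars_def char_mult_def)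

lemma char_pow_in: "\<mu> \<in> mult_chars \<Longrightarrow> char_pow \<mu> n \<in> mult_chars"
  by (auto simp: mult_chars_def char_pow_def power_mult_distrib)

definition char_inv :: "('k::{finite,field} \<Rightarrow> complex) \<Rightarrow> 'k \<Rightarrow> complex" where
  "char_inv \<mu> x = \<mu> (inverse x)"

lemma char_inv_in: "\<mu> \<in> mult_chars \<Longrightarrow> char_inv \<mu> \<in> mult_chars"
  by (auto simp: mult_chars_def char_inv_def)

lemma char_inv_inv [simp]: "char_inv (char_inv \<mu>) = \<mu>"
  by (simp add: char_inv_def fun_eq_iff)

lemma mult_chars_power_card:
  fixes x :: "'k::{finite,field}"
  assumes "\<mu> \<in> mult_chars" "x \<noteq> 0"
  shows "\<mu> x ^ (CARD('k) - 1) = 1" "x ^ (CARD('k) - 1) = 1"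
proof -
  interpret finite_subfield "UNIV :: 'k set" "CARD('k)" by unfold_locales auto
  show "x ^ (CARD('k) - 1) = 1" by (rule power_card_minus_1) (use assms in auto)
  thus "\<mu> x ^ (CARD('k) - 1) = 1"
    using mult_chars_power[OF assms(1), of x "CARD('k) - 1"] mult_charsD(2)[OF assms(1)] by simp
qed

lemma ex_primitive_element:
  "\<exists>a::'k::{finite,field}. a \<noteq> 0 \<and> (\<forall>x. x \<noteq> 0 \<longrightarrow> (\<exists>i < CARD('k) - 1. x = a ^ i)) \<and>
     (\<forall>i j. i < CARD('k) - 1 \<longrightarrow> j < CARD('k) - 1 \<longrightarrow> a ^ i = a ^ j \<longrightarrow> i = j)"
proof -
  define R where "R = (ring_of_type_algebra :: 'k ring)"
  interpret R: field R unfolding R_def by (rule field_from_type_algebra)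
  have carrier: "carrier R = UNIV" and zero: "\<zero>\<^bsub>R\<^esub> = 0" by (simp_all add: R_def ring_of_type_algebra_def)
  have pow: "a [^]\<^bsub>R\<^esub> i = a ^ i" for a i
    by (induction i) (simp_all add: R_def ring_of_type_algebra_def mult.commute)
  obtain a where a: "a \<in> carrier (mult_of R)" "carrier (mult_of R) = {a [^]\<^bsub>R\<^esub> i |i::nat. i \<in> UNIV}"
    using R.finite_field_mult_group_has_gen by (auto simp: carrier)
  have a0: "a \<noteq> 0" using a(1) by (simp add: carrier zero)
  have N: "CARD('k) - 1 > 0" using finite_subfield.Q_ge_2[of "UNIV :: 'k set" "CARD('k)"]
    by (simp add: finite_subfield_def)
  have gen: "\<exists>i < CARD('k) - 1. x = a ^ i" if "x \<noteq> 0" for x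
  proof -
    have "x \<in> carrier (mult_of R)" using that by (simp add: carrier zero)
    then obtain i where "x = a ^ i" unfolding a(2) by (auto simp: pow)
    also have "\<dots> = (a ^ (CARD('k) - 1)) ^ (i div (CARD('k) - 1)) * a ^ (i mod (CARD('k) - 1))"
      by (simp flip: power_mult power_add)
    also have "\<dots> = a ^ (i mod (CARD('k) - 1))"
      using mult_chars_power_card(2)[OF triv_char_in a0] by simp
    finally show ?thesis using N by (intro exI[of _ "i mod (CARD('k) - 1)"]) simp
  qed
  have img: "(\<lambda>i. a ^ i) ` {..<CARD('k) - 1} = UNIV - {0}" using gen a0 by auto
  have "inj_on (\<lambda>i. a ^ i) {..<CARD('k) - 1}"
    by (rule eq_card_imp_inj_on) (simp_all only: img finite_lessThan card_lessThan, simp add: card_Diff_singleton)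
  thus ?thesis using a0 gen by (intro exI[of _ a]) (simp add: inj_on_def)
qed

text \<open>
  Sending a primitive element to a primitive root of unity of order \<open>Q - 1\<close>.
\<close>

lemma ex_faithful_char:
  "\<exists>\<nu> :: 'k::{finite,field} \<Rightarrow> complex. \<nu> \<in> mult_chars \<and> (\<forall>x. \<nu> x = 1 \<longrightarrow> x = 1)"
proof -
  obtain a :: 'k where a: "a \<noteq> 0" "\<And>x. x \<noteq> 0 \<Longrightarrow> \<exists>i < CARD('k) - 1. x = a ^ i"
    "\<And>i j. i < CARD('k) - 1 \<Longrightarrow> j < CARD('k) - 1 \<Longrightarrow> a ^ i = a ^ j \<Longrightarrow> i = j"
    using ex_primitive_element[where 'k = 'k] by blast
  define N where "N = CARD('k) - 1"
  have N: "N > 0" using a(2)[of 1] by (auto simp: N_def)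
  define \<omega> where "\<omega> = (\<lambda>k. cis (2 * pi * real k / real N))"
  have bij: "bij_betw \<omega> {..<N} {z. z ^ N = 1}" unfolding \<omega>_def by (rule bij_betw_roots_unity[OF N])
  have om_add: "\<omega> (i + j) = \<omega> i * \<omega> j" for i j
    by (simp add: \<omega>_def cis_mult distrib_left add_divide_distrib)
  have om_N: "\<omega> (N * k) = 1" for k
  proof -
    have "\<omega> (N * k) = cis (2 * pi * real k)" using N unfolding \<omega>_def by (intro arg_cong[where f = cis]) simp
    moreover have "cis (2 * pi * real k) = 1" by (rule cis_multiple_2pi) simp
    ultimately show ?thesis by simp
  qed
  have om_mod: "\<omega> (i mod N) = \<omega> i" for i
    using om_add[of "N * (i div N)" "i mod N"] om_N by simp
  have ex: "\<exists>i. i < N \<and> x = a ^ i" if "x \<noteq> 0" for x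
    using a(2)[OF that] by (auto simp: N_def)
  define L where "L = (\<lambda>x. SOME i. i < N \<and> x = a ^ i)"
  have L: "L x < N" "x = a ^ L x" if "x \<noteq> 0" for x
    using someI_ex[OF ex[OF that]] by (auto simp: L_def)
  have aN: "a ^ N = 1" using mult_chars_power_card(2)[OF triv_char_in a(1)] by (simp add: N_def)
  have L_mult: "L (x * y) = (L x + L y) mod N" if "x \<noteq> 0" "y \<noteq> 0" for x y
  proof -
    have "a ^ L (x * y) = a ^ (L x + L y)" using L[of x] L[of y] L[of "x * y"] that by (simp add: power_add)
    also have "\<dots> = (a ^ N) ^ ((L x + L y) div N) * a ^ ((L x + L y) mod N)"
      by (simp flip: power_mult power_add)
    finally have "a ^ L (x * y) = a ^ ((L x + L y) mod N)" by (simp add: aN)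
    thus ?thesis using a(3) L(1)[of "x * y"] that N by (simp add: N_def)
  qed
  have L1: "L 1 = 0" using a(3)[of "L 1" 0] L[of 1] N by (simp add: N_def)
  define \<nu> where "\<nu> = (\<lambda>x. if x = 0 then 0 else \<omega> (L x))"
  have "\<nu> \<in> mult_chars"
    by (auto simp: mult_chars_def \<nu>_def L_mult om_mod om_add L1) (simp add: \<omega>_def)
  moreover have "x = 1" if "\<nu> x = 1" for x
  proof -
    have x: "x \<noteq> 0" using that by (auto simp: \<nu>_def)
    have "\<omega> (L x) = \<omega> 0" using that x by (simp add: \<nu>_def \<omega>_def)
    hence "L x = 0" using bij L(1)[OF x] N by (auto simp: bij_betw_def inj_on_def)
    thus "x = 1" using L(2)[OF x] by simp
  qed
  ultimately show ?thesis by blast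
qed

text \<open>
  A character is determined by its value at a primitive element, which is a root of unity of
  order dividing \<open>Q - 1\<close>; and the powers of a faithful character realise that many characters.
\<close>

lemma card_mult_chars:
  "finite (mult_chars :: ('k::{finite,field} \<Rightarrow> complex) set)"
  "card (mult_chars :: ('k \<Rightarrow> complex) set) = CARD('k) - 1"
proof -
  obtain a :: 'k where a: "a \<noteq> 0" "\<And>x. x \<noteq> 0 \<Longrightarrow> \<exists>i < CARD('k) - 1. x = a ^ i"
    "\<And>i j. i < CARD('k) - 1 \<Longrightarrow> j < CARD('k) - 1 \<Longrightarrow> a ^ i = a ^ j \<Longrightarrow> i = j"
    using ex_primitive_element[where 'k = 'k] by blast
  obtain \<nu> :: "'k \<Rightarrow> complex" where \<nu>: "\<nu> \<in> mult_chars" "\<And>x. \<nu> x = 1 \<Longrightarrow> x = 1"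
    using ex_faithful_char[where 'k = 'k] by blast
  define N where "N = CARD('k) - 1"
  have N: "N > 0" using a(2)[of 1] by (auto simp: N_def)
  have inj: "inj_on (\<lambda>\<mu>. \<mu> a) mult_chars"
  proof (rule inj_onI)
    fix \<mu> \<eta> :: "'k \<Rightarrow> complex" assume h: "\<mu> \<in> mult_chars" "\<eta> \<in> mult_chars" "\<mu> a = \<eta> a"
    show "\<mu> = \<eta>"
    proof
      fix x
      show "\<mu> x = \<eta> x"
      proof (cases "x = 0")
        case False
        then obtain i where "x = a ^ i" using a(2) by blast
        thus ?thesis using h by (simp add: mult_chars_power)
      qed (use h in \<open>simp add: mult_charsD\<close>)
    qed
  qed
  have sub: "(\<lambda>\<mu>. \<mu> a) ` mult_chars \<subseteq> {z. z ^ N = 1}"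
    using mult_chars_power_card(1)[OF _ a(1)] by (auto simp: N_def)
  have fin: "finite {z :: complex. z ^ N = 1}" using N by (rule card_power_eq_le(1))
  have cardN: "card {z :: complex. z ^ N = 1} = N" using N by (rule card_roots_unity_eq)
  have "inj_on (\<lambda>k. char_pow \<nu> k) {..<N}"
  proof (rule linorder_inj_onI)
    fix i j assume ij: "i < j" "i \<in> {..<N}" "j \<in> {..<N}"
    show "char_pow \<nu> i \<noteq> char_pow \<nu> j"
    proof
      assume "char_pow \<nu> i = char_pow \<nu> j"
      hence "\<nu> a ^ i = \<nu> a ^ j" using a(1) by (metis char_pow_def)
      also have "\<dots> = \<nu> a ^ i * \<nu> a ^ (j - i)" using ij by (simp flip: power_add)
      finally have "\<nu> a ^ (j - i) = 1" using mult_chars_nonzero[OF \<nu>(1) a(1)] by simp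
      hence "a ^ (j - i) = a ^ 0" using \<nu> by (simp add: mult_chars_power[symmetric])
      hence "j - i = 0" using ij N by (intro a(3)) (auto simp: N_def)
      thus False using ij by simp
    qed
  qed auto
  hence "card ((\<lambda>k. char_pow \<nu> k) ` {..<N}) = N" by (simp add: card_image)
  moreover have "(\<lambda>k. char_pow \<nu> k) ` {..<N} \<subseteq> mult_chars" using char_pow_in[OF \<nu>(1)] by auto
  moreover show fin': "finite (mult_chars :: ('k \<Rightarrow> complex) set)"
    using finite_imageD[OF finite_subset[OF sub fin] inj] .
  ultimately have "N \<le> card (mult_chars :: ('k \<Rightarrow> complex) set)" by (metis card_mono)
  moreover have "card (mult_chars :: ('k \<Rightarrow> complex) set) \<le> N"
    using card_inj_on_le[OF inj sub fin] cardN by simp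
  ultimately show "card (mult_chars :: ('k \<Rightarrow> complex) set) = CARD('k) - 1" by (simp add: N_def)
qed

lemma sum_mult_chars:
  fixes f :: "('k::{finite,field} \<Rightarrow> complex) \<Rightarrow> complex"
  assumes \<nu>: "\<nu> \<in> mult_chars"
  shows "(\<Sum>\<mu>\<in>mult_chars. f (char_mult \<nu> \<mu>)) = (\<Sum>\<mu>\<in>mult_chars. f \<mu>)"
proof -
  have cancel: "char_mult (char_inv \<nu>) (char_mult \<nu> \<mu>) = \<mu>" "char_mult \<nu> (char_mult (char_inv \<nu>) \<mu>) = \<mu>"
    if "\<mu> \<in> mult_chars" for \<mu>
  proof -
    have "\<nu> (inverse x) * (\<nu> x * \<mu> x) = \<mu> x" for x
      using mult_charsD(1)[OF that] mult_chars_nonzero[OF \<nu>, of x]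
      by (cases "x = 0") (simp_all add: mult_chars_inverse[OF \<nu>])
    thus "char_mult (char_inv \<nu>) (char_mult \<nu> \<mu>) = \<mu>" "char_mult \<nu> (char_mult (char_inv \<nu>) \<mu>) = \<mu>"
      by (simp_all add: char_mult_def char_inv_def fun_eq_iff mult.left_commute)
  qed
  show ?thesis
    by (rule sum.reindex_bij_witness[of _ "char_mult (char_inv \<nu>)" "char_mult \<nu>"])
       (use cancel \<nu> in \<open>auto intro!: char_mult_in char_inv_in\<close>)
qed

lemma sum_mult_chars_inv:
  fixes f :: "('k::{finite,field} \<Rightarrow> complex) \<Rightarrow> complex"
  shows "(\<Sum>\<mu>\<in>mult_chars. f (char_inv \<mu>)) = (\<Sum>\<mu>\<in>mult_chars. f \<mu>)"
  by (rule sum.reindex_bij_witness[of _ char_inv char_inv]) (auto intro: char_inv_in)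

lemma orthogonality:
  fixes x :: "'k::{finite,field}"
  shows "(\<Sum>\<mu>\<in>mult_chars. \<mu> x) = (if x = 1 then of_nat CARD('k) - 1 else 0)"
proof (cases "x = 1")
  case True
  have "(\<Sum>\<mu>\<in>mult_chars. \<mu> (1::'k)) = (\<Sum>\<mu>\<in>(mult_chars :: ('k \<Rightarrow> complex) set). 1)"
    by (intro sum.cong refl) (simp add: mult_charsD)
  thus ?thesis using True by (simp add: card_mult_chars of_nat_diff Suc_leI)
next
  case False
  obtain \<nu> :: "'k \<Rightarrow> complex" where \<nu>: "\<nu> \<in> mult_chars" "\<And>x. \<nu> x = 1 \<Longrightarrow> x = 1"
    using ex_faithful_char[where 'k = 'k] by blast
  have "(\<Sum>\<mu>\<in>mult_chars. \<mu> x) = (\<Sum>\<mu>\<in>mult_chars. char_mult \<nu> \<mu> x)"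
    by (rule sum_mult_chars[OF \<nu>(1), symmetric])
  also have "\<dots> = \<nu> x * (\<Sum>\<mu>\<in>mult_chars. \<mu> x)" by (simp add: char_mult_def sum_distrib_left)
  finally have "(\<nu> x - 1) * (\<Sum>\<mu>\<in>mult_chars. \<mu> x) = 0" by (simp add: algebra_simps)
  thus ?thesis using \<nu>(2) False by auto
qed

lemma sum_nontrivial_char:
  fixes \<mu> :: "'k::{finite,field} \<Rightarrow> complex"
  assumes \<mu>: "\<mu> \<in> mult_chars" "\<mu> \<noteq> triv_char"
  shows "(\<Sum>x\<in>UNIV. \<mu> x) = 0"
proof -
  obtain a where a: "a \<noteq> 0" "\<mu> a \<noteq> 1"
    using \<mu> mult_charsD(1)[OF \<mu>(1)] by (auto simp: triv_char_def fun_eq_iff split: if_splits)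
  have "(\<Sum>x\<in>UNIV. \<mu> x) = (\<Sum>x\<in>UNIV. \<mu> (a * x))"
    by (rule sum.reindex_bij_witness[of _ "\<lambda>x. a * x" "\<lambda>x. x / a"]) (use a in auto)
  also have "\<dots> = \<mu> a * (\<Sum>x\<in>UNIV. \<mu> x)" by (simp add: mult_charsD[OF \<mu>(1)] sum_distrib_left)
  finally have "(\<mu> a - 1) * (\<Sum>x\<in>UNIV. \<mu> x) = 0" by (simp add: algebra_simps)
  thus ?thesis using a by simp
qed

context field_one_mod_four
begin

lemma qc_in: "qc \<in> mult_chars"
  by (auto simp: mult_chars_def qc_mult)

lemma qc_nontrivial: "qc \<noteq> triv_char"
  using ex_nonresidue by (auto simp: triv_char_def fun_eq_iff quad_char_def)

text \<open>
  A nontrivial character with values \<open>1\<close> and \<open>-1\<close> is \<open>1\<close> on squares and \<open>-1\<close> at some non-square,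
  and the non-squares form a single coset of the squares.
\<close>

lemma quadratic_chars:
  assumes \<mu>: "\<mu> \<in> mult_chars" and sq: "\<And>x. x \<noteq> 0 \<Longrightarrow> \<mu> x ^ 2 = 1"
  shows "\<mu> = triv_char \<or> \<mu> = qc"
proof (cases "\<mu> = triv_char")
  case False
  then obtain n where n: "n \<noteq> 0" "\<mu> n \<noteq> 1"
    using mult_charsD(1)[OF \<mu>] by (auto simp: triv_char_def fun_eq_iff split: if_splits)
  have square: "\<mu> x = 1" if "qc x = 1" for x
  proof -
    have x: "x \<noteq> 0" using that by auto
    have "x ^ ((CARD('f) - 1) div 2) = 1"
      using that x by (simp add: quad_char_def split: if_splits)
    then obtain w where "w ^ 2 = x" using residue_iff_square[of x] x by blast
    thus ?thesis using sq[of w] x mult_chars_power[OF \<mu>, of w 2] by auto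
  qed
  have qn: "qc n = -1" using square[of n] n by (auto simp: quad_char_def)
  have mn: "\<mu> n = -1" using sq[OF n(1)] n(2) by (simp add: power2_eq_1_iff)
  have "\<mu> x = qc x" for x
  proof -
    consider "x = 0" | "qc x = 1" | "qc x = -1" unfolding quad_char_def by metis
    thus ?thesis
    proof cases
      case 3
      hence "\<mu> (x * n) = 1" using qn by (intro square) (simp add: qc_mult)
      hence "\<mu> x * (-1) = 1" using mn by (simp add: mult_charsD[OF \<mu>])
      hence "\<mu> x = -1" by (simp add: minus_equation_iff)
      thus ?thesis using 3 by simp
    qed (use square mult_charsD(1)[OF \<mu>] in auto)
  qed
  thus ?thesis by auto
qed simp

text \<open>
  The Jacobi sum without the sign \<open>(-1) ^ (n - 1)\<close> of the general definition.
\<close>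

definition jac :: "('f \<Rightarrow> complex) \<Rightarrow> ('f \<Rightarrow> complex) \<Rightarrow> complex" where
  "jac \<alpha> \<beta> = (\<Sum>x\<in>UNIV. \<alpha> x * \<beta> (1 - x))"

lemma convolution_scale:
  assumes \<alpha>: "\<alpha> \<in> mult_chars" and \<beta>: "\<beta> \<in> mult_chars" and s: "s \<noteq> 0"
  shows "(\<Sum>x\<in>UNIV. \<alpha> x * \<beta> (s - x)) = \<alpha> s * \<beta> s * jac \<alpha> \<beta>"
proof -
  have "(\<Sum>x\<in>UNIV. \<alpha> x * \<beta> (s - x)) = (\<Sum>x\<in>UNIV. \<alpha> (s * x) * \<beta> (s - s * x))"
    by (rule sum_scale[OF s, of "\<lambda>x. \<alpha> x * \<beta> (s - x)", symmetric])
  also have "\<dots> = (\<Sum>x\<in>UNIV. \<alpha> (s * x) * \<beta> (s * (1 - x)))" by (simp add: right_diff_distrib)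
  also have "\<dots> = \<alpha> s * \<beta> s * jac \<alpha> \<beta>"
    by (simp add: jac_def mult_charsD[OF \<alpha>] mult_charsD[OF \<beta>] sum_distrib_left mult_ac)
  finally show ?thesis .
qed

text \<open>
  The product \<open>p = x (1 - x)\<close> is attained \<open>1 + \<chi> (1 - 4 p)\<close> times.
\<close>

lemma jac_self:
  assumes \<mu>: "\<mu> \<in> mult_chars" "\<mu> \<noteq> triv_char"
  shows "jac \<mu> \<mu> = \<mu> (1 / 4) * jac \<mu> qc"
proof -
  have "jac \<mu> \<mu> = (\<Sum>x\<in>UNIV. \<mu> (x * (1 - x)))" by (simp add: jac_def mult_charsD[OF \<mu>(1)])
  also have "\<dots> = (\<Sum>p\<in>UNIV. of_nat (card {x\<in>UNIV. x * (1 - x) = p}) * \<mu> p)"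
    by (rule sum_fibers[where h = "\<lambda>x. x * (1 - x)" and f = \<mu>]) auto
  also have "\<dots> = (\<Sum>p\<in>UNIV. (1 + qc (1 - 4 * p)) * \<mu> p)"
  proof (intro sum.cong refl arg_cong2[where f = "\<lambda>x y :: complex. x * y"], goal_cases)
    case (1 p)
    have "x * (1 - x) = p \<longleftrightarrow> 1 * x ^ 2 + (-1) * x + p = 0" for x
    proof -
      have "x * (1 - x) - p = - (1 * x ^ 2 + (-1) * x + p)" by (simp add: algebra_simps power2_eq_square)
      thus ?thesis by (metis eq_iff_diff_eq_0 neg_equal_0_iff_equal)
    qed
    hence "{x\<in>UNIV. x * (1 - x) = p} = {x\<in>UNIV. 1 * x ^ 2 + (-1) * x + p = 0}" by simp
    thus ?case using card_quadratic_roots[of 1 "-1" p] by simp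
  qed
  also have "\<dots> = (\<Sum>p\<in>UNIV. \<mu> p) + (\<Sum>p\<in>UNIV. \<mu> p * qc (1 - 4 * p))"
    by (simp add: algebra_simps sum.distrib)
  also have "(\<Sum>p\<in>UNIV. \<mu> p) = 0" by (rule sum_nontrivial_char[OF \<mu>])
  also have "(\<Sum>p\<in>UNIV. \<mu> p * qc (1 - 4 * p)) = (\<Sum>p\<in>UNIV. \<mu> (1 / 4 * p) * qc (1 - 4 * (1 / 4 * p)))"
    by (rule sum_scale[of "1 / 4" "\<lambda>p. \<mu> p * qc (1 - 4 * p)", symmetric]) simp
  also have "\<dots> = \<mu> (1 / 4) * jac \<mu> qc"
    unfolding jac_def sum_distrib_left mult_charsD(3)[OF \<mu>(1)] by (intro sum.cong refl) simp
  finally show ?thesis by simp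
qed

end

locale gauss_sums = field_one_mod_four ty for ty :: "'f::{finite,field} itself" +
  fixes \<psi> :: "'f \<Rightarrow> complex"
  assumes \<psi>: "nontrivial_add_char \<psi>"
begin

lemma psi_0: "\<psi> 0 = 1" and psi_add: "\<psi> (x + y) = \<psi> x * \<psi> y"
  using \<psi> by (auto simp: nontrivial_add_char_def)

lemma sum_psi: "(\<Sum>x\<in>UNIV. \<psi> x) = 0"
proof -
  obtain a where a: "\<psi> a \<noteq> 1" using \<psi> by (auto simp: nontrivial_add_char_def)
  have "(\<Sum>x\<in>UNIV. \<psi> x) = (\<Sum>x\<in>UNIV. \<psi> (x + a))" by (rule sum_shift[symmetric])
  also have "\<dots> = \<psi> a * (\<Sum>x\<in>UNIV. \<psi> x)" by (simp add: psi_add sum_distrib_left mult.commute)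
  finally have "(\<psi> a - 1) * (\<Sum>x\<in>UNIV. \<psi> x) = 0" by (simp add: algebra_simps)
  thus ?thesis using a by simp
qed

lemma sum_psi_scale: "(\<Sum>e\<in>UNIV - {0}. \<psi> (e * c)) = (if c = 0 then of_nat CARD('f) else 0) - 1"
proof -
  have "(\<Sum>e\<in>UNIV. \<psi> (c * e)) = (if c = 0 then of_nat CARD('f) else 0)"
    using sum_scale[of c \<psi>] sum_psi by (cases "c = 0") (simp_all add: psi_0)
  thus ?thesis using sum_remove_0[of "\<lambda>e. \<psi> (e * c)"] by (simp add: psi_0 mult.commute algebra_simps)
qed

abbreviation g :: "('f \<Rightarrow> complex) \<Rightarrow> complex" where "g \<equiv> gauss_sum \<psi>"
abbreviation gc :: "('f \<Rightarrow> complex) \<Rightarrow> complex" where "gc \<equiv> gauss_sum_circ \<psi>"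

lemma g_eq: "\<mu> \<in> mult_chars \<Longrightarrow> g \<mu> = - (\<Sum>x\<in>UNIV. \<mu> x * \<psi> x)"
  using sum_remove_0[of "\<lambda>x. \<mu> x * \<psi> x"] by (simp add: gauss_sum_def mult_charsD)

lemma g_triv: "g triv_char = 1"
proof -
  have "(\<Sum>x\<in>UNIV - {0}. triv_char x * \<psi> x) = (\<Sum>x\<in>UNIV - {0}. \<psi> x)"
    by (intro sum.cong refl) (simp add: triv_char_def)
  thus ?thesis using sum_remove_0[of \<psi>] sum_psi by (simp add: gauss_sum_def psi_0 add_eq_0_iff)
qed

lemma g_mult:
  assumes \<alpha>: "\<alpha> \<in> mult_chars" and \<beta>: "\<beta> \<in> mult_chars"
  shows "g \<alpha> * g \<beta> = (\<Sum>s\<in>UNIV. \<psi> s * (\<Sum>x\<in>UNIV. \<alpha> x * \<beta> (s - x)))"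
proof -
  have "g \<alpha> * g \<beta> = (\<Sum>x\<in>UNIV. \<Sum>y\<in>UNIV. \<alpha> x * \<beta> y * \<psi> (y + x))"
    by (simp add: g_eq \<alpha> \<beta> sum_product psi_add mult_ac)
  also have "\<dots> = (\<Sum>x\<in>UNIV. \<Sum>s\<in>UNIV. \<alpha> x * \<beta> (s - x) * \<psi> s)"
  proof (rule sum.cong[OF refl])
    fix x
    show "(\<Sum>y\<in>UNIV. \<alpha> x * \<beta> y * \<psi> (y + x)) = (\<Sum>s\<in>UNIV. \<alpha> x * \<beta> (s - x) * \<psi> s)"
      using sum_shift[of "\<lambda>s. \<alpha> x * \<beta> (s - x) * \<psi> s" x] by simp
  qed
  also have "\<dots> = (\<Sum>s\<in>UNIV. \<Sum>x\<in>UNIV. \<alpha> x * \<beta> (s - x) * \<psi> s)" by (rule sum.swap)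
  finally show ?thesis by (simp add: sum_distrib_left mult_ac)
qed

text \<open>
  The convolution of two characters is a multiple of their product. This holds at \<open>0\<close> too, where
  it is the sum of a nontrivial character.
\<close>

lemma g_mult_jac:
  assumes \<alpha>: "\<alpha> \<in> mult_chars" and \<beta>: "\<beta> \<in> mult_chars" and nt: "char_mult \<alpha> \<beta> \<noteq> triv_char"
  shows "g \<alpha> * g \<beta> = - jac \<alpha> \<beta> * g (char_mult \<alpha> \<beta>)"
proof -
  have conv: "(\<Sum>x\<in>UNIV. \<alpha> x * \<beta> (s - x)) = char_mult \<alpha> \<beta> s * jac \<alpha> \<beta>" for s
  proof (cases "s = 0")
    case True
    have "\<alpha> x * \<beta> (s - x) = \<beta> (-1) * char_mult \<alpha> \<beta> x" for x
      using mult_charsD(3)[OF \<beta>, of "-1" x] by (simp add: True char_mult_def)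
    hence "(\<Sum>x\<in>UNIV. \<alpha> x * \<beta> (s - x)) = \<beta> (-1) * (\<Sum>x\<in>UNIV. char_mult \<alpha> \<beta> x)"
      by (simp only: sum_distrib_left)
    also have "(\<Sum>x\<in>UNIV. char_mult \<alpha> \<beta> x) = 0"
      by (rule sum_nontrivial_char[OF char_mult_in[OF \<alpha> \<beta>] nt])
    finally show ?thesis using True by (simp add: char_mult_def mult_charsD[OF \<alpha>])
  qed (simp add: convolution_scale[OF \<alpha> \<beta>] char_mult_def)
  show ?thesis unfolding g_mult[OF \<alpha> \<beta>] conv g_eq[OF char_mult_in[OF \<alpha> \<beta>]]
    by (simp add: sum_distrib_left sum_negf mult_ac)
qed

lemma g_inv:
  assumes \<mu>: "\<mu> \<in> mult_chars" "\<mu> \<noteq> triv_char"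
  shows "g \<mu> * g (char_inv \<mu>) = \<mu> (-1) * of_nat CARD('f)"
proof -
  have "g \<mu> * g (char_inv \<mu>) = (\<Sum>y\<in>UNIV - {0}. \<Sum>x\<in>UNIV. \<mu> x * \<mu> (inverse y) * \<psi> (x + y))"
    unfolding g_eq[OF \<mu>(1)] gauss_sum_def[of _ "char_inv \<mu>"] char_inv_def minus_mult_minus sum_product
    by (subst sum.swap) (simp add: psi_add mult_ac)
  also have "\<dots> = (\<Sum>y\<in>UNIV - {0}. \<Sum>z\<in>UNIV. \<mu> z * \<psi> (y * (z + 1)))"
  proof (rule sum.cong[OF refl])
    fix y :: 'f assume y: "y \<in> UNIV - {0}"
    have "(\<Sum>x\<in>UNIV. \<mu> x * \<mu> (inverse y) * \<psi> (x + y)) = (\<Sum>z\<in>UNIV. \<mu> (y * z) * \<mu> (inverse y) * \<psi> (y * z + y))"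
      using y by (intro sum_scale[symmetric, of y "\<lambda>x. \<mu> x * \<mu> (inverse y) * \<psi> (x + y)"]) simp
    also have "\<dots> = (\<Sum>z\<in>UNIV. \<mu> z * \<psi> (y * (z + 1)))"
    proof (intro sum.cong refl)
      fix z
      have "\<mu> (y * z) * \<mu> (inverse y) = \<mu> (y * z * inverse y)" by (simp only: mult_charsD(3)[OF \<mu>(1)])
      also have "y * z * inverse y = z" using y by simp
      finally show "\<mu> (y * z) * \<mu> (inverse y) * \<psi> (y * z + y) = \<mu> z * \<psi> (y * (z + 1))"
        by (simp add: distrib_left)
    qed
    finally show "(\<Sum>x\<in>UNIV. \<mu> x * \<mu> (inverse y) * \<psi> (x + y)) = (\<Sum>z\<in>UNIV. \<mu> z * \<psi> (y * (z + 1)))" .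
  qed
  also have "\<dots> = (\<Sum>z\<in>UNIV. \<mu> z * (\<Sum>y\<in>UNIV - {0}. \<psi> (y * (z + 1))))"
    by (subst sum.swap) (simp add: sum_distrib_left)
  also have "\<dots> = (\<Sum>z\<in>UNIV. (if z = -1 then \<mu> z * of_nat CARD('f) else 0) - \<mu> z)"
  proof (intro sum.cong refl)
    fix z :: 'f
    have "z + 1 = 0 \<longleftrightarrow> z = -1" by (simp add: eq_neg_iff_add_eq_0)
    thus "\<mu> z * (\<Sum>y\<in>UNIV - {0}. \<psi> (y * (z + 1))) = (if z = -1 then \<mu> z * of_nat CARD('f) else 0) - \<mu> z"
      unfolding sum_psi_scale by (simp add: right_diff_distrib)
  qed
  also have "\<dots> = \<mu> (-1) * of_nat CARD('f)"
    by (simp add: sum_subtractf sum_nontrivial_char[OF \<mu>])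
  finally show ?thesis .
qed

text \<open>
  The factor \<open>Q\<close> in \<open>gc\<close> at the trivial character makes the reflection formula hold without
  exception.
\<close>

lemma gc_inv:
  assumes \<mu>: "\<mu> \<in> mult_chars"
  shows "gc \<mu> * g (char_inv \<mu>) = \<mu> (-1) * of_nat CARD('f)"
proof (cases "\<mu> = triv_char")
  case True
  have "char_inv triv_char = (triv_char :: 'f \<Rightarrow> complex)" by (auto simp: char_inv_def triv_char_def fun_eq_iff)
  thus ?thesis using True by (simp add: gauss_sum_circ_def g_triv) (simp add: triv_char_def)
qed (simp add: gauss_sum_circ_def g_inv[OF \<mu>])

lemma minus_1_sq: "\<mu> \<in> mult_chars \<Longrightarrow> \<mu> (-1) * \<mu> (-1) = 1"
  using mult_charsD(3)[of \<mu> "-1" "-1"] mult_charsD(2)[of \<mu>] by simp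

lemma g_nonzero: "\<mu> \<in> mult_chars \<Longrightarrow> g \<mu> \<noteq> 0"
  using g_inv[of \<mu>] minus_1_sq[of \<mu>] g_triv by (cases "\<mu> = triv_char") auto

lemma gc_nonzero: "\<mu> \<in> mult_chars \<Longrightarrow> gc \<mu> \<noteq> 0"
  using g_nonzero by (simp add: gauss_sum_circ_def)

lemma inverse_gc:
  "\<mu> \<in> mult_chars \<Longrightarrow> 1 / gc \<mu> = \<mu> (-1) * g (char_inv \<mu>) / of_nat CARD('f)"
  using gc_inv[of \<mu>] minus_1_sq[of \<mu>] gc_nonzero[of \<mu>]
  by (simp add: field_simps) (metis mult.assoc mult.commute mult.left_neutral)

lemma g_qc_sq: "g qc * g qc = of_nat CARD('f)"
proof -
  have "qc (inverse x) = qc x" for x using qc_divide[of 1 x] by (simp add: divide_inverse)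
  hence "char_inv qc = qc" by (simp add: char_inv_def fun_eq_iff)
  thus ?thesis using g_inv[OF qc_in qc_nontrivial] by simp
qed

text \<open>
  The Hasse-Davenport product formula for the quadratic character. In the generic case it
  follows by comparing the expressions for \<open>g \<mu> * g \<mu>\<close> and \<open>g \<mu> * g qc\<close> in terms of Jacobi sums,
  since the two Jacobi sums agree up to the factor \<open>\<mu> (1 / 4)\<close> (\<open>jac_self\<close>).
\<close>

lemma gauss_duplication:
  assumes \<mu>: "\<mu> \<in> mult_chars"
  shows "g \<mu> * g (char_mult \<mu> qc) = g (char_mult \<mu> \<mu>) * g qc * \<mu> (1 / 4)"
proof -
  consider "\<mu> = triv_char" | "\<mu> = qc" | "\<mu> \<noteq> triv_char" "\<mu> \<noteq> qc" by blast
  thus ?thesis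
  proof cases
    case 1
    have "char_mult triv_char qc = qc" "char_mult triv_char triv_char = (triv_char :: 'f \<Rightarrow> complex)"
      by (auto simp: char_mult_def triv_char_def fun_eq_iff)
    thus ?thesis using 1 g_triv by (simp add: triv_char_def)
  next
    case 2
    have "char_mult qc qc = triv_char"
      by (auto simp: char_mult_def triv_char_def fun_eq_iff qc_self)
    moreover have "qc (1 / 4) = 1" using qc_divide[of 1 4] by simp
    ultimately show ?thesis using 2 g_triv by simp
  next
    case 3
    have sq: "char_mult \<mu> \<mu> \<noteq> triv_char"
    proof
      assume "char_mult \<mu> \<mu> = triv_char"
      hence "\<mu> x ^ 2 = 1" if "x \<noteq> 0" for x
        using that by (metis char_mult_def power2_eq_square triv_char_def)
      thus False using quadratic_chars[OF \<mu>] 3 by blast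
    qed
    have nt: "char_mult \<mu> qc \<noteq> triv_char"
    proof
      assume eq: "char_mult \<mu> qc = triv_char"
      have "\<mu> x = qc x" for x
      proof (cases "x = 0")
        case False
        have "\<mu> x * qc x = 1" using fun_cong[OF eq, of x] False by (simp add: char_mult_def triv_char_def)
        hence "\<mu> x * (qc x * qc x) = qc x" by (simp flip: mult.assoc)
        thus ?thesis using qc_self[OF False] by simp
      qed (simp add: mult_charsD[OF \<mu>])
      thus False using 3 by auto
    qed
    define J where "J = jac \<mu> qc"
    have e1: "g \<mu> * g \<mu> = - (\<mu> (1 / 4) * J) * g (char_mult \<mu> \<mu>)"
      using g_mult_jac[OF \<mu> \<mu> sq] jac_self[OF \<mu> 3(1)] by (simp add: J_def)
    have e2: "g \<mu> * g qc = - J * g (char_mult \<mu> qc)"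
      using g_mult_jac[OF \<mu> qc_in nt] by (simp add: J_def)
    have J0: "J \<noteq> 0" using e2 g_nonzero[OF \<mu>] g_nonzero[OF qc_in] by auto
    have "- J * (g \<mu> * g (char_mult \<mu> qc)) = g \<mu> * (g \<mu> * g qc)" using e2 by simp
    also have "\<dots> = - J * (g (char_mult \<mu> \<mu>) * g qc * \<mu> (1 / 4))"
      using e1 by (simp flip: mult.assoc)
    finally show ?thesis using J0 by simp
  qed
qed

end

section \<open>The hypergeometric sum as a point count\<close>

context field_one_mod_four
begin

text \<open>The condition is linear in \<open>c\<close> and can be solved for it.\<close>

lemma k3_sum_as_count:
  assumes "L \<noteq> 0"
  shows "(\<Sum>a\<in>UNIV. \<Sum>b\<in>UNIV. \<Sum>c\<in>UNIV. if a + b + c + 1 = 4 * L ^ 2 * (a * b * c) then qc (a * b * c) else 0)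
         = k3_sum (1 / L ^ 2)"
  unfolding k3_sum_symmetric_form[OF assms, symmetric]
proof (intro sum.cong refl, goal_cases)
  case (1 a b)
  define k where "k = 4 * L ^ 2 * a * b - 1"
  have iff: "a + b + c + 1 = 4 * L ^ 2 * (a * b * c) \<longleftrightarrow> a + b + 1 = c * k" for c
  proof -
    have "a + b + c + 1 - 4 * L ^ 2 * (a * b * c) = a + b + 1 - c * k" by (simp add: k_def algebra_simps)
    thus ?thesis by (metis eq_iff_diff_eq_0)
  qed
  show ?case
  proof (cases "k = 0")
    case True
    have "(\<Sum>c\<in>UNIV. if a + b + 1 = c * k then qc (a * b * c) else 0) =
          (if a + b + 1 = 0 then qc (a * b) else 0) * (\<Sum>c\<in>UNIV. qc c)"
      by (simp add: True qc_mult sum_distrib_left)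
    also have "\<dots> = 0" by (simp add: sum_qc)
    finally show ?thesis using True unfolding iff by (simp add: k_def)
  next
    case False
    have "(\<Sum>c\<in>UNIV. if a + b + 1 = c * k then qc (a * b * c) else 0) =
          (\<Sum>c\<in>UNIV. if c = (a + b + 1) / k then qc (a * b * c) else 0)"
      using False by (intro sum.cong if_cong refl) (auto simp: field_simps)
    also have "\<dots> = qc (a * b * ((a + b + 1) / k))" by simp
    also have "\<dots> = qc (a * b * (a + b + 1) * k)" by (simp add: qc_mult qc_divide)
    finally show ?thesis unfolding iff by (simp add: k_def)
  qed
qed

end

lemma char_pow_add:
  "char_mult (char_pow A i) (char_mult (char_pow A j) \<mu>) = char_mult (char_pow A (i + j)) \<mu>"
  by (simp add: char_mult_def char_pow_def fun_eq_iff power_add)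

locale quartic_gauss = gauss_sums ty \<psi> for ty :: "'f::{finite,field} itself" and \<psi> +
  fixes A :: "'f \<Rightarrow> complex"
  assumes A: "A \<in> mult_chars" and A_sq: "A x ^ 2 = qc x"
begin

lemma A_4: "x \<noteq> 0 \<Longrightarrow> A x ^ 4 = 1"
proof -
  assume "x \<noteq> 0"
  hence "(A x ^ 2) ^ 2 = 1" using qc_self[of x] unfolding A_sq by (simp add: power2_eq_square)
  thus ?thesis by (simp flip: power_mult)
qed

abbreviation B :: "nat \<Rightarrow> 'f \<Rightarrow> complex" where "B \<equiv> char_pow A"

lemma B_in: "B k \<in> mult_chars"
  by (rule char_pow_in[OF A])

lemma B_0: "B 0 = triv_char"
  by (simp add: char_pow_def triv_char_def fun_eq_iff)

lemma B_1: "B 1 = A"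
  by (simp add: char_pow_def fun_eq_iff mult_charsD[OF A])

lemma B_2: "B 2 = qc"
  by (simp add: char_pow_def fun_eq_iff A_sq)

lemma B_add_4: "B (k + 4) = B k"
  using A_4 by (simp add: char_pow_def fun_eq_iff power_add)

lemma B_mult: "char_mult (B i) (B j) = B (i + j)"
  by (simp add: char_mult_def char_pow_def fun_eq_iff power_add)

lemma triv_mult: "\<mu> \<in> mult_chars \<Longrightarrow> char_mult (B 0) \<mu> = \<mu>"
  by (auto simp: char_mult_def char_pow_def fun_eq_iff mult_charsD)

lemma B_distinct:
  "B 0 \<noteq> B 1" "B 0 \<noteq> B 2" "B 0 \<noteq> B 3" "B 1 \<noteq> B 2" "B 1 \<noteq> B 3" "B 2 \<noteq> B 3"
proof -
  have step: "B (i + k) = B (j + k)" if "B i = B j" for i j k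
    using that B_mult[of i k] B_mult[of j k] by simp
  show n2: "B 0 \<noteq> B 2" using qc_nontrivial by (simp add: B_0 B_2)
  have B4: "B 4 = B 0" using B_add_4[of 0] by simp
  show n1: "B 0 \<noteq> B 1"
  proof
    assume e: "B 0 = B 1"
    have "B 1 = B 2" using step[OF e, of 1] by (simp add: numeral_2_eq_2)
    thus False using e n2 by simp
  qed
  show "B 0 \<noteq> B 3"
  proof
    assume e: "B 0 = B 3"
    have "B 1 = B 4" using step[OF e, of 1] by simp
    thus False using B4 n1 by simp
  qed
  show "B 1 \<noteq> B 2"
  proof
    assume e: "B 1 = B 2"
    have "B 4 = B 5" using step[OF e, of 3] by simp
    thus False using B4 B_add_4[of 1] n1 by simp
  qed
  show "B 1 \<noteq> B 3"
  proof
    assume e: "B 1 = B 3"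
    have "B 4 = B 6" using step[OF e, of 3] by simp
    thus False using B4 B_add_4[of 2] n2 by simp
  qed
  show "B 2 \<noteq> B 3"
  proof
    assume e: "B 2 = B 3"
    have "B 4 = B 5" using step[OF e, of 2] by simp
    thus False using B4 B_add_4[of 1] n1 by simp
  qed
qed

text \<open>
  With \<open>i\<^sup>2 = -1\<close> one has \<open>-4 = (1 + i)\<^sup>4\<close>, and \<open>A\<close> is trivial on fourth powers.
\<close>

lemma A_minus_4: "A (-1) * A (1 / 4) = 1"
proof -
  have "(-1::'f) ^ ((CARD('f) - 1) div 2) = 1"
    using qc_minus_1 by (simp add: quad_char_def split: if_splits)
  then obtain i :: 'f where i: "i ^ 2 = -1" using residue_iff_square[of "-1"] by auto
  have p4: "(1 + i) ^ 4 = - 4"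
  proof -
    have "(1 + i) ^ 2 = 2 * i" using i by (simp add: power2_sum)
    hence "((1 + i) ^ 2) ^ 2 = - 4" using i by (simp add: power_mult_distrib)
    thus ?thesis by (simp flip: power_mult)
  qed
  have "1 + i \<noteq> 0"
  proof
    assume "1 + i = 0"
    hence "(1 + i) ^ 4 = 0" by simp
    hence "- (4::'f) = 0" using p4 by (simp only:)
    thus False by simp
  qed
  hence "A (- 4) = 1" using mult_chars_power[OF A, of "1 + i" 4] p4 A_4[of "1 + i"] by simp
  hence "A (-1) * A 4 = 1" using mult_charsD(3)[OF A, of "-1" 4] by simp
  moreover have "A (1 / 4) * A 4 = 1" using mult_charsD(3)[OF A, of "1 / 4" 4] mult_charsD(2)[OF A] by simp
  ultimately have "A (1 / 4) = A (-1)" by (metis mult_right_cancel mult_zero_right zero_neq_one)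
  thus ?thesis using minus_1_sq[OF A] by simp
qed

text \<open>
  Replacing the summation variable \<open>\<nu>\<close> by \<open>B (4 - m) * \<mu>\<close> moves the upper parameters to the
  trivial character and permutes the four lower ones cyclically. Before the shift one lower
  parameter is \<open>B m\<close> and cancels against an upper one; after it the lower parameters are the
  nontrivial powers of \<open>A\<close>. The fourth power of \<open>w\<close> makes the values \<open>B k (w ^ 4)\<close> equal to \<open>1\<close>.
\<close>

lemma hyp_F_shifted:
  assumes m: "m \<in> {1, 2, 3}" and w: "w \<noteq> 0"
  shows "hyp_F_red \<psi> {#B m, B m, B m, B m#} {#B 0, B 1, B 2, B 3#} (w ^ 4) =
     1 / (1 - of_nat CARD('f)) * (of_nat CARD('f) * g (B 1) * g (B 2) * g (B 3) / g (B m) ^ 4) *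
     (\<Sum>\<mu>\<in>mult_chars. g \<mu> ^ 3 / (gc (char_mult (B 1) \<mu>) * gc (char_mult (B 2) \<mu>) * gc (char_mult (B 3) \<mu>)) * \<mu> (w ^ 4))"
proof -
  have gB: "gc (B k) = g (B k)" if "k \<in> {1, 2, 3}" for k
    using that B_distinct by (auto simp: gauss_sum_circ_def B_0[symmetric])
  have gB0: "gc (B 0) = of_nat CARD('f)" by (simp add: B_0 gauss_sum_circ_def g_triv)
  have nz: "g (B k) \<noteq> 0" "gc (B k) \<noteq> 0" for k by (simp_all add: g_nonzero gc_nonzero B_in)
  have wval: "char_mult (B k) \<mu> (w ^ 4) = \<mu> (w ^ 4)" for k \<mu>
    using A_4[OF w] w by (simp add: char_mult_def char_pow_def mult_chars_power[OF A])
  have main: "hyp_F \<psi> {#B m, B m, B m#} {#B i, B j, B k#} (w ^ 4) =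
     1 / (1 - of_nat CARD('f)) * (gc (B i) * gc (B j) * gc (B k) / g (B m) ^ 3) *
     (\<Sum>\<mu>\<in>mult_chars. g \<mu> ^ 3 / (gc (char_mult (B (i + (4 - m))) \<mu>) * gc (char_mult (B (j + (4 - m))) \<mu>) *
         gc (char_mult (B (k + (4 - m))) \<mu>)) * \<mu> (w ^ 4))" for i j k
  proof -
    define h where "h = (\<lambda>\<nu>. poch \<psi> (B m) \<nu> ^ 3 /
      (poch_circ \<psi> (B i) \<nu> * poch_circ \<psi> (B j) \<nu> * poch_circ \<psi> (B k) \<nu>) * \<nu> (w ^ 4))"
    have "hyp_F \<psi> {#B m, B m, B m#} {#B i, B j, B k#} (w ^ 4) =
        1 / (1 - of_nat CARD('f)) * (\<Sum>\<nu>\<in>mult_chars. h \<nu>)"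
      by (simp add: hyp_F_def h_def power3_eq_cube mult_ac)
    also have "(\<Sum>\<nu>\<in>mult_chars. h \<nu>) = (\<Sum>\<mu>\<in>mult_chars. h (char_mult (B (4 - m)) \<mu>))"
      by (rule sum_mult_chars[OF B_in, symmetric])
    also have "\<dots> = (\<Sum>\<mu>\<in>mult_chars. gc (B i) * gc (B j) * gc (B k) / g (B m) ^ 3 *
        (g \<mu> ^ 3 / (gc (char_mult (B (i + (4 - m))) \<mu>) * gc (char_mult (B (j + (4 - m))) \<mu>) *
         gc (char_mult (B (k + (4 - m))) \<mu>)) * \<mu> (w ^ 4)))"
    proof (intro sum.cong refl)
      fix \<mu> :: "'f \<Rightarrow> complex" assume \<mu>: "\<mu> \<in> mult_chars"
      have "m + (4 - m) = 0 + 4" using m by auto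
      hence "char_mult (B m) (char_mult (B (4 - m)) \<mu>) = \<mu>"
        by (simp only: char_pow_add B_add_4 triv_mult[OF \<mu>])
      thus "h (char_mult (B (4 - m)) \<mu>) = gc (B i) * gc (B j) * gc (B k) / g (B m) ^ 3 *
        (g \<mu> ^ 3 / (gc (char_mult (B (i + (4 - m))) \<mu>) * gc (char_mult (B (j + (4 - m))) \<mu>) *
         gc (char_mult (B (k + (4 - m))) \<mu>)) * \<mu> (w ^ 4))"
        unfolding h_def poch_def poch_circ_def char_pow_add wval by (simp add: power_divide mult_ac)
    qed
    finally show ?thesis by (simp add: sum_distrib_left mult.assoc)
  qed
  have B456: "B 4 = B 0" "B 5 = B 1" "B 6 = B 2" using B_add_4[of 0] B_add_4[of 1] B_add_4[of 2] by simp_all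
  have up: "{#B m, B m, B m, B m#} - {#B 0, B 1, B 2, B 3#} = {#B m, B m, B m#}"
    using m B_distinct by (intro multiset_eqI) auto
  consider "m = 1" | "m = 2" | "m = 3" using m by auto
  thus ?thesis
  proof cases
    case 1
    have low: "{#B 0, B 1, B 2, B 3#} - {#B m, B m, B m, B m#} = {#B 0, B 2, B 3#}"
      using 1 B_distinct by (intro multiset_eqI) auto
    have idx: "0 + (4 - m) = 3" "2 + (4 - m) = 5" "3 + (4 - m) = 6" using 1 by auto
    have "gc (B 0) * gc (B 2) * gc (B 3) / g (B m) ^ 3 =
       of_nat CARD('f) * g (B 1) * g (B 2) * g (B 3) / g (B m) ^ 4"
      unfolding 1 using nz(1)[of 1]
      by (simp add: gB gB0 power3_eq_cube power4_eq_xxxx mult_ac)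
    thus ?thesis unfolding hyp_F_red_def up low main[of 0 2 3] idx B456 by (simp only: mult_ac)
  next
    case 2
    have low: "{#B 0, B 1, B 2, B 3#} - {#B m, B m, B m, B m#} = {#B 0, B 1, B 3#}"
      using 2 B_distinct by (intro multiset_eqI) auto
    have idx: "0 + (4 - m) = 2" "1 + (4 - m) = 3" "3 + (4 - m) = 5" using 2 by auto
    have "gc (B 0) * gc (B 1) * gc (B 3) / g (B m) ^ 3 =
       of_nat CARD('f) * g (B 1) * g (B 2) * g (B 3) / g (B m) ^ 4"
      unfolding 2 using nz(1)[of 2]
      by (simp add: gB gB0 power3_eq_cube power4_eq_xxxx mult_ac)
    thus ?thesis unfolding hyp_F_red_def up low main[of 0 1 3] idx B456 by (simp only: mult_ac)
  next
    case 3
    have low: "{#B 0, B 1, B 2, B 3#} - {#B m, B m, B m, B m#} = {#B 0, B 1, B 2#}"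
      using 3 B_distinct by (intro multiset_eqI) auto
    have idx: "0 + (4 - m) = 1" "1 + (4 - m) = 2" "2 + (4 - m) = 3" using 3 by auto
    have "gc (B 0) * gc (B 1) * gc (B 2) / g (B m) ^ 3 =
       of_nat CARD('f) * g (B 1) * g (B 2) * g (B 3) / g (B m) ^ 4"
      unfolding 3 using nz(1)[of 3]
      by (simp add: gB gB0 power3_eq_cube power4_eq_xxxx mult_ac)
    thus ?thesis unfolding hyp_F_red_def up low main[of 0 1 2] idx B456 by (simp only: mult_ac)
  qed
qed

lemma g_scale: "\<mu> \<in> mult_chars \<Longrightarrow> e \<noteq> 0 \<Longrightarrow> g \<mu> = - (\<mu> e * (\<Sum>x\<in>UNIV. \<mu> x * \<psi> (e * x)))"
  using sum_scale[of e "\<lambda>x. \<mu> x * \<psi> x"] by (simp add: g_eq mult_charsD sum_distrib_left mult_ac)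

text \<open>
  Let \<open>e\<close> be the summation variable of the Gauss sum of \<open>qc * \<mu> * \<mu>\<close>. Rescaling the variables
  \<open>a\<close>, \<open>b\<close>, \<open>c\<close>, \<open>d\<close> of the other four Gauss sums by \<open>e\<close> cancels all characters of \<open>e\<close>, because
  the product of the five characters is trivial, and leaves the sum of
  \<open>\<psi> (e (a + b + c + d + 1))\<close>, which detects \<open>a + b + c + d + 1 = 0\<close>. The sum over \<open>\<mu>\<close> then
  detects \<open>d = a b c / y\<close>.
\<close>

lemma gauss_product_sum:
  assumes y: "y \<noteq> 0" "qc y = 1"
  shows "(\<Sum>\<mu>\<in>mult_chars. g (char_inv \<mu>) ^ 3 * g (char_mult qc \<mu>) * g (char_mult qc (char_mult \<mu> \<mu>)) * \<mu> y) =
    - (of_nat CARD('f) - 1) * of_nat CARD('f) *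
      (\<Sum>a\<in>UNIV. \<Sum>b\<in>UNIV. \<Sum>c\<in>UNIV. if a + b + c + a * b * c / y + 1 = 0 then qc (a * b * c) else 0)"
proof -
  define R where "R = (\<lambda>a b c d. (if a + b + c + d + 1 = (0::'f) then of_nat CARD('f) else 0) - (1::complex))"
  have tm: "g (char_inv \<mu>) ^ 3 * g (char_mult qc \<mu>) * g (char_mult qc (char_mult \<mu> \<mu>)) * \<mu> y =
     - (\<Sum>a\<in>UNIV. \<Sum>b\<in>UNIV. \<Sum>c\<in>UNIV. \<Sum>d\<in>UNIV. qc d * R a b c d * \<mu> (y * d / (a * b * c)))"
    if \<mu>: "\<mu> \<in> mult_chars" for \<mu>
  proof -
    define i where "i = char_inv \<mu>"
    have i: "i \<in> mult_chars" unfolding i_def by (rule char_inv_in[OF \<mu>])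
    have q: "char_mult qc \<mu> \<in> mult_chars" by (rule char_mult_in[OF qc_in \<mu>])
    have qq: "char_mult qc (char_mult \<mu> \<mu>) \<in> mult_chars" by (intro char_mult_in qc_in \<mu>)
    define S where "S = (\<lambda>\<eta> e. \<Sum>x\<in>UNIV. \<eta> x * \<psi> (e * x))"
    have scaled: "g i ^ 3 * g (char_mult qc \<mu>) * (qc e * \<mu> e ^ 2) = S i e ^ 3 * S (char_mult qc \<mu>) e"
      if e: "e \<noteq> 0" for e
    proof -
      have ie: "i e * \<mu> e = 1" unfolding i_def char_inv_def
        using mult_charsD(3)[OF \<mu>, of "inverse e" e] mult_charsD(2)[OF \<mu>] e by simp
      have "g i ^ 3 * g (char_mult qc \<mu>) = (- (i e * S i e)) ^ 3 * (- (qc e * \<mu> e * S (char_mult qc \<mu>) e))"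
        unfolding S_def using g_scale[OF i e] g_scale[OF q e] by (simp add: char_mult_def)
      hence "g i ^ 3 * g (char_mult qc \<mu>) * (qc e * \<mu> e ^ 2) =
         (i e * \<mu> e) ^ 3 * (qc e * qc e) * (S i e ^ 3 * S (char_mult qc \<mu>) e)"
        by (simp add: power3_eq_cube power2_eq_square mult_ac)
      thus ?thesis using ie qc_self[OF e] by simp
    qed
    have "g i ^ 3 * g (char_mult qc \<mu>) * g (char_mult qc (char_mult \<mu> \<mu>)) =
       - (\<Sum>e\<in>UNIV - {0}. (g i ^ 3 * g (char_mult qc \<mu>) * (qc e * \<mu> e ^ 2)) * \<psi> e)"
      by (simp add: gauss_sum_def[of _ "char_mult qc (char_mult \<mu> \<mu>)"] char_mult_def power2_eq_square sum_distrib_left mult_ac)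
    also have "\<dots> = - (\<Sum>e\<in>UNIV - {0}. (S i e ^ 3 * S (char_mult qc \<mu>) e) * \<psi> e)"
      using scaled by (intro arg_cong[where f = uminus] sum.cong) auto
    also have "(\<Sum>e\<in>UNIV - {0}. (S i e ^ 3 * S (char_mult qc \<mu>) e) * \<psi> e) =
       (\<Sum>e\<in>UNIV - {0}. \<Sum>a\<in>UNIV. \<Sum>b\<in>UNIV. \<Sum>c\<in>UNIV. \<Sum>d\<in>UNIV.
          qc d * (i a * i b * i c * \<mu> d) * \<psi> (e * (a + b + c + d + 1)))"
    proof (rule sum.cong[OF refl])
      fix e
      have "S i e ^ 3 * S (char_mult qc \<mu>) e * \<psi> e = S i e * (S i e * (S i e * (S (char_mult qc \<mu>) e * \<psi> e)))"
        by (simp add: power3_eq_cube mult_ac)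
      also have "\<dots> = (\<Sum>a\<in>UNIV. \<Sum>b\<in>UNIV. \<Sum>c\<in>UNIV. \<Sum>d\<in>UNIV.
          (i a * \<psi> (e * a)) * ((i b * \<psi> (e * b)) * ((i c * \<psi> (e * c)) * (char_mult qc \<mu> d * \<psi> (e * d) * \<psi> e))))"
        by (simp only: S_def sum_distrib_right) (simp only: sum_distrib_left)
      also have "\<dots> = (\<Sum>a\<in>UNIV. \<Sum>b\<in>UNIV. \<Sum>c\<in>UNIV. \<Sum>d\<in>UNIV.
          qc d * (i a * i b * i c * \<mu> d) * \<psi> (e * (a + b + c + d + 1)))"
        by (intro sum.cong refl) (simp add: char_mult_def distrib_left psi_add mult_ac)
      finally show "S i e ^ 3 * S (char_mult qc \<mu>) e * \<psi> e = (\<Sum>a\<in>UNIV. \<Sum>b\<in>UNIV. \<Sum>c\<in>UNIV. \<Sum>d\<in>UNIV.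
          qc d * (i a * i b * i c * \<mu> d) * \<psi> (e * (a + b + c + d + 1)))" .
    qed
    also have "\<dots> = (\<Sum>a\<in>UNIV. \<Sum>b\<in>UNIV. \<Sum>c\<in>UNIV. \<Sum>d\<in>UNIV.
          qc d * (i a * i b * i c * \<mu> d) * (\<Sum>e\<in>UNIV - {0}. \<psi> (e * (a + b + c + d + 1))))"
      unfolding sum_distrib_left
      by (subst sum.swap, rule sum.cong[OF refl], subst sum.swap, rule sum.cong[OF refl],
          subst sum.swap, rule sum.cong[OF refl], subst sum.swap, rule refl)
    also have "\<dots> = (\<Sum>a\<in>UNIV. \<Sum>b\<in>UNIV. \<Sum>c\<in>UNIV. \<Sum>d\<in>UNIV.
          qc d * (i a * i b * i c * \<mu> d) * R a b c d)"
      unfolding sum_psi_scale R_def ..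
    finally have "g i ^ 3 * g (char_mult qc \<mu>) * g (char_mult qc (char_mult \<mu> \<mu>)) * \<mu> y =
       - (\<Sum>a\<in>UNIV. \<Sum>b\<in>UNIV. \<Sum>c\<in>UNIV. \<Sum>d\<in>UNIV. qc d * (i a * i b * i c * \<mu> d) * R a b c d * \<mu> y)"
      by (simp add: sum_distrib_right)
    moreover have "qc d * (i a * i b * i c * \<mu> d) * R a b c d * \<mu> y = qc d * R a b c d * \<mu> (y * d / (a * b * c))" for a b c d
      by (simp add: i_def char_inv_def mult_charsD(3)[OF \<mu>] divide_inverse)
    ultimately show ?thesis unfolding i_def by (simp only:)
  qed
  have "(\<Sum>\<mu>\<in>mult_chars. g (char_inv \<mu>) ^ 3 * g (char_mult qc \<mu>) * g (char_mult qc (char_mult \<mu> \<mu>)) * \<mu> y) =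
    (\<Sum>\<mu>\<in>mult_chars. - (\<Sum>a\<in>UNIV. \<Sum>b\<in>UNIV. \<Sum>c\<in>UNIV. \<Sum>d\<in>UNIV. qc d * R a b c d * \<mu> (y * d / (a * b * c))))"
    by (intro sum.cong refl tm)
  also have "\<dots> = - (\<Sum>\<mu>\<in>mult_chars. \<Sum>a\<in>UNIV. \<Sum>b\<in>UNIV. \<Sum>c\<in>UNIV. \<Sum>d\<in>UNIV. qc d * R a b c d * \<mu> (y * d / (a * b * c)))"
    by (rule sum_negf)
  also have "(\<Sum>\<mu>\<in>mult_chars. \<Sum>a\<in>UNIV. \<Sum>b\<in>UNIV. \<Sum>c\<in>UNIV. \<Sum>d\<in>UNIV. qc d * R a b c d * \<mu> (y * d / (a * b * c))) =
     (\<Sum>a\<in>UNIV. \<Sum>b\<in>UNIV. \<Sum>c\<in>UNIV. \<Sum>d\<in>UNIV. qc d * R a b c d * (\<Sum>\<mu>\<in>mult_chars. \<mu> (y * d / (a * b * c))))"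
    unfolding sum_distrib_left
    by (subst sum.swap, rule sum.cong[OF refl], subst sum.swap, rule sum.cong[OF refl],
          subst sum.swap, rule sum.cong[OF refl], subst sum.swap, rule refl)
  also have "\<dots> = (\<Sum>a\<in>UNIV. \<Sum>b\<in>UNIV. \<Sum>c\<in>UNIV. (of_nat CARD('f) - 1) *
       (of_nat CARD('f) * (if a + b + c + a * b * c / y + 1 = 0 then qc (a * b * c) else 0) - qc (a * b * c)))"
  proof (intro sum.cong refl)
    fix a b c :: 'f
    have iff: "y * d / (a * b * c) = 1 \<longleftrightarrow> a * b * c \<noteq> 0 \<and> d = a * b * c / y" for d
      using y by (auto simp: field_simps)
    have "(\<Sum>d\<in>UNIV. qc d * R a b c d * (\<Sum>\<mu>\<in>mult_chars. \<mu> (y * d / (a * b * c)))) =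
      (\<Sum>d\<in>UNIV. if d = a * b * c / y then (if a * b * c = 0 then 0 else qc d * R a b c d * (of_nat CARD('f) - 1)) else 0)"
      unfolding orthogonality iff by (intro sum.cong refl) auto
    also have "\<dots> = (if a * b * c = 0 then 0 else qc (a * b * c / y) * R a b c (a * b * c / y) * (of_nat CARD('f) - 1))"
      by (simp only: sum.delta finite UNIV_I if_True)
    also have "\<dots> = (of_nat CARD('f) - 1) * (qc (a * b * c) * R a b c (a * b * c / y))"
      using y by (simp add: qc_divide)
    also have "qc (a * b * c) * R a b c (a * b * c / y) =
       of_nat CARD('f) * (if a + b + c + a * b * c / y + 1 = 0 then qc (a * b * c) else 0) - qc (a * b * c)"
      by (simp add: R_def right_diff_distrib)
    finally show "(\<Sum>d\<in>UNIV. qc d * R a b c d * (\<Sum>\<mu>\<in>mult_chars. \<mu> (y * d / (a * b * c)))) =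
      (of_nat CARD('f) - 1) *
       (of_nat CARD('f) * (if a + b + c + a * b * c / y + 1 = 0 then qc (a * b * c) else 0) - qc (a * b * c))" .
  qed
  also have "\<dots> = (of_nat CARD('f) - 1) * (of_nat CARD('f) *
      (\<Sum>a\<in>UNIV. \<Sum>b\<in>UNIV. \<Sum>c\<in>UNIV. if a + b + c + a * b * c / y + 1 = 0 then qc (a * b * c) else 0) -
      (\<Sum>a\<in>UNIV. \<Sum>b\<in>UNIV. \<Sum>c\<in>UNIV. qc (a * b * c)))"
    by (simp only: sum_distrib_left[symmetric] sum_subtractf)
  also have "(\<Sum>a\<in>UNIV. \<Sum>b\<in>UNIV. \<Sum>c\<in>UNIV. qc (a * b * c)) = 0"
    by (simp add: qc_mult sum_qc flip: sum_distrib_left)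
  finally show ?thesis by (simp only: diff_0_right mult.assoc mult_minus_left)
qed

lemma B_inv: "\<mu> \<in> mult_chars \<Longrightarrow> j \<le> 4 \<Longrightarrow> char_inv (char_mult (B j) \<mu>) = char_mult (B (4 - j)) (char_inv \<mu>)"
proof
  fix x assume \<mu>: "\<mu> \<in> mult_chars" and j: "j \<le> 4"
  show "char_inv (char_mult (B j) \<mu>) x = char_mult (B (4 - j)) (char_inv \<mu>) x"
  proof (cases "x = 0")
    case False
    have "A (inverse x) * A x = 1" using mult_charsD(3)[OF A, of "inverse x" x] mult_charsD(2)[OF A] False by simp
    hence "A (inverse x) ^ j = A (inverse x) ^ j * (A x ^ j * A x ^ (4 - j))"
      using A_4[OF False] j by (simp flip: power_add)
    also have "\<dots> = (A (inverse x) * A x) ^ j * A x ^ (4 - j)" by (simp add: power_mult_distrib)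
    finally show ?thesis using \<open>A (inverse x) * A x = 1\<close> False by (simp add: char_inv_def char_mult_def char_pow_def)
  qed (simp add: char_inv_def char_mult_def char_pow_def mult_charsD[OF \<mu>])
qed

text \<open>
  The reflection formula moves the Gauss sums in the denominators to the numerators, and
  duplication replaces \<open>g (A * \<mu>) * g (A\<^sup>3 * \<mu>)\<close> by one Gauss sum of \<open>qc * \<mu> * \<mu>\<close>; the sum over
  \<open>\<mu>\<close> is then a point count. The constants collapse to a power of \<open>Q\<close>, since
  \<open>g A * g A\<^sup>3 = A (-1) * Q\<close>, \<open>g qc * g qc = Q\<close> and \<open>A (-1) * A (1 / 4) = 1\<close>.
\<close>

theorem hyp_F_eq_k3_sum:
  assumes m: "m \<in> {1, 2, 3}" and w: "w \<noteq> 0"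
  shows "hyp_F_red \<psi> {#B m, B m, B m, B m#} {#triv_char, A, B 2, B 3#} (w ^ 4) =
     of_nat CARD('f) * k3_sum (1 / w ^ 4) / g (B m) ^ 4"
proof -
  define Q :: complex where "Q = of_nat CARD('f)"
  have Q: "Q \<noteq> 0" "Q - 1 \<noteq> 0" using q_minus_1_ne by (simp_all add: Q_def)
  \<comment> \<open>The \<open>4\<close> comes from the factor \<open>\<mu> (1 / 4)\<close> in the duplication formula and the sign from the
     reflection formula.\<close>
  define y where "y = - 1 / (4 * w ^ 4)"
  have y: "y \<noteq> 0" using w by (simp add: y_def)
  have "y * ((2 * w ^ 2) ^ 2) = -1" using w by (simp add: y_def power_mult_distrib flip: power_mult)
  hence "qc y * qc ((2 * w ^ 2) ^ 2) = 1" by (metis qc_mult qc_minus_1)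
  moreover have "qc ((2 * w ^ 2) ^ 2) = 1" by (rule qc_sq) (use w in simp)
  ultimately have qy: "qc y = 1" by (simp only: mult_1_right)
  have T: "g \<mu> ^ 3 / (gc (char_mult (B 1) \<mu>) * gc (char_mult (B 2) \<mu>) * gc (char_mult (B 3) \<mu>)) * \<mu> (w ^ 4) =
     g (char_inv (char_inv \<mu>)) ^ 3 * g (char_mult (B 1) (char_inv \<mu>)) * g (char_mult (B 2) (char_inv \<mu>)) *
       g (char_mult (B 3) (char_inv \<mu>)) * char_inv \<mu> (- 1 / w ^ 4) / Q ^ 3"
    if \<mu>: "\<mu> \<in> mult_chars" for \<mu>
  proof -
    have inv: "1 / gc (char_mult (B j) \<mu>) = char_mult (B j) \<mu> (-1) * g (char_mult (B (4 - j)) (char_inv \<mu>)) / Q"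
      if "j \<le> 4" for j
      using inverse_gc[OF char_mult_in[OF B_in \<mu>], of j] B_inv[OF \<mu> that] by (simp add: Q_def)
    have "1 / (gc (char_mult (B 1) \<mu>) * gc (char_mult (B 2) \<mu>) * gc (char_mult (B 3) \<mu>)) =
       (1 / gc (char_mult (B 1) \<mu>)) * (1 / gc (char_mult (B 2) \<mu>)) * (1 / gc (char_mult (B 3) \<mu>))" by simp
    also have "\<dots> = (char_mult (B 1) \<mu> (-1) * char_mult (B 2) \<mu> (-1) * char_mult (B 3) \<mu> (-1)) *
       (g (char_mult (B 1) (char_inv \<mu>)) * g (char_mult (B 2) (char_inv \<mu>)) * g (char_mult (B 3) (char_inv \<mu>))) / Q ^ 3"
      by (simp add: inv power3_eq_cube)
    also have "char_mult (B 1) \<mu> (-1) * char_mult (B 2) \<mu> (-1) * char_mult (B 3) \<mu> (-1) = \<mu> (-1)"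
    proof -
      have "A (-1) * A (-1) = 1" "\<mu> (-1) * \<mu> (-1) = 1" by (rule minus_1_sq[OF A], rule minus_1_sq[OF \<mu>])
      hence "(A (-1) * A (-1)) ^ 3 * (\<mu> (-1) * \<mu> (-1)) * \<mu> (-1) = \<mu> (-1)" by simp
      thus ?thesis by (simp add: char_mult_def char_pow_def power3_eq_cube power2_eq_square mult_ac)
    qed
    finally have e: "1 / (gc (char_mult (B 1) \<mu>) * gc (char_mult (B 2) \<mu>) * gc (char_mult (B 3) \<mu>)) = \<mu> (-1) *
       (g (char_mult (B 1) (char_inv \<mu>)) * g (char_mult (B 2) (char_inv \<mu>)) * g (char_mult (B 3) (char_inv \<mu>))) / Q ^ 3" .
    have "inverse (- 1 / w ^ 4) = (-1) * w ^ 4" by (simp add: field_simps)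
    hence v: "char_inv \<mu> (- 1 / w ^ 4) = \<mu> (-1) * \<mu> (w ^ 4)"
      by (simp only: char_inv_def mult_charsD(3)[OF \<mu>])
    show ?thesis unfolding v char_inv_inv
      using e by (simp add: divide_inverse mult_ac)
  qed
  have D: "g (char_inv \<mu>) ^ 3 * g (char_mult (B 1) \<mu>) * g (char_mult (B 2) \<mu>) * g (char_mult (B 3) \<mu>) * \<mu> (- 1 / w ^ 4) / Q ^ 3
     = g qc * A (1 / 4) / Q ^ 3 *
       (g (char_inv \<mu>) ^ 3 * g (char_mult qc \<mu>) * g (char_mult qc (char_mult \<mu> \<mu>)) * \<mu> y)"
    if \<mu>: "\<mu> \<in> mult_chars" for \<mu>
  proof -
    define \<eta> where "\<eta> = char_mult (B 1) \<mu>"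
    have \<eta>: "\<eta> \<in> mult_chars" unfolding \<eta>_def by (rule char_mult_in[OF B_in \<mu>])
    have e1: "char_mult (B 3) \<mu> = char_mult \<eta> qc"
      by (auto simp: \<eta>_def char_mult_def char_pow_def fun_eq_iff power3_eq_cube power2_eq_square simp flip: A_sq)
    have e2: "char_mult \<eta> \<eta> = char_mult qc (char_mult \<mu> \<mu>)"
      by (auto simp: \<eta>_def char_mult_def char_pow_def fun_eq_iff power2_eq_square mult_charsD[OF \<mu>] simp flip: A_sq)
    have e3: "\<eta> (1 / 4) = A (1 / 4) * \<mu> (1 / 4)" by (simp add: \<eta>_def char_mult_def char_pow_def)
    have "y = (1 / 4) * (- 1 / w ^ 4)" by (simp add: y_def)
    hence yv: "\<mu> y = \<mu> (1 / 4) * \<mu> (- 1 / w ^ 4)" by (simp only: mult_charsD(3)[OF \<mu>])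
    have "g \<eta> * g (char_mult \<eta> qc) = g (char_mult qc (char_mult \<mu> \<mu>)) * g qc * (A (1 / 4) * \<mu> (1 / 4))"
      using gauss_duplication[OF \<eta>] by (simp only: e2 e3)
    thus ?thesis unfolding e1 B_2 yv \<eta>_def[symmetric] by (simp add: mult_ac)
  qed
  have sum: "(\<Sum>\<mu>\<in>mult_chars. g \<mu> ^ 3 / (gc (char_mult (B 1) \<mu>) * gc (char_mult (B 2) \<mu>) * gc (char_mult (B 3) \<mu>)) * \<mu> (w ^ 4))
     = g qc * A (1 / 4) / Q ^ 3 * (- (Q - 1) * Q * k3_sum (1 / w ^ 4))"
  proof -
    have cond: "a + b + c + a * b * c / y + 1 = 0 \<longleftrightarrow> a + b + c + 1 = 4 * (w ^ 2) ^ 2 * (a * b * c)" for a b c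
    proof -
      have "a * b * c / y = - (4 * (w ^ 2) ^ 2 * (a * b * c))"
        using w by (simp add: y_def flip: power_mult)
      hence "a + b + c + a * b * c / y + 1 = a + b + c + 1 - 4 * (w ^ 2) ^ 2 * (a * b * c)" by simp
      thus ?thesis by (metis eq_iff_diff_eq_0)
    qed
    define G where "G = (\<lambda>\<mu>. g (char_inv \<mu>) ^ 3 * g (char_mult (B 1) \<mu>) * g (char_mult (B 2) \<mu>) *
       g (char_mult (B 3) \<mu>) * \<mu> (- 1 / w ^ 4) / Q ^ 3)"
    have "(\<Sum>\<mu>\<in>mult_chars. g \<mu> ^ 3 / (gc (char_mult (B 1) \<mu>) * gc (char_mult (B 2) \<mu>) * gc (char_mult (B 3) \<mu>)) * \<mu> (w ^ 4))
      = (\<Sum>\<mu>\<in>mult_chars. G (char_inv \<mu>))"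
      unfolding G_def by (intro sum.cong refl T)
    also have "\<dots> = (\<Sum>\<mu>\<in>mult_chars. G \<mu>)" by (rule sum_mult_chars_inv)
    also have "\<dots> = g qc * A (1 / 4) / Q ^ 3 *
       (\<Sum>\<mu>\<in>mult_chars. g (char_inv \<mu>) ^ 3 * g (char_mult qc \<mu>) * g (char_mult qc (char_mult \<mu> \<mu>)) * \<mu> y)"
      unfolding sum_distrib_left G_def by (rule sum.cong[OF refl D])
    also have "(\<Sum>\<mu>\<in>mult_chars. g (char_inv \<mu>) ^ 3 * g (char_mult qc \<mu>) * g (char_mult qc (char_mult \<mu> \<mu>)) * \<mu> y) =
       - (Q - 1) * Q * k3_sum (1 / (w ^ 2) ^ 2)"
      unfolding gauss_product_sum[OF y qy] cond Q_def by (subst k3_sum_as_count) (use w in auto)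
    finally show ?thesis by (simp flip: power_mult)
  qed
  have inv1: "char_inv A = B 3"
  proof -
    have "char_inv (char_mult (B 1) (B 0)) = char_mult (B 3) (char_inv (B 0))"
      using B_inv[OF B_in, of 1 0] by simp
    moreover have "char_inv (B 0) = B 0" by (auto simp: char_inv_def char_pow_def fun_eq_iff)
    ultimately show ?thesis using B_mult[of 1 0] B_mult[of 3 0] by (simp add: B_1[simplified])
  qed
  have "A \<noteq> triv_char" using B_distinct(1) by (metis B_0 B_1)
  hence gA: "g (B 1) * g (B 3) = A (-1) * Q" using g_inv[OF A] by (simp add: inv1 Q_def B_1[simplified])
  have "g (B 1) * g (B 2) * g (B 3) * (g qc * A (1 / 4)) = (g (B 1) * g (B 3)) * (g qc * g qc) * A (1 / 4)"
    by (simp add: B_2)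
  also have "\<dots> = (A (-1) * A (1 / 4)) * Q ^ 2" by (simp only: gA g_qc_sq) (simp add: Q_def power2_eq_square)
  finally have const: "g (B 1) * g (B 2) * g (B 3) * (g qc * A (1 / 4)) = Q ^ 2" by (simp add: A_minus_4)
  have "hyp_F_red \<psi> {#B m, B m, B m, B m#} {#triv_char, A, B 2, B 3#} (w ^ 4) =
     1 / (1 - Q) * (Q * g (B 1) * g (B 2) * g (B 3) / g (B m) ^ 4) *
       (g qc * A (1 / 4) / Q ^ 3 * (- (Q - 1) * Q * k3_sum (1 / w ^ 4)))"
    using hyp_F_shifted[OF m w] unfolding sum by (simp only: B_0 B_1 Q_def)
  also have "\<dots> = (- (Q - 1) / (1 - Q)) * (g (B 1) * g (B 2) * g (B 3) * (g qc * A (1 / 4))) * (Q * Q / Q ^ 3) * k3_sum (1 / w ^ 4) / g (B m) ^ 4"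
    by (simp add: mult_ac)
  also have "\<dots> = Q * k3_sum (1 / w ^ 4) / g (B m) ^ 4"
    unfolding const using Q by (simp add: power2_eq_square power3_eq_cube)
  finally show ?thesis by (simp add: Q_def)
qed

lemma g_qc_4: "g (B 2) ^ 4 = of_nat CARD('f) ^ 2"
  using g_qc_sq by (simp add: B_2 power4_eq_xxxx power2_eq_square)

lemma g_odd_4:
  assumes m: "m \<in> {1, 3}"
  shows "g (B m) ^ 4 = of_nat CARD('f) * jac (B m) (B m) ^ 2"
proof -
  have sq: "char_mult (B m) (B m) = qc"
    using m B_add_4[of 2] by (auto simp: B_mult B_2[symmetric] numeral_2_eq_2)
  have "g (B m) * g (B m) = - jac (B m) (B m) * g qc"
    using g_mult_jac[OF B_in B_in, of m m] qc_nontrivial by (simp add: sq)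
  hence "(g (B m) * g (B m)) ^ 2 = jac (B m) (B m) ^ 2 * (g qc * g qc)"
    by (simp add: power2_eq_square)
  thus ?thesis by (simp only: g_qc_sq) (simp add: power4_eq_xxxx power2_eq_square mult_ac)
qed

end

section \<open>The fourfold Jacobi sum\<close>

context field_one_mod_four
begin

text \<open>
  The four variables are grouped in two pairs with sums \<open>s\<close> and \<open>1 - s\<close>.
\<close>

lemma jacobi_sum_convolution:
  fixes \<chi> :: "'f \<Rightarrow> complex"
  assumes \<chi>: "\<chi> \<in> mult_chars"
  shows "jacobi_sum [\<chi>, \<chi>, \<chi>, \<chi>] =
    - (\<Sum>s\<in>UNIV. (\<Sum>x\<in>UNIV. \<chi> x * \<chi> (s - x)) * (\<Sum>x\<in>UNIV. \<chi> x * \<chi> (1 - s - x)))"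
proof -
  define L :: "'f list set" where "L = {xs. length xs = 4 \<and> 0 \<notin> set xs \<and> sum_list xs = 1}"
  define w where "w = (\<lambda>(a, b, c). \<chi> a * \<chi> b * \<chi> c * \<chi> (1 - a - b - c))"
  have "jacobi_sum [\<chi>, \<chi>, \<chi>, \<chi>] = - (\<Sum>xs\<in>L. \<Prod>i<4. \<chi> (xs ! i))"
  proof -
    have "(\<Prod>i<4. ([\<chi>, \<chi>, \<chi>, \<chi>] ! i) (xs ! i)) = (\<Prod>i<4. \<chi> (xs ! i))" for xs
      by (intro prod.cong refl) (auto simp: nth_Cons numeral_eq_Suc less_Suc_eq split: nat.splits)
    thus ?thesis by (simp add: jacobi_sum_def L_def numeral_eq_Suc)
  qed
  also have "(\<Sum>xs\<in>L. \<Prod>i<4. \<chi> (xs ! i)) =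
      (\<Sum>p\<in>{(a, b, c). a \<noteq> 0 \<and> b \<noteq> 0 \<and> c \<noteq> 0 \<and> 1 - a - b - c \<noteq> 0}. w p)"
  proof (rule sum.reindex_bij_witness[of _ "\<lambda>(a, b, c). [a, b, c, 1 - a - b - c]" "\<lambda>xs. (xs ! 0, xs ! 1, xs ! 2)"])
    fix xs assume xs: "xs \<in> L"
    then obtain a b c d where e: "xs = [a, b, c, d]"
      by (auto simp: L_def length_Suc_conv numeral_eq_Suc)
    have d: "d = 1 - a - b - c" using xs unfolding e L_def by (auto simp: algebra_simps)
    show "(case (xs ! 0, xs ! 1, xs ! 2) of (a, b, c) \<Rightarrow> [a, b, c, 1 - a - b - c]) = xs"
      by (simp add: e d)
    show "(xs ! 0, xs ! 1, xs ! 2) \<in> {(a, b, c). a \<noteq> 0 \<and> b \<noteq> 0 \<and> c \<noteq> 0 \<and> 1 - a - b - c \<noteq> 0}"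
      using xs by (simp add: e L_def d)
    show "w (xs ! 0, xs ! 1, xs ! 2) = (\<Prod>i<4. \<chi> (xs ! i))"
      by (simp add: e d w_def numeral_eq_Suc lessThan_Suc mult_ac)
  qed (auto simp: L_def)
  also have "\<dots> = (\<Sum>p\<in>UNIV. w p)"
    by (rule sum.mono_neutral_left) (auto simp: w_def mult_charsD[OF \<chi>])
  also have "\<dots> = (\<Sum>a\<in>UNIV. \<Sum>b\<in>UNIV. \<Sum>c\<in>UNIV. w (a, b, c))"
    by (simp add: sum.cartesian_product case_prod_beta)
  also have "\<dots> = (\<Sum>a\<in>UNIV. \<Sum>s\<in>UNIV. \<Sum>c\<in>UNIV. \<chi> a * \<chi> (s - a) * (\<chi> c * \<chi> (1 - s - c)))"
  proof (rule sum.cong[OF refl])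
    fix a
    show "(\<Sum>b\<in>UNIV. \<Sum>c\<in>UNIV. w (a, b, c)) = (\<Sum>s\<in>UNIV. \<Sum>c\<in>UNIV. \<chi> a * \<chi> (s - a) * (\<chi> c * \<chi> (1 - s - c)))"
      using sum_shift[of "\<lambda>s. \<Sum>c\<in>UNIV. \<chi> a * \<chi> (s - a) * (\<chi> c * \<chi> (1 - s - c))" a]
      by (simp add: w_def algebra_simps)
  qed
  also have "\<dots> = (\<Sum>s\<in>UNIV. \<Sum>a\<in>UNIV. \<Sum>c\<in>UNIV. \<chi> a * \<chi> (s - a) * (\<chi> c * \<chi> (1 - s - c)))"
    by (rule sum.swap)
  finally show ?thesis by (simp add: sum_product)
qed

text \<open>
  Each of the two convolutions is \<open>jac \<chi> \<chi>\<close> times the quadratic character, and the Jacobi sum of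
  the quadratic character with itself is \<open>-1\<close>.
\<close>

lemma jacobi_sum_square_root:
  fixes \<chi> :: "'f \<Rightarrow> complex"
  assumes \<chi>: "\<chi> \<in> mult_chars" and sq: "char_mult \<chi> \<chi> = qc"
  shows "jacobi_sum [\<chi>, \<chi>, \<chi>, \<chi>] = jac \<chi> \<chi> ^ 2"
proof -
  have conv: "(\<Sum>x\<in>UNIV. \<chi> x * \<chi> (s - x)) = qc s * jac \<chi> \<chi>" for s
  proof (cases "s = 0")
    case True
    have "\<chi> x * \<chi> (0 - x) = \<chi> (-1) * qc x" for x
      using mult_charsD(3)[OF \<chi>, of "-1" x] fun_cong[OF sq, of x] by (simp add: char_mult_def)
    thus ?thesis using True sum_qc by (simp flip: sum_distrib_left)
  next
    case False
    thus ?thesis using convolution_scale[OF \<chi> \<chi>] fun_cong[OF sq, of s] by (simp add: char_mult_def)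
  qed
  have "(\<Sum>s\<in>UNIV. qc s * qc (1 - s)) = (\<Sum>s\<in>UNIV. qc ((-1) * s ^ 2 + 1 * s + 0))"
    unfolding qc_mult[symmetric] by (intro sum.cong refl arg_cong[where f = qc]) (simp add: algebra_simps power2_eq_square)
  also have "\<dots> = -1" by (subst sum_quad_char_quadratic) auto
  finally have one: "(\<Sum>s\<in>UNIV. qc s * qc (1 - s)) = -1" .
  have "jacobi_sum [\<chi>, \<chi>, \<chi>, \<chi>] = - (\<Sum>s\<in>UNIV. jac \<chi> \<chi> ^ 2 * (qc s * qc (1 - s)))"
    unfolding jacobi_sum_convolution[OF \<chi>] conv by (simp add: power2_eq_square mult_ac)
  also have "\<dots> = jac \<chi> \<chi> ^ 2" unfolding sum_distrib_left[symmetric] one by simp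
  finally show ?thesis .
qed

lemma jacobi_sum_quad_char: "jacobi_sum [qc, qc, qc, qc] = of_nat CARD('f)"
proof -
  have conv: "(\<Sum>x\<in>UNIV. qc x * qc (s - x)) = (if s = 0 then of_nat CARD('f) else 0) - 1" for s
  proof -
    have "(\<Sum>x\<in>UNIV. qc x * qc (s - x)) = (\<Sum>x\<in>UNIV. qc ((-1) * x ^ 2 + s * x + 0))"
      unfolding qc_mult[symmetric] by (intro sum.cong refl arg_cong[where f = qc]) (simp add: algebra_simps power2_eq_square)
    also have "\<dots> = (if s = 0 then of_nat CARD('f) else 0) - 1"
    proof (cases "s = 0")
      case True
      thus ?thesis by (subst sum_quad_char_quadratic_0) auto
    next
      case False
      thus ?thesis by (subst sum_quad_char_quadratic) auto
    qed
    finally show ?thesis .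
  qed
  have "(\<Sum>s\<in>UNIV. ((if s = 0 then of_nat CARD('f) else 0) - 1) * ((if 1 - s = (0::'f) then of_nat CARD('f) else 0) - 1)) =
     (\<Sum>s\<in>UNIV. 1 - (if s = (0::'f) then of_nat CARD('f) else 0) - (if s = 1 then of_nat CARD('f) else 0) :: complex)"
    by (intro sum.cong refl) auto
  also have "\<dots> = - of_nat CARD('f)" by (simp add: sum_subtractf)
  finally show ?thesis unfolding jacobi_sum_convolution[OF qc_in] conv by simp
qed

end

section \<open>Embeddings of finite fields into an algebraically closed field\<close>

lemma field_embeddingD:
  assumes "field_embedding e"
  shows "e 1 = 1" "e 0 = 0" "e (x + y) = e x + e y" "e (x * y) = e x * e y"
    "e (- x) = - e x" "e (x - y) = e x - e y" "e x = e y \<longleftrightarrow> x = y" "e (x ^ n) = e x ^ n"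
    "e (inverse x) = inverse (e x)" "e (x / y) = e x / e y" "e (numeral k) = numeral k" "e (of_nat n) = of_nat n"
proof -
  have a: "e (x + y) = e x + e y" and m: "e (x * y) = e x * e y" and one: "e 1 = 1" for x y
    using assms by (auto simp: field_embedding_def)
  show "e 1 = 1" "e (x + y) = e x + e y" "e (x * y) = e x * e y" by (rule one a m)+
  show z: "e 0 = 0" by (metis a add.right_neutral add_left_cancel)
  have u: "e (- x) = - e x" for x using a[of x "- x"] z by (simp add: add_eq_0_iff)
  show "e (- x) = - e x" by (rule u)
  have d: "e (x - y) = e x - e y" for x y using a[of x "- y"] u[of y] by simp
  show "e (x - y) = e x - e y" by (rule d)
  have nz: "e x \<noteq> 0" if "x \<noteq> 0" for x using m[of x "inverse x"] one that by auto
  show "e x = e y \<longleftrightarrow> x = y" using nz[of "x - y"] d[of x y] by auto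
  show "e (x ^ n) = e x ^ n" by (induction n) (simp_all add: one m)
  have i: "e (inverse x) = inverse (e x)" for x
  proof (cases "x = 0")
    case False
    hence "e x * e (inverse x) = 1" using m[of x "inverse x"] one by simp
    thus ?thesis by (metis inverse_unique)
  qed (simp add: z)
  show "e (inverse x) = inverse (e x)" by (rule i)
  show "e (x / y) = e x / e y" by (simp add: divide_inverse m i)
  have n: "e (of_nat n) = of_nat n" for n by (induction n) (simp_all add: z one a)
  show "e (of_nat n) = of_nat n" by (rule n)
  show "e (numeral k) = numeral k" using n[of "numeral k"] by simp
qed

lemma embedding_range_subfield:
  fixes e :: "'f::{finite,field} \<Rightarrow> 'a::field"
  assumes e: "field_embedding e"
  shows "finite_subfield (range e) CARD('f)"
proof
  have "inj e" by (rule injI) (simp add: field_embeddingD[OF e])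
  thus "card (range e) = CARD('f)" by (rule card_image)
  show "finite (range e)" by simp
  show "0 \<in> range e" "1 \<in> range e"
    by (rule range_eqI[of _ _ 0], simp add: field_embeddingD[OF e],
        rule range_eqI[of _ _ 1], simp add: field_embeddingD[OF e])
  fix x assume "x \<in> range e"
  then obtain a where a: "x = e a" by auto
  show "- x \<in> range e" unfolding a by (rule range_eqI[of _ _ "- a"]) (simp add: field_embeddingD[OF e])
  show "inverse x \<in> range e" unfolding a by (rule range_eqI[of _ _ "inverse a"]) (simp add: field_embeddingD[OF e])
  fix y assume "y \<in> range e"
  then obtain b where b: "y = e b" by auto
  show "x + y \<in> range e" unfolding a b by (rule range_eqI[of _ _ "a + b"]) (simp add: field_embeddingD[OF e])
  show "x * y \<in> range e" unfolding a b by (rule range_eqI[of _ _ "a * b"]) (simp add: field_embeddingD[OF e])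
qed

text \<open>
  The polynomial \<open>(X + 1)\<^sup>q - X\<^sup>q - 1\<close> has degree less than \<open>q\<close> and vanishes on a subfield with
  \<open>q\<close> elements, so it is zero. Hence the inner binomial coefficients vanish in the field.
\<close>

lemma embedding_frobenius_additive:
  fixes e :: "'f::{finite,field} \<Rightarrow> 'a::field" and x y :: 'a
  assumes e: "field_embedding e"
  shows "(x + y) ^ CARD('f) = x ^ CARD('f) + y ^ CARD('f)"
proof -
  define q where "q = CARD('f)"
  interpret R: finite_subfield "range e" q unfolding q_def by (rule embedding_range_subfield[OF e])
  have q2: "q \<ge> 2" by (rule R.Q_ge_2)
  define I where "I = {1..<q}"
  have split: "{..q} = insert 0 (insert q I)" "0 \<notin> insert q I" "q \<notin> I" "finite I"
    using q2 by (auto simp: I_def)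
  have binom: "(x + y) ^ q = x ^ q + y ^ q + (\<Sum>i\<in>I. of_nat (q choose i) * x ^ i * y ^ (q - i))" for x y :: 'a
    unfolding binomial_ring split(1) using split(2-4) by (simp add: algebra_simps)
  define P where "P = (\<Sum>i\<in>I. monom (of_nat (q choose i) :: 'a) i)"
  have Px: "poly P x = (x + 1) ^ q - x ^ q - 1" for x
    using binom[of x 1] by (simp add: P_def poly_sum poly_monom)
  have "poly P z = 0" if "z \<in> range e" for z
    using that R.power_card[of z] R.power_card[of "z + 1"] R.add_in[OF that R.one_in] by (simp add: Px)
  hence sub: "range e \<subseteq> {z. poly P z = 0}" by auto
  have "P = 0"
  proof (rule ccontr)
    assume P: "P \<noteq> 0"
    have "degree P < q" unfolding P_def
    proof (rule degree_sum_less)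
      fix i assume "i \<in> I"
      thus "degree (monom (of_nat (q choose i) :: 'a) i) < q"
        using degree_monom_le[of "of_nat (q choose i) :: 'a" i] by (simp add: I_def)
    qed (use q2 in simp)
    moreover have "q \<le> card {z. poly P z = 0}"
      using card_mono[OF poly_roots_finite[OF P] sub] R.card_F by simp
    ultimately show False using card_poly_roots_bound[OF P] by simp
  qed
  have "of_nat (q choose i) = (0::'a)" if "i \<in> I" for i
  proof -
    have "coeff P i = of_nat (q choose i)" using that split(4) by (simp add: P_def coeff_sum)
    thus ?thesis using \<open>P = 0\<close> by simp
  qed
  thus ?thesis using binom[of x y] by (simp add: q_def[symmetric])
qed

lemma quad_char_embedding:
  assumes "field_embedding e"
  shows "quad_char Q (e x) = quad_char Q x"
proof -
  have "e x = 0 \<longleftrightarrow> x = 0" "e y = 1 \<longleftrightarrow> y = 1" for y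
    using field_embeddingD(7)[OF assms, of x 0] field_embeddingD(7)[OF assms, of y 1] field_embeddingD(1,2)[OF assms] by auto
  thus ?thesis by (simp add: quad_char_def flip: field_embeddingD(8)[OF assms])
qed

lemma of_nat_card_eq_0:
  fixes e :: "'f::{finite,field} \<Rightarrow> 'a::field"
  assumes e: "field_embedding e"
  shows "of_nat CARD('f) = (0::'a)"
proof -
  have "(\<Sum>x\<in>UNIV. x :: 'f) = (\<Sum>x\<in>UNIV. x + 1)"
    by (rule sum.reindex_bij_witness[of _ "\<lambda>x. x + 1" "\<lambda>x. x - 1"]) auto
  hence "of_nat CARD('f) = (0::'f)" by (simp add: sum.distrib)
  thus ?thesis using field_embeddingD(12)[OF e, of "CARD('f)"] field_embeddingD(2)[OF e] by simp
qed

text \<open>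
  The derivative of \<open>X ^ (q ^ r) - X\<close> is \<open>-1\<close>, so all its roots are simple.
\<close>

lemma (in frobenius_field) card_fixed_power:
  assumes "of_nat q = (0::'a)" "r > 0"
  shows "card (fixed r) = q ^ r"
proof -
  define p :: "'a poly" where "p = monom 1 (q ^ r) - [:0, 1:]"
  have N: "q ^ r > 1" using q_ge_2 assms(2) by (intro one_less_power) auto
  have deg: "degree p = q ^ r"
  proof (rule antisym)
    show "degree p \<le> q ^ r" unfolding p_def
      by (rule degree_diff_le) (use N in \<open>auto simp: degree_monom_eq\<close>)
    have "coeff p (q ^ r) = 1" using N assms(2) by (auto simp: p_def coeff_pCons split: nat.split)
    thus "q ^ r \<le> degree p" by (intro le_degree) simp
  qed
  have p0: "p \<noteq> 0" using deg N by (metis degree_0 not_less_zero)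
  have roots: "fixed r = {x. poly p x = 0}" by (auto simp: p_def poly_monom fixed_def)
  have "of_nat (q ^ r) = (0::'a)" using assms by (simp add: power_0_left)
  hence deriv: "pderiv p = - 1" unfolding p_def pderiv_diff pderiv_monom
    by (simp add: pderiv_pCons assms(1) zero_power[OF assms(2)] one_pCons)
  have "order x p = 1" if "poly p x = 0" for x
  proof (rule ccontr)
    assume "order x p \<noteq> 1"
    moreover have "order x p \<noteq> 0" using that p0 by (simp add: order_root)
    ultimately have "[:- x, 1:] ^ 2 dvd p" by (simp add: order_divides)
    then obtain k where k: "p = [:- x, 1:] ^ 2 * k" by (elim dvdE)
    have root: "poly [:- x, 1:] x = 0" by simp
    have "poly (pderiv p) x = 0"
      by (simp only: k power2_eq_square pderiv_mult poly_add poly_mult root mult_zero_left mult_zero_right add_0_left)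
    thus False by (simp add: deriv)
  qed
  hence "(\<Sum>x | poly p x = 0. order x p) = card (fixed r)" by (simp add: roots)
  thus ?thesis using sum_order_alg_closed[OF p0] deg by simp
qed

lemma frobenius_field_embedding:
  fixes e :: "'f::{finite,field} \<Rightarrow> 'a::alg_closed_field"
  assumes e: "field_embedding e"
  shows "frobenius_field TYPE('a) CARD('f)"
proof
  show "CARD('f) \<ge> 2" using finite_subfield.Q_ge_2[OF embedding_range_subfield[OF e]] .
qed (rule embedding_frobenius_additive[OF e])

text \<open>
  The square root \<open>s\<close> of \<open>1 - t\<close> is taken in an algebraically closed field, so that a single \<open>s\<close>
  serves for all extensions of a base field. Frobenius decides which case applies. In the second
  one, \<open>(a, b) \<mapsto> e a + e b * s\<close> identifies the quadratic algebra with the field of \<open>Q\<^sup>2\<close>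
  elements, and the norm with the power \<open>Q + 1\<close>.
\<close>

lemma k3_sum_closure:
  fixes e :: "'f::{finite,field} \<Rightarrow> 'a::alg_closed_field"
  assumes q4: "4 dvd CARD('f) - 1" and e: "field_embedding e"
    and t: "t \<noteq> 0" "t \<noteq> 1" and s: "s ^ 2 = 1 - e t"
  shows "s ^ CARD('f) = s \<Longrightarrow> field_one_mod_four.k3_sum t =
           (\<Sum>z | z ^ CARD('f) = z. quad_char CARD('f) (z * (z ^ 2 - 2 * z + (1 - s) / 2))) ^ 2 - of_nat CARD('f)"
    and "s ^ CARD('f) = - s \<Longrightarrow> field_one_mod_four.k3_sum t =
           - quad_char CARD('f) (2::'f) *
             (\<Sum>z | z ^ (CARD('f) ^ 2) = z. quad_char (CARD('f) ^ 2) (z * (z ^ 2 - 2 * z + (1 - s) / 2)))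
             - of_nat CARD('f)"
proof -
  define Q where "Q = CARD('f)"
  interpret field_one_mod_four "TYPE('f)" by unfold_locales (rule q4)
  interpret R: finite_subfield "range e" Q unfolding Q_def by (rule embedding_range_subfield[OF e])
  interpret K: frobenius_field "TYPE('a)" Q unfolding Q_def by (rule frobenius_field_embedding[OF e])
  note ee = field_embeddingD[OF e]
  have two: "(2::'a) \<noteq> 0" using ee(7)[of 2 0] ee(2) ee(11)[of "num.Bit0 num.One"] two_ne by simp
  have s0: "s \<noteq> 0" using s t(2) ee(1) ee(7)[of t 1] by auto
  {
    assume "s ^ CARD('f) = s"
    hence "s \<in> range e" unfolding R.F_eq_fixed by (simp add: Q_def)
    then obtain v where v: "s = e v" by auto
    have "e (v ^ 2) = e (1 - t)" using s unfolding v ee(8) ee(6) ee(1) .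
    hence v2: "v ^ 2 = 1 - t" by (simp only: ee(7))
    have v0: "v \<noteq> 0" using s0 v ee(2) by auto
    have "(\<Sum>z | z ^ CARD('f) = z. quad_char CARD('f) (z * (z ^ 2 - 2 * z + (1 - s) / 2))) =
          (\<Sum>z\<in>range e. quad_char CARD('f) (z * (z ^ 2 - 2 * z + (1 - s) / 2)))"
      unfolding R.F_eq_fixed by (simp add: Q_def)
    also have "\<dots> = (\<Sum>x\<in>UNIV. quad_char CARD('f) (e x * (e x ^ 2 - 2 * e x + (1 - s) / 2)))"
      by (rule sum.reindex[unfolded o_def]) (simp add: inj_def ee)
    also have "\<dots> = cubic_sum ((1 - v) / 2)"
      unfolding cubic_sum_def
    proof (intro sum.cong refl)
      fix x
      have "e x * (e x ^ 2 - 2 * e x + (1 - s) / 2) = e (x * (x ^ 2 - 2 * x + (1 - v) / 2))"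
        unfolding v by (simp only: ee)
      thus "quad_char CARD('f) (e x * (e x ^ 2 - 2 * e x + (1 - s) / 2)) = qc (x * (x ^ 2 - 2 * x + (1 - v) / 2))"
        by (simp only: quad_char_embedding[OF e])
    qed
    finally show "k3_sum t = (\<Sum>z | z ^ CARD('f) = z. quad_char CARD('f) (z * (z ^ 2 - 2 * z + (1 - s) / 2))) ^ 2 - of_nat CARD('f)"
      using k3_sum_split[OF t(1) v2 v0] by simp
  }
  {
    assume "s ^ CARD('f) = - s"
    hence sQ: "s ^ Q = - s" by (simp add: Q_def)
    have sne: "s \<notin> range e"
    proof
      assume "s \<in> range e"
      hence "s = - s" using R.power_card[of s] sQ by simp
      hence "s + s = 0" by (metis add.right_inverse)
      hence "2 * s = 0" by (simp only: mult_2)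
      thus False using two s0 by simp
    qed
    define D where "D = 1 - t"
    have eD: "e D = s ^ 2" by (simp add: D_def ee s)
    have D0: "D \<noteq> 0" "D \<noteq> 1" using t by (auto simp: D_def)
    have nonsq: "qc D = -1"
    proof (rule ccontr)
      assume "qc D \<noteq> -1"
      hence "D ^ ((CARD('f) - 1) div 2) = 1" using D0 by (simp add: quad_char_def split: if_splits)
      then obtain v where "v ^ 2 = D" using residue_iff_square[of D] D0 by auto
      hence "e v ^ 2 = s ^ 2" using eD by (simp flip: ee(8))
      hence "s = e v \<or> s = e (- v)" by (auto simp: power2_eq_iff ee(5))
      thus False using sne by auto
    qed
    \<comment> \<open>\<open>E\<close> identifies the quadratic algebra with the field \<open>G\<close> of \<open>Q\<^sup>2\<close> elements. It turns
       conjugation into Frobenius (\<open>EQ\<close>) and hence the norm into the power \<open>Q + 1\<close> (\<open>EN\<close>).\<close>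
    define E where "E = (\<lambda>p. e (fst p) + e (snd p) * s)"
    define G where "G = {z :: 'a. z ^ (Q ^ 2) = z}"
    have EQ: "E p ^ Q = e (fst p) - e (snd p) * s" for p
    proof -
      have "e x ^ Q = e x" for x by (rule R.power_card) simp
      thus ?thesis unfolding E_def K.frob_add power_mult_distrib sQ by simp
    qed
    have EN: "E p ^ (Q + 1) = e (nrm D (fst p) (snd p))" for p
    proof -
      have "E p ^ (Q + 1) = (e (fst p) - e (snd p) * s) * E p" by (simp add: EQ)
      also have "\<dots> = e (fst p) ^ 2 - s ^ 2 * e (snd p) ^ 2" by (simp add: E_def algebra_simps power2_eq_square)
      also have "\<dots> = e (nrm D (fst p) (snd p))" by (simp add: nrm_def ee eD)
      finally show ?thesis .
    qed
    have inj: "inj E"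
    proof (rule injI)
      fix x y assume "E x = E y"
      hence *: "e (fst x - fst y) = e (snd y - snd x) * s" by (simp add: E_def ee algebra_simps)
      have "snd x = snd y"
      proof (rule ccontr)
        assume "snd x \<noteq> snd y"
        hence "e (snd y - snd x) \<noteq> 0" using ee(7)[of "snd y - snd x" 0] ee(2) by simp
        hence "s = e ((fst x - fst y) / (snd y - snd x))" using * by (simp add: ee(10))
        thus False using sne by blast
      qed
      moreover from this * have "fst x = fst y" using ee(7)[of "fst x - fst y" 0] ee(2) by simp
      ultimately show "x = y" by (simp add: prod_eq_iff)
    qed
    have img: "range E = G"
    proof (rule card_subset_eq)
      have *: "G = K.fixed 2" by (simp add: G_def K.fixed_def)
      show "finite G" unfolding * by (rule K.finite_fixed) simp
      show "range E \<subseteq> G"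
      proof
        fix z assume "z \<in> range E"
        then obtain p where z: "z = E p" by auto
        have "E p ^ (Q ^ 2) = (E p ^ Q) ^ Q" by (simp add: power2_eq_square flip: power_mult)
        also have "\<dots> = E (fst p, - snd p) ^ Q" unfolding EQ[of p] by (simp add: E_def ee)
        also have "\<dots> = E p" unfolding EQ by (simp add: E_def ee)
        finally show "z \<in> G" by (simp add: G_def z)
      qed
      have "card G = Q ^ 2"
        unfolding * by (rule K.card_fixed_power) (use of_nat_card_eq_0[OF e] in \<open>simp_all add: Q_def\<close>)
      also have "Q ^ 2 = card (range E)" using inj by (simp add: card_image Q_def power2_eq_square)
      finally show "card (range E) = card G" ..
    qed
    have qE: "quad_char (Q ^ 2) (E p) = qc (nrm D (fst p) (snd p))" for p
    proof -
      obtain k where k: "Q = Suc (2 * k)" using odd_Q by (metis oddE Suc_eq_plus1 Q_def)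
      have "Q ^ 2 - 1 = 2 * ((Q + 1) * k)" by (simp add: k power2_eq_square)
      hence half: "(Q ^ 2 - 1) div 2 = (Q + 1) * ((Q - 1) div 2)" by (simp add: k)
      have "quad_char (Q ^ 2) (E p) = quad_char Q (E p ^ (Q + 1))"
        unfolding quad_char_def half power_mult by simp
      thus ?thesis by (simp only: EN quad_char_embedding[OF e]) (simp only: Q_def)
    qed
    have "(\<Sum>z\<in>G. quad_char (Q ^ 2) (z * (z ^ 2 - 2 * z + (1 - s) / 2))) =
       (\<Sum>p\<in>UNIV. quad_char (Q ^ 2) (E p * (E p ^ 2 - 2 * E p + (1 - s) / 2)))"
      unfolding img[symmetric] by (rule sum.reindex[unfolded o_def, OF inj])
    also have "\<dots> = (\<Sum>p\<in>UNIV. qc (nrm D (fst p) (snd p)) * qc (nrm D (quad_re D (fst p) (snd p) 1 1) (quad_im (fst p) (snd p) 1 1)))"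
    proof (intro sum.cong refl)
      fix p :: "'f \<times> 'f"
      obtain a b where p: "p = (a, b)" by (cases p)
      define c d where "c = quad_re D a b 1 1 / 2" and "d = quad_im a b 1 1 / 2"
      have cd: "2 * c = quad_re D a b 1 1" "2 * d = quad_im a b 1 1" by (simp_all add: c_def d_def)
      have "2 * E (c, d) = e (2 * c) + e (2 * d) * s"
        using ee(11)[of "num.Bit0 num.One"] by (simp add: E_def ee(4) algebra_simps)
      also have "\<dots> = 2 * (e a + e b * s) ^ 2 - 4 * (e a + e b * s) + (1 - s)"
        unfolding cd quad_re_def quad_im_def by (simp add: ee eD algebra_simps power2_eq_square)
      also have "\<dots> = 2 * (E p ^ 2 - 2 * E p + (1 - s) / 2)"
        using two by (simp add: E_def p distrib_left right_diff_distrib)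
      finally have "2 * E (c, d) = 2 * (E p ^ 2 - 2 * E p + (1 - s) / 2)" .
      hence "E p ^ 2 - 2 * E p + (1 - s) / 2 = E (c, d)"
        unfolding mult_cancel_left using two by (simp only: simp_thms)
      moreover have "E p * E (c, d) = E (a * c + D * b * d, a * d + b * c)"
        by (simp add: E_def p ee eD algebra_simps power2_eq_square)
      moreover have "nrm D (a * c + D * b * d) (a * d + b * c) = nrm D a b * nrm D c d"
        by (simp add: nrm_def algebra_simps power2_eq_square)
      moreover have "nrm D (quad_re D a b 1 1) (quad_im a b 1 1) = 2 ^ 2 * nrm D c d"
        unfolding cd[symmetric] by (rule nrm_scale)
      hence "qc (nrm D (quad_re D a b 1 1) (quad_im a b 1 1)) = qc (nrm D c d)" by (rule qc_eqI) simp
      ultimately show "quad_char (Q ^ 2) (E p * (E p ^ 2 - 2 * E p + (1 - s) / 2)) =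
          qc (nrm D (fst p) (snd p)) * qc (nrm D (quad_re D (fst p) (snd p) 1 1) (quad_im (fst p) (snd p) 1 1))"
        by (simp add: qE p qc_mult)
    qed
    also have "\<dots> = norm_sum D" unfolding norm_sum_def by (rule sum_UNIV_pair[symmetric])
    finally have "(\<Sum>z | z ^ (CARD('f) ^ 2) = z. quad_char (CARD('f) ^ 2) (z * (z ^ 2 - 2 * z + (1 - s) / 2))) = norm_sum (1 - t)"
      by (simp add: G_def D_def Q_def)
    thus "k3_sum t = - quad_char CARD('f) (2::'f) *
             (\<Sum>z | z ^ (CARD('f) ^ 2) = z. quad_char (CARD('f) ^ 2) (z * (z ^ 2 - 2 * z + (1 - s) / 2)))
             - of_nat CARD('f)"
      using k3_sum_nonsplit[OF t] nonsq by (simp add: D_def)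
  }
qed

section \<open>Lifting characters along the norm\<close>

text \<open>
  The product of the conjugates is fixed by Frobenius and therefore has a preimage under \<open>\<iota>\<close>.
\<close>

lemma ext_norm_embedded:
  fixes \<iota> :: "'k::{finite,field} \<Rightarrow> 'l::{finite,field}"
  assumes e: "field_embedding \<iota>" and card: "CARD('l) = CARD('k) ^ r"
  shows "\<iota> (ext_norm \<iota> r x) = (\<Prod>i<r. x ^ (CARD('k) ^ i))"
proof -
  define q where "q = CARD('k)"
  interpret R: finite_subfield "range \<iota>" q unfolding q_def by (rule embedding_range_subfield[OF e])
  interpret L: finite_subfield "UNIV :: 'l set" "CARD('l)" by unfold_locales auto
  define y where "y = (\<Prod>i<r. x ^ (q ^ i))"
  have "y ^ q = y"
  proof (cases r)
    case (Suc n)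
    have "y ^ q = (\<Prod>i<r. x ^ (q ^ Suc i))"
      unfolding y_def prod_power_distrib by (simp only: power_mult[symmetric] power_Suc2)
    also have "\<dots> = (\<Prod>i<n. x ^ (q ^ Suc i)) * x ^ (q ^ r)" unfolding Suc by (simp only: prod.lessThan_Suc)
    also have "x ^ (q ^ r) = x ^ (q ^ 0)" using L.power_card[of x] card by (simp add: q_def)
    also have "(\<Prod>i<n. x ^ (q ^ Suc i)) * x ^ (q ^ 0) = y"
      unfolding y_def Suc prod.lessThan_Suc_shift by (simp only: mult.commute)
    finally show ?thesis .
  qed (simp add: y_def)
  hence "y \<in> range \<iota>" unfolding R.F_eq_fixed by simp
  thus ?thesis unfolding ext_norm_def y_def q_def by (rule f_inv_into_f)
qed

lemma ext_norm_mult: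
  fixes \<iota> :: "'k::{finite,field} \<Rightarrow> 'l::{finite,field}"
  assumes e: "field_embedding \<iota>" and card: "CARD('l) = CARD('k) ^ r"
  shows "ext_norm \<iota> r (x * y) = ext_norm \<iota> r x * ext_norm \<iota> r y"
proof -
  have "\<iota> (ext_norm \<iota> r (x * y)) = \<iota> (ext_norm \<iota> r x * ext_norm \<iota> r y)"
    by (simp add: field_embeddingD(4)[OF e] ext_norm_embedded[OF e card] power_mult_distrib prod.distrib)
  thus ?thesis by (simp only: field_embeddingD(7)[OF e])
qed

lemma ext_norm_1:
  fixes \<iota> :: "'k::{finite,field} \<Rightarrow> 'l::{finite,field}"
  assumes e: "field_embedding \<iota>" and card: "CARD('l) = CARD('k) ^ r"
  shows "ext_norm \<iota> r 1 = 1"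
proof -
  have "\<iota> (ext_norm \<iota> r 1) = \<iota> 1"
    by (simp add: field_embeddingD(1)[OF e] ext_norm_embedded[OF e card])
  thus ?thesis by (simp only: field_embeddingD(7)[OF e])
qed

lemma ext_norm_eq_0_iff:
  fixes \<iota> :: "'k::{finite,field} \<Rightarrow> 'l::{finite,field}"
  assumes e: "field_embedding \<iota>" and card: "CARD('l) = CARD('k) ^ r" and r: "r \<ge> 1"
  shows "ext_norm \<iota> r x = 0 \<longleftrightarrow> x = 0"
proof -
  have "ext_norm \<iota> r x = 0 \<longleftrightarrow> \<iota> (ext_norm \<iota> r x) = 0"
    using field_embeddingD(7)[OF e, of _ 0] field_embeddingD(2)[OF e] by metis
  also have "\<dots> \<longleftrightarrow> x = 0" unfolding ext_norm_embedded[OF e card] using r by (auto intro!: exI[of _ 0])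
  finally show ?thesis .
qed

lemma char_lift_in:
  fixes \<iota> :: "'k::{finite,field} \<Rightarrow> 'l::{finite,field}"
  assumes e: "field_embedding \<iota>" and card: "CARD('l) = CARD('k) ^ r" and r: "r \<ge> 1" and \<eta>: "\<eta> \<in> mult_chars"
  shows "char_lift \<iota> r \<eta> \<in> mult_chars"
proof -
  have "ext_norm \<iota> r 0 = 0" using ext_norm_eq_0_iff[OF e card r] by simp
  thus ?thesis using mult_charsD[OF \<eta>]
    by (simp add: mult_chars_def char_lift_def ext_norm_mult[OF e card] ext_norm_1[OF e card])
qed

lemma char_lift_pow:
  fixes \<iota> :: "'k::{finite,field} \<Rightarrow> 'l::{finite,field}"
  assumes e: "field_embedding \<iota>" and card: "CARD('l) = CARD('k) ^ r" and r: "r \<ge> 1"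
  shows "char_pow (char_lift \<iota> r \<eta>) m = char_lift \<iota> r (char_pow \<eta> m)"
  by (simp add: char_pow_def char_lift_def fun_eq_iff ext_norm_eq_0_iff[OF e card r])

lemma char_lift_triv:
  fixes \<iota> :: "'k::{finite,field} \<Rightarrow> 'l::{finite,field}"
  assumes e: "field_embedding \<iota>" and card: "CARD('l) = CARD('k) ^ r" and r: "r \<ge> 1"
  shows "char_lift \<iota> r triv_char = triv_char"
  by (simp add: triv_char_def char_lift_def fun_eq_iff ext_norm_eq_0_iff[OF e card r])

lemma field_embedding_id: "field_embedding (id :: 'k::field \<Rightarrow> 'k)"
  by (simp add: field_embedding_def)

lemma char_lift_id: "char_lift id 1 \<eta> = (\<eta> :: 'k::{finite,field} \<Rightarrow> complex)"
  by (simp add: char_lift_def ext_norm_def fun_eq_iff)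

text \<open>Every character is a power of the generator, in particular a faithful one is.\<close>

lemma char_generator_faithful:
  fixes \<phi> :: "'k::{finite,field} \<Rightarrow> complex"
  assumes "char_generator \<phi>" "\<phi> x = 1"
  shows "x = 1"
proof -
  obtain \<nu> :: "'k \<Rightarrow> complex" where \<nu>: "\<nu> \<in> mult_chars" "\<And>x. \<nu> x = 1 \<Longrightarrow> x = 1"
    using ex_faithful_char[where 'k = 'k] by blast
  obtain n where n: "\<nu> = char_pow \<phi> n" using assms(1) \<nu>(1) by (auto simp: char_generator_def)
  have "x \<noteq> 0" using assms mult_charsD(1)[of \<phi>] by (auto simp: char_generator_def)
  hence "\<nu> x = 1" using assms(2) by (simp add: n char_pow_def)
  thus ?thesis by (rule \<nu>(2))
qed

text \<open>
  A faithful character sends \<open>-1\<close> to \<open>-1\<close>, so it preserves the two values in Euler's criterion.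
\<close>

lemma generator_power_eq_quad_char:
  fixes \<phi> :: "'k::{finite,field} \<Rightarrow> complex"
  assumes gen: "char_generator \<phi>" and odd: "odd CARD('k)"
  shows "char_pow \<phi> ((CARD('k) - 1) div 2) x = quad_char CARD('k) x"
proof (cases "x = 0")
  case False
  interpret F: odd_finite_subfield "UNIV :: 'k set" "CARD('k)" by (rule odd_finite_subfield_UNIV[OF odd])
  have \<phi>: "\<phi> \<in> mult_chars" using gen by (simp add: char_generator_def)
  have ne: "(-1 :: 'k) \<noteq> 1" using F.two_neq_0 by (metis add.left_inverse one_add_one)
  have "\<phi> (-1) ^ 2 = 1" using mult_chars_power[OF \<phi>, of "-1" 2] mult_charsD(2)[OF \<phi>] by simp
  moreover have "\<phi> (-1) \<noteq> 1" using char_generator_faithful[OF gen, of "-1"] ne by auto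
  ultimately have m1: "\<phi> (-1) = -1" by (simp add: power2_eq_1_iff)
  have "char_pow \<phi> ((CARD('k) - 1) div 2) x = \<phi> (x ^ ((CARD('k) - 1) div 2))"
    using False by (simp add: char_pow_def mult_chars_power[OF \<phi>])
  thus ?thesis using F.half_pow[of x] False m1 mult_charsD(2)[OF \<phi>] ne by (auto simp: quad_char_def)
qed (simp add: char_pow_def)

text \<open>
  The quadratic character of the extension is the one of the base field composed with the norm.
\<close>

lemma lifted_quartic_char:
  fixes \<iota> :: "'k::{finite,field} \<Rightarrow> 'l::{finite,field}"
  assumes e: "field_embedding \<iota>" and card: "CARD('l) = CARD('k) ^ r" and r: "r \<ge> 1"
    and gen: "char_generator \<phi>" and q4: "4 dvd CARD('k) - 1"
  shows "char_lift \<iota> r (char_of_order \<phi> 4) \<in> mult_chars"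
    and "char_lift \<iota> r (char_of_order \<phi> 4) x ^ 2 = quad_char CARD('l) x"
proof -
  interpret k: field_one_mod_four "TYPE('k)" by unfold_locales (rule q4)
  have \<phi>: "\<phi> \<in> mult_chars" using gen by (simp add: char_generator_def)
  show "char_lift \<iota> r (char_of_order \<phi> 4) \<in> mult_chars"
    unfolding char_of_order_def by (intro char_lift_in[OF e card r] char_pow_in \<phi>)
  have half: "(CARD('k) - Suc 0) div 4 * 2 = (CARD('k) - Suc 0) div 2" using q4 by auto
  have "char_lift \<iota> r (char_of_order \<phi> 4) x ^ 2 = char_pow \<phi> ((CARD('k) - 1) div 2) (ext_norm \<iota> r x)"
    by (simp add: char_lift_def char_of_order_def char_pow_def half flip: power_mult)
  also have "\<dots> = quad_char CARD('k) (ext_norm \<iota> r x)" by (rule generator_power_eq_quad_char[OF gen k.odd_card])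
  also have "\<dots> = quad_char CARD('k) (\<iota> (ext_norm \<iota> r x))" by (rule quad_char_embedding[OF e, symmetric])
  also have "\<dots> = quad_char CARD('l) x"
    unfolding ext_norm_embedded[OF e card] card by (rule quad_char_norm[OF k.odd_card r])
  finally show "char_lift \<iota> r (char_of_order \<phi> 4) x ^ 2 = quad_char CARD('l) x" .
qed

text \<open>
  The lift of \<open>\<phi>\<^sub>4\<close> to the extension is again a character whose square is the quadratic
  character, so the results on \<open>quartic_gauss\<close> apply over the extension.
\<close>

lemma F_w_red_eq_k3_sum:
  fixes \<iota> :: "'k::{finite,field} \<Rightarrow> 'l::{finite,field}"
  assumes e: "field_embedding \<iota>" and card: "CARD('l) = CARD('k) ^ r" and r: "r \<ge> 1"
    and gen: "char_generator \<phi>" and q4: "4 dvd CARD('k) - 1" and lam: "lam \<noteq> 0"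
    and m: "m \<in> {1, 2, 3}" and \<psi>: "nontrivial_add_char \<psi>"
  shows "F_w_red \<iota> r \<psi> \<phi> m lam = of_nat CARD('l) * field_one_mod_four.k3_sum (\<iota> (1 / lam ^ 4)) /
     gauss_sum \<psi> (char_pow (char_lift \<iota> r (char_of_order \<phi> 4)) m) ^ 4"
    and "gauss_sum \<psi> (char_pow (char_lift \<iota> r (char_of_order \<phi> 4)) m) ^ 4 = of_nat CARD('l) *
      (if m = 2 then of_nat CARD('l) else field_one_mod_four.jac (char_pow (char_lift \<iota> r (char_of_order \<phi> 4)) m)
         (char_pow (char_lift \<iota> r (char_of_order \<phi> 4)) m) ^ 2)"
proof -
  have "4 dvd CARD('l) - 1" unfolding card using q4 by (intro four_dvd_power_minus_1) auto
  then interpret l: field_one_mod_four "TYPE('l)" by unfold_locales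
  interpret A: quartic_gauss "TYPE('l)" \<psi> "char_lift \<iota> r (char_of_order \<phi> 4)"
    by unfold_locales (use \<psi> lifted_quartic_char[OF e card r gen q4] in auto)
  have "\<iota> lam \<noteq> 0" using field_embeddingD(7)[OF e, of lam 0] field_embeddingD(2)[OF e] lam by simp
  thus "F_w_red \<iota> r \<psi> \<phi> m lam = of_nat CARD('l) * l.k3_sum (\<iota> (1 / lam ^ 4)) /
     gauss_sum \<psi> (char_pow (char_lift \<iota> r (char_of_order \<phi> 4)) m) ^ 4"
    using A.hyp_F_eq_k3_sum[OF m, of "\<iota> lam"]
    by (simp add: F_w_red_def char_lift_triv[OF e card r] field_embeddingD[OF e])
  show "gauss_sum \<psi> (char_pow (char_lift \<iota> r (char_of_order \<phi> 4)) m) ^ 4 = of_nat CARD('l) *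
      (if m = 2 then of_nat CARD('l) else l.jac (char_pow (char_lift \<iota> r (char_of_order \<phi> 4)) m)
         (char_pow (char_lift \<iota> r (char_of_order \<phi> 4)) m) ^ 2)"
    using A.g_qc_4 A.g_odd_4[of m] m by (auto simp: power2_eq_square)
qed

lemma to_ac_embedding: "field_embedding (to_ac :: 'l::field \<Rightarrow> 'l alg_closure)"
  by (simp add: field_embedding_def)

lemma closure_frobenius:
  fixes \<iota> :: "'k::{finite,field} \<Rightarrow> 'a::alg_closed_field"
  assumes e: "field_embedding \<iota>" and q4: "4 dvd CARD('k) - 1"
  shows "frobenius_field_one_mod_four TYPE('a) CARD('k)"
    and "frobenius_field.fixed CARD('k) 1 = range \<iota>"
proof -
  interpret K: frobenius_field "TYPE('a)" "CARD('k)" by (rule frobenius_field_embedding[OF e])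
  interpret R: finite_subfield "range \<iota>" "CARD('k)" by (rule embedding_range_subfield[OF e])
  show fixed: "K.fixed 1 = range \<iota>" unfolding R.F_eq_fixed by (simp add: K.fixed_def)
  show "frobenius_field_one_mod_four TYPE('a) CARD('k)"
  proof unfold_locales
    show "card (K.fixed (Suc 0)) = CARD('k)" using fixed R.card_F by simp
  qed (rule q4)
qed

text \<open>
  The Hasse-Davenport relation for Jacobi sums. It is transported from \<open>jacobi_point_sum\<close> by
  embedding both finite fields in an algebraic closure of the larger one.
\<close>

lemma jac_lift:
  fixes \<iota> :: "'k::{finite,field} \<Rightarrow> 'l::{finite,field}"
  assumes e: "field_embedding \<iota>" and card: "CARD('l) = CARD('k) ^ r" and r: "r \<ge> 1"
    and q4: "4 dvd CARD('k) - 1" and \<chi>: "\<chi> \<in> mult_chars" "\<chi> \<noteq> triv_char"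
  shows "field_one_mod_four.jac (char_lift \<iota> r \<chi>) (char_lift \<iota> r \<chi>) = - ((- field_one_mod_four.jac \<chi> \<chi>) ^ r)"
proof -
  define q where "q = CARD('k)"
  define c :: "'l \<Rightarrow> 'l alg_closure" where "c = to_ac"
  define f where "f = c \<circ> \<iota>"
  have ec: "field_embedding c" unfolding c_def by (rule to_ac_embedding)
  have ef: "field_embedding f" using e ec by (simp add: f_def field_embedding_def)
  interpret k: field_one_mod_four "TYPE('k)" by unfold_locales (rule q4)
  have "4 dvd CARD('l) - 1" unfolding card using q4 by (intro four_dvd_power_minus_1) auto
  then interpret l: field_one_mod_four "TYPE('l)" by unfold_locales
  interpret K: frobenius_field_one_mod_four "TYPE('l alg_closure)" q
    unfolding q_def by (rule closure_frobenius(1)[OF ef q4])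
  have fix1: "K.fixed (Suc 0) = range f" using closure_frobenius(2)[OF ef q4] by (simp add: q_def)
  interpret C: finite_subfield "range c" "CARD('l)" by (rule embedding_range_subfield[OF ec])
  have fixr: "K.fixed r = range c" unfolding C.F_eq_fixed K.fixed_def by (simp only: card q_def)
  have injf: "inj f" by (rule injI) (simp add: field_embeddingD[OF ef])
  have injc: "inj c" by (rule injI) (simp add: field_embeddingD[OF ec])
  define ch where "ch = (\<lambda>y. \<chi> (inv_into UNIV f y))"
  have ch_f: "ch (f a) = \<chi> a" for a by (simp add: ch_def inv_f_f[OF injf])
  have mult: "ch (x * y) = ch x * ch y" if xy: "x \<in> K.fixed (Suc 0)" "y \<in> K.fixed (Suc 0)" for x y
  proof -
    obtain a b where "x = f a" "y = f b" using xy unfolding fix1 by auto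
    thus ?thesis by (simp add: ch_f mult_charsD[OF \<chi>(1)] flip: field_embeddingD(4)[OF ef])
  qed
  have one: "ch 1 = 1" using ch_f[of 1] by (simp add: field_embeddingD[OF ef] mult_charsD[OF \<chi>(1)])
  have sumf: "(\<Sum>x\<in>K.fixed (Suc 0). h x) = (\<Sum>a\<in>UNIV. h (f a))" for h :: "'l alg_closure \<Rightarrow> complex"
    unfolding fix1 by (rule sum.reindex[unfolded o_def, OF injf])
  have nontriv: "(\<Sum>x\<in>K.fixed (Suc 0). ch x) = 0"
    unfolding sumf ch_f by (rule sum_nontrivial_char[OF \<chi>])
  have "(\<Sum>x\<in>K.fixed r. ch (\<Prod>i<r. (x * (1 - x)) ^ (q ^ i))) =
        - ((- (\<Sum>x\<in>K.fixed (Suc 0). ch (x * (1 - x)))) ^ r)"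
    by (rule K.jacobi_point_sum[OF mult one nontriv r])
  also have "(\<Sum>x\<in>K.fixed (Suc 0). ch (x * (1 - x))) = k.jac \<chi> \<chi>"
    unfolding sumf k.jac_def
  proof (intro sum.cong refl)
    fix a
    have "f a * (1 - f a) = f (a * (1 - a))" by (simp add: field_embeddingD[OF ef])
    thus "ch (f a * (1 - f a)) = \<chi> a * \<chi> (1 - a)" by (simp add: ch_f mult_charsD[OF \<chi>(1)])
  qed
  also have "(\<Sum>x\<in>K.fixed r. ch (\<Prod>i<r. (x * (1 - x)) ^ (q ^ i))) =
     (\<Sum>y\<in>UNIV. ch (\<Prod>i<r. (c y * (1 - c y)) ^ (q ^ i)))"
    unfolding fixr by (rule sum.reindex[unfolded o_def, OF injc])
  also have "\<dots> = l.jac (char_lift \<iota> r \<chi>) (char_lift \<iota> r \<chi>)"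
    unfolding l.jac_def
  proof (intro sum.cong refl)
    fix y
    have "(\<Prod>i<r. (c y * (1 - c y)) ^ (q ^ i)) = c (\<Prod>i<r. (y * (1 - y)) ^ (q ^ i))"
      by (simp add: c_def to_ac_prod)
    also have "\<dots> = f (ext_norm \<iota> r (y * (1 - y)))"
      by (simp add: f_def ext_norm_embedded[OF e card] q_def)
    finally show "ch (\<Prod>i<r. (c y * (1 - c y)) ^ (q ^ i)) = char_lift \<iota> r \<chi> y * char_lift \<iota> r \<chi> (1 - y)"
      by (simp add: ch_f char_lift_def ext_norm_mult[OF e card] mult_charsD[OF \<chi>(1)])
  qed
  finally show ?thesis .
qed

section \<open>Frobenius eigenvalues of the K3 sum\<close>

text \<open>
  Let \<open>s\<^sup>2 = 1 - t\<close> in an algebraic closure. If \<open>s\<close> lies in the base field, then \<open>K = S\<^sup>2 - Q\<close>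
  over the base field and over the extension, and \<open>S = - (\<alpha>\<^sup>r + \<beta>\<^sup>r)\<close> gives \<open>K = \<alpha>\<^sup>2\<^sup>r + \<beta>\<^sup>2\<^sup>r + q\<^sup>r\<close>;
  so \<open>a = \<alpha>\<^sup>2 / q\<close> and \<open>b = \<beta>\<^sup>2 / q\<close>. Otherwise the elliptic curve is defined over the field with
  \<open>q\<^sup>2\<close> elements only. Let \<open>\<alpha>\<close>, \<open>\<beta>\<close> be its eigenvalues over that field, with \<open>\<alpha> \<beta> = q\<^sup>2\<close>, and
  \<open>\<epsilon> = \<chi>(2)\<close> in the base field. For even \<open>r\<close> the root \<open>s\<close> lies in the extension, which has
  degree \<open>r / 2\<close> over the field with \<open>q\<^sup>2\<close> elements; for odd \<open>r\<close> it does not, and the relevant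
  field has degree \<open>r\<close> over it. In both cases \<open>K = \<epsilon>\<^sup>r (\<alpha>\<^sup>r + \<beta>\<^sup>r) + (- q)\<^sup>r\<close>, so \<open>a = \<epsilon> \<alpha> / q\<close> and
  \<open>b = \<epsilon> \<beta> / q\<close>.
\<close>

lemma k3_sum_eigenvalues:
  fixes \<iota> :: "'k::{finite,field} \<Rightarrow> 'l::{finite,field}"
  assumes e: "field_embedding \<iota>" and card: "CARD('l) = CARD('k) ^ r" and r: "r \<ge> 1"
    and q4: "4 dvd CARD('k) - 1" and t: "t \<noteq> 0" "t \<noteq> 1"
  shows "\<exists>a b :: complex. a * b = 1 \<and>
     field_one_mod_four.k3_sum t = of_nat CARD('k) * (quad_char CARD('k) (1 - t) + (a + b)) \<and>
     field_one_mod_four.k3_sum (\<iota> t) = of_nat CARD('l) * (quad_char CARD('k) (1 - t) ^ r + (a ^ r + b ^ r))"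
proof -
  define q where "q = CARD('k)"
  define c :: "'l \<Rightarrow> 'l alg_closure" where "c = to_ac"
  define f where "f = c \<circ> \<iota>"
  have ec: "field_embedding c" unfolding c_def by (rule to_ac_embedding)
  have ef: "field_embedding f" using e ec by (simp add: f_def field_embedding_def)
  interpret k: field_one_mod_four "TYPE('k)" by unfold_locales (rule q4)
  have l4: "4 dvd CARD('l) - 1" unfolding card using q4 by (intro four_dvd_power_minus_1) auto
  then interpret l: field_one_mod_four "TYPE('l)" by unfold_locales
  interpret K: frobenius_field_one_mod_four "TYPE('l alg_closure)" q
    unfolding q_def by (rule closure_frobenius(1)[OF ef q4])
  have q0: "(of_nat q :: complex) \<noteq> 0" using K.q_ge_2 by simp
  have Q: "CARD('l) = q ^ r" by (simp add: card q_def)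
  have it: "\<iota> t \<noteq> 0" "\<iota> t \<noteq> 1"
    using field_embeddingD(7)[OF e, of t 0] field_embeddingD(7)[OF e, of t 1] field_embeddingD(1,2)[OF e] t by auto
  obtain s where s: "s ^ 2 = 1 - f t" using nth_root_exists[of 2 "1 - f t"] by auto
  have s': "s ^ 2 = 1 - c (\<iota> t)" using s by (simp add: f_def)
  have ft: "f t \<noteq> 0" "f t \<noteq> 1"
    using field_embeddingD(7)[OF ef, of t 0] field_embeddingD(7)[OF ef, of t 1] field_embeddingD(1,2)[OF ef] t by auto
  have s0: "s \<noteq> 0" using s ft by auto
  have two: "(2 :: 'l alg_closure) \<noteq> 0" by (rule K.F.two_neq_0)
  define u where "u = (1 - s) / 2"
  have u: "u \<noteq> 0" "u \<noteq> 1"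
  proof -
    show "u \<noteq> 0" using s ft two by (auto simp: u_def)
    show "u \<noteq> 1"
    proof
      assume "u = 1"
      hence "1 - s = 2" using two by (simp add: u_def)
      hence "s = 1 - 2" by (metis diff_diff_eq2 add_diff_cancel_left' diff_add_cancel)
      hence "s = -1" by simp
      thus False using s ft by simp
    qed
  qed
  have "(s ^ q) ^ 2 = s ^ 2"
  proof -
    have "f (1 - t) ^ q = f (1 - t)"
      using finite_subfield.power_card[OF embedding_range_subfield[OF ef], of "f (1 - t)"] by (simp add: q_def)
    moreover have "s ^ 2 = f (1 - t)" using s by (simp add: field_embeddingD[OF ef])
    ultimately show ?thesis by (metis mult.commute power_mult)
  qed
  hence sq: "s ^ q = s \<or> s ^ q = - s" by (simp add: power2_eq_iff)
  have \<kappa>: "quad_char q (1 - t) = (if s ^ q = s then 1 else -1)"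
  proof -
    obtain n where n: "q = Suc (2 * n)" using k.odd_card by (metis oddE Suc_eq_plus1 q_def)
    have "quad_char q (1 - t) = quad_char q (s ^ 2)"
      using quad_char_embedding[OF ef, of q "1 - t"] s by (simp add: field_embeddingD[OF ef])
    also have "\<dots> = (if s ^ (2 * n) = 1 then 1 else -1)" using s0 by (simp add: quad_char_def n power_mult)
    also have "s ^ (2 * n) = 1 \<longleftrightarrow> s ^ q = s" using s0 by (simp add: n)
    finally show ?thesis .
  qed
  have fixed_pow: "z ^ (q ^ i) = z" if "z ^ q = z" for z :: "'l alg_closure" and i
    by (induction i) (simp_all add: that power_mult mult.commute[of q])
  consider "s ^ q = s" | "s ^ q = - s" "s ^ q \<noteq> s" using sq by blast
  thus ?thesis
  proof cases
    case 1
    have "u \<in> K.fixed (Suc 0)"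
      using 1 K.frob_pow_diff[of 1 s 1] K.F.numeral_in[of "num.Bit0 num.One"]
      by (simp add: u_def K.fixed_def power_divide)
    then obtain \<alpha> \<beta> where ab: "\<alpha> * \<beta> = of_nat q"
      and S: "\<And>r. r \<ge> 1 \<Longrightarrow> (\<Sum>x\<in>K.fixed r. quad_char (q ^ r) (x * (x ^ 2 - 2 * x + u))) = - (\<alpha> ^ r + \<beta> ^ r)"
      using K.cubic_point_sum[of u] u by blast
    have "k.k3_sum t = (- (\<alpha> ^ 1 + \<beta> ^ 1)) ^ 2 - of_nat q"
      using k3_sum_closure(1)[OF q4 ef t s] 1 S[of 1] by (simp add: q_def[symmetric] K.fixed_def u_def)
    also have "\<dots> = \<alpha> ^ 2 + \<beta> ^ 2 + of_nat q"
      using ab by (simp add: power2_eq_square algebra_simps)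
    finally have k1: "k.k3_sum t = \<alpha> ^ 2 + \<beta> ^ 2 + of_nat q" .
    have "l.k3_sum (\<iota> t) = (- (\<alpha> ^ r + \<beta> ^ r)) ^ 2 - of_nat (q ^ r)"
      using k3_sum_closure(1)[OF l4 ec it s'] fixed_pow[OF 1] S[OF r] by (simp add: Q K.fixed_def u_def)
    also have "\<dots> = (\<alpha> ^ 2) ^ r + (\<beta> ^ 2) ^ r + 2 * (\<alpha> * \<beta>) ^ r - of_nat q ^ r"
      by (simp add: power2_eq_square algebra_simps power_mult_distrib)
    finally have kr: "l.k3_sum (\<iota> t) = (\<alpha> ^ 2) ^ r + (\<beta> ^ 2) ^ r + of_nat q ^ r" by (simp add: ab)
    have "\<alpha> ^ 2 / of_nat q * (\<beta> ^ 2 / of_nat q) = (\<alpha> * \<beta>) ^ 2 / of_nat q ^ 2"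
      by (simp add: power_mult_distrib power2_eq_square)
    hence "\<alpha> ^ 2 / of_nat q * (\<beta> ^ 2 / of_nat q) = 1" using q0 by (simp add: ab)
    moreover have "k.k3_sum t = of_nat q * (quad_char q (1 - t) + (\<alpha> ^ 2 / of_nat q + \<beta> ^ 2 / of_nat q))"
      using q0 1 by (simp add: k1 \<kappa> distrib_left)
    moreover have "l.k3_sum (\<iota> t) = of_nat (q ^ r) * (quad_char q (1 - t) ^ r + ((\<alpha> ^ 2 / of_nat q) ^ r + (\<beta> ^ 2 / of_nat q) ^ r))"
      using q0 1 by (simp add: kr \<kappa> distrib_left power_divide)
    ultimately show ?thesis unfolding Q q_def[symmetric] by blast
  next
    case 2
    define \<epsilon> :: complex where "\<epsilon> = quad_char q (2::'l alg_closure)"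
    have \<epsilon>2: "\<epsilon> * \<epsilon> = 1" unfolding \<epsilon>_def by (rule quad_char_self_mult[OF two])
    have two_fixed: "(2 :: 'l alg_closure) ^ q = 2" using K.F.numeral_in[of "num.Bit0 num.One"] by (simp add: K.fixed_def)
    have sq2: "s ^ (q ^ 2) = s"
    proof -
      have "s ^ (q ^ 2) = (s ^ q) ^ q" by (simp add: power2_eq_square power_mult)
      thus ?thesis using 2(1) K.frob_uminus by simp
    qed
    have s_even: "s ^ (q ^ (2 * j)) = s" for j
    proof (induction j)
      case (Suc j)
      have "s ^ (q ^ (2 * Suc j)) = (s ^ (q ^ 2)) ^ (q ^ (2 * j))"
        by (simp add: power_add power2_eq_square mult.assoc flip: power_mult)
      thus ?case using Suc sq2 by simp
    qed simp
    have q2: "q ^ 2 \<ge> 2" using K.q_ge_2 power_mono[of 2 q 2] by simp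
    interpret K2: frobenius_field "TYPE('l alg_closure)" "q ^ 2"
      by unfold_locales (use q2 K.frob_pow_add in auto)
    have fixed2: "K2.fixed j = K.fixed (2 * j)" for j
      by (simp add: K2.fixed_def K.fixed_def power_mult)
    have "card (K.fixed 2) = q ^ 2"
      by (rule K.card_fixed_power) (use of_nat_card_eq_0[OF ef] in \<open>simp_all add: q_def\<close>)
    hence card2: "card (K2.fixed 1) = q ^ 2" by (simp add: fixed2)
    interpret K2: frobenius_field_one_mod_four "TYPE('l alg_closure)" "q ^ 2"
    proof unfold_locales
      show "card (K2.fixed (Suc 0)) = q ^ 2" using card2 by simp
      show "4 dvd q ^ 2 - 1" using K.four_dvd_q K.q_ge_2 by (intro four_dvd_power_minus_1) auto
    qed
    have "u \<in> K2.fixed (Suc 0)"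
      using sq2 K.frob_pow_diff[of 1 s 2] fixed_pow[OF two_fixed, of 2]
      by (simp add: u_def K2.fixed_def power_divide)
    then obtain \<alpha> \<beta> where ab: "\<alpha> * \<beta> = of_nat (q ^ 2)"
      and S: "\<And>r. r \<ge> 1 \<Longrightarrow> (\<Sum>x\<in>K2.fixed r. quad_char ((q ^ 2) ^ r) (x * (x ^ 2 - 2 * x + u))) = - (\<alpha> ^ r + \<beta> ^ r)"
      using K2.cubic_point_sum[of u] u by blast
    have \<epsilon>k: "quad_char q (2::'k) = \<epsilon>"
      using quad_char_embedding[OF ef, of q 2] field_embeddingD(11)[OF ef] by (simp add: \<epsilon>_def)
    have "k.k3_sum t = - quad_char q (2::'k) * (- (\<alpha> ^ 1 + \<beta> ^ 1)) - of_nat q"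
      using k3_sum_closure(2)[OF q4 ef t s] 2 S[of 1] by (simp add: q_def[symmetric] K2.fixed_def u_def)
    hence k1: "k.k3_sum t = \<epsilon> * (\<alpha> + \<beta>) - of_nat q" by (simp add: \<epsilon>k algebra_simps)
    have kr: "l.k3_sum (\<iota> t) = \<epsilon> ^ r * (\<alpha> ^ r + \<beta> ^ r) + (- 1) ^ r * of_nat q ^ r"
    proof (cases "even r")
      case True
      then obtain j where j: "r = 2 * j" by auto
      have j1: "j \<ge> 1" using r j by auto
      have eps1: "\<epsilon> ^ r = 1" using \<epsilon>2 by (simp add: j power_mult power2_eq_square)
      have "s ^ CARD('l) = s" using s_even by (simp add: Q j)
      hence "l.k3_sum (\<iota> t) = (- (\<alpha> ^ j + \<beta> ^ j)) ^ 2 - of_nat (q ^ r)"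
        using k3_sum_closure(1)[OF l4 ec it s'] S[OF j1]
        by (simp add: Q K2.fixed_def u_def j power_mult)
      also have "\<dots> = (\<alpha> ^ j) ^ 2 + (\<beta> ^ j) ^ 2 + 2 * (\<alpha> * \<beta>) ^ j - of_nat q ^ r"
        by (simp add: power2_eq_square algebra_simps power_mult_distrib)
      also have "\<dots> = \<alpha> ^ r + \<beta> ^ r + of_nat q ^ r"
        by (simp add: ab j power_mult mult.commute flip: power_mult)
      finally show ?thesis using True eps1 by simp
    next
      case False
      then obtain j where j: "r = Suc (2 * j)" by (metis oddE Suc_eq_plus1)
      have "s ^ CARD('l) = (s ^ (q ^ (2 * j))) ^ q" by (simp only: Q j power_Suc2 power_mult)
      hence sl: "s ^ CARD('l) = - s" using s_even 2(1) by simp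
      have pow2: "quad_char q ((2::'l alg_closure) ^ n) = \<epsilon> ^ n" for n
        by (induction n) (simp_all add: \<epsilon>_def K.F.quad_char_mult K.F.numeral_in K.F.power_in)
      have "quad_char CARD('l) (2::'l) = quad_char (q ^ r) (2 :: 'l alg_closure)"
        using quad_char_embedding[OF ec, of "CARD('l)" 2] field_embeddingD(11)[OF ec] by (simp add: Q)
      also have "\<dots> = quad_char q (\<Prod>i<r. (2 :: 'l alg_closure) ^ (q ^ i))"
        by (rule quad_char_norm[OF K.odd_q r, symmetric])
      also have "\<dots> = \<epsilon> ^ r" by (simp add: fixed_pow[OF two_fixed] pow2)
      finally have e2: "quad_char CARD('l) (2::'l) = \<epsilon> ^ r" .
      have QQ: "CARD('l) ^ 2 = (q ^ 2) ^ r" by (simp add: Q mult.commute flip: power_mult)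
      have "l.k3_sum (\<iota> t) = - (\<epsilon> ^ r) * (- (\<alpha> ^ r + \<beta> ^ r)) - of_nat CARD('l)"
        using k3_sum_closure(2)[OF l4 ec it s' sl] S[OF r] unfolding e2 QQ
        by (simp add: K2.fixed_def u_def)
      thus ?thesis using False by (simp add: Q algebra_simps)
    qed
    have "\<epsilon> * \<alpha> / of_nat q * (\<epsilon> * \<beta> / of_nat q) = (\<epsilon> * \<epsilon>) * (\<alpha> * \<beta>) / of_nat q ^ 2"
      by (simp add: power2_eq_square)
    hence "\<epsilon> * \<alpha> / of_nat q * (\<epsilon> * \<beta> / of_nat q) = 1" using q0 by (simp add: ab \<epsilon>2)
    moreover have "k.k3_sum t = of_nat q * (quad_char q (1 - t) + (\<epsilon> * \<alpha> / of_nat q + \<epsilon> * \<beta> / of_nat q))"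
      using q0 2 by (simp add: k1 \<kappa> distrib_left right_diff_distrib)
    moreover have "l.k3_sum (\<iota> t) = of_nat (q ^ r) * (quad_char q (1 - t) ^ r + ((\<epsilon> * \<alpha> / of_nat q) ^ r + (\<epsilon> * \<beta> / of_nat q) ^ r))"
      using q0 2 by (simp add: kr \<kappa> distrib_left right_diff_distrib power_divide power_mult_distrib)
    ultimately show ?thesis unfolding Q q_def[symmetric] by blast
  qed
qed

lemma power_sum_poly: "eval2 (power_sum_poly r) (a + b) (a * b) = a ^ r + b ^ r"
  using theI'[OF power_sum_poly_ex1[of r]] unfolding power_sum_poly_def by blast

text \<open>
  For odd \<open>m\<close> the square of the character is the quadratic character, and for \<open>m = 2\<close> the
  character itself is.
\<close>

lemma jacobi_w_eq:
  fixes \<phi> :: "'k::{finite,field} \<Rightarrow> complex"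
  assumes q4: "4 dvd CARD('k) - 1" and gen: "char_generator \<phi>" and m: "m \<in> {1, 2, 3}"
  shows "jacobi_w \<phi> m = (if m = 2 then of_nat CARD('k) else
     field_one_mod_four.jac (char_pow (char_of_order \<phi> 4) m) (char_pow (char_of_order \<phi> 4) m) ^ 2)"
proof -
  interpret k: field_one_mod_four "TYPE('k)" by unfold_locales (rule q4)
  define A where "A = char_of_order \<phi> 4"
  have id: "CARD('k) = CARD('k) ^ 1" by simp
  have A: "A \<in> mult_chars" and A_sq: "A x ^ 2 = k.qc x" for x
    using lifted_quartic_char[OF field_embedding_id id _ gen q4] char_lift_id[of A] by (simp_all add: A_def)
  show ?thesis
  proof (cases "m = 2")
    case True
    have "char_pow A m = k.qc" using True by (simp add: char_pow_def fun_eq_iff A_sq)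
    thus ?thesis using True k.jacobi_sum_quad_char by (simp add: jacobi_w_def A_def Let_def)
  next
    case False
    have "char_mult (char_pow A m) (char_pow A m) x = k.qc x" for x
    proof (cases "x = 0")
      case nz: False
      have "char_mult (char_pow A m) (char_pow A m) x = (A x ^ 2) ^ m"
        using nz by (simp add: char_mult_def char_pow_def mult.commute flip: power_mult power_add mult_2)
      also have "\<dots> = k.qc x" using m False k.qc_self[OF nz] by (auto simp: A_sq power3_eq_cube)
      finally show ?thesis .
    qed (simp add: char_mult_def char_pow_def)
    hence "char_mult (char_pow A m) (char_pow A m) = k.qc" by blast
    thus ?thesis using False k.jacobi_sum_square_root[OF char_pow_in[OF A]]
      by (simp add: jacobi_w_def A_def Let_def)
  qed
qed

theorem theorem4p8:
  fixes \<iota> :: "'k::{finite,field} \<Rightarrow> 'l::{finite,field}"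
    and \<phi> :: "'k \<Rightarrow> complex"
    and \<psi>\<^sub>1 :: "'k \<Rightarrow> complex" and \<psi>\<^sub>r :: "'l \<Rightarrow> complex"
    and lam :: 'k
    and q r m :: nat
  assumes "q = CARD('k)" and "4 dvd q - 1"
    and "char_generator \<phi>"
    and "lam \<noteq> 0" and "lam ^ 4 \<noteq> 1"
    and "m \<in> {1, 2, 3}"
    and "r \<ge> 1" and "field_embedding \<iota>" and "CARD('l) = q ^ r"
    and "nontrivial_add_char \<psi>\<^sub>1" and "nontrivial_add_char \<psi>\<^sub>r"
  shows "F_w_red \<iota> r \<psi>\<^sub>r \<phi> m lam =
      (char_of_order \<phi> 2 (1 - lam ^ 4) * of_nat q / jacobi_w \<phi> m) ^ r
      + eval2 (power_sum_poly r)
          (F_w_red id 1 \<psi>\<^sub>1 \<phi> m lam - char_of_order \<phi> 2 (1 - lam ^ 4) * of_nat q / jacobi_w \<phi> m)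
          ((of_nat q / jacobi_w \<phi> m) ^ 2)"
proof -
  note q = assms(1) and gen = assms(3) and lam = assms(4,5) and m = assms(6) and r = assms(7) and e = assms(8)
  have q4: "4 dvd CARD('k) - 1" using assms(1,2) by simp
  have card: "CARD('l) = CARD('k) ^ r" using assms(1,9) by simp
  have card1: "CARD('k) = CARD('k) ^ 1" by simp
  have l4: "4 dvd CARD('l) - 1" unfolding card using q4 by (intro four_dvd_power_minus_1) auto
  interpret k: field_one_mod_four "TYPE('k)" by unfold_locales (rule q4)
  interpret l: field_one_mod_four "TYPE('l)" by unfold_locales (rule l4)
  define A where "A = char_of_order \<phi> 4"
  define \<chi> where "\<chi> = char_pow A m"
  define t where "t = 1 / lam ^ 4"
  define j where "j = jacobi_w \<phi> m"
  define \<kappa> where "\<kappa> = quad_char q (1 - t)"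
  have t: "t \<noteq> 0" "t \<noteq> 1" using lam by (simp_all add: t_def)
  have qne: "(of_nat CARD('k) :: complex) \<noteq> 0" "(of_nat CARD('l) :: complex) \<noteq> 0" by simp_all
  have \<phi>: "\<phi> \<in> mult_chars" using gen by (simp add: char_generator_def)
  have \<chi>_in: "\<chi> \<in> mult_chars" unfolding \<chi>_def A_def char_of_order_def by (intro char_pow_in \<phi>)

  \<comment> \<open>The quotient of \<open>1 - \<lambda>\<^sup>4\<close> by \<open>1 - t\<close> is \<open>- \<lambda>\<^sup>4\<close>, a square because \<open>-1\<close> is one.\<close>
  have kappa: "char_of_order \<phi> 2 (1 - lam ^ 4) = \<kappa>"
  proof -
    have "1 - lam ^ 4 = (lam ^ 2) ^ 2 * (- (1 - t))" using lam by (simp add: t_def algebra_simps flip: power_mult)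
    hence "k.qc (1 - lam ^ 4) = k.qc (- (1 - t))" by (rule k.qc_eqI) (use lam in simp)
    thus ?thesis unfolding char_of_order_def generator_power_eq_quad_char[OF gen k.odd_card] k.qc_minus
      by (simp add: \<kappa>_def q)
  qed

  have F1: "F_w_red id 1 \<psi>\<^sub>1 \<phi> m lam = of_nat CARD('k) * k.k3_sum t / gauss_sum \<psi>\<^sub>1 \<chi> ^ 4"
    and g1: "gauss_sum \<psi>\<^sub>1 \<chi> ^ 4 = of_nat CARD('k) * j"
    using F_w_red_eq_k3_sum[OF field_embedding_id card1 _ gen q4 lam(1) m assms(10)]
      jacobi_w_eq[OF q4 gen m] char_lift_id[of A]
    by (simp_all add: A_def \<chi>_def t_def j_def)
  have Fr: "F_w_red \<iota> r \<psi>\<^sub>r \<phi> m lam = of_nat CARD('l) * l.k3_sum (\<iota> t) / gauss_sum \<psi>\<^sub>r (char_lift \<iota> r \<chi>) ^ 4"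
    and gr: "gauss_sum \<psi>\<^sub>r (char_lift \<iota> r \<chi>) ^ 4 = of_nat CARD('l) *
      (if m = 2 then of_nat CARD('l) else l.jac (char_lift \<iota> r \<chi>) (char_lift \<iota> r \<chi>) ^ 2)"
    using F_w_red_eq_k3_sum[OF e card r gen q4 lam(1) m assms(11)]
    by (simp_all add: A_def \<chi>_def t_def char_lift_pow[OF e card r])
  \<comment> \<open>The fourth power of the Gauss sum is an even function of the Jacobi sum, so the sign in the
     Hasse-Davenport relation disappears.\<close>
  have jr: "gauss_sum \<psi>\<^sub>r (char_lift \<iota> r \<chi>) ^ 4 = of_nat CARD('l) * j ^ r"
  proof (cases "m = 2")
    case True
    thus ?thesis using jacobi_w_eq[OF q4 gen m] by (simp add: gr j_def card)
  next
    case False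
    have "\<chi> \<noteq> triv_char"
    proof
      assume tr: "\<chi> = triv_char"
      obtain n :: 'k where n: "n \<noteq> 0" "k.qc n \<noteq> 1"
        using k.ex_nonresidue by (auto simp: quad_char_def)
      have "A n ^ m = 1" using fun_cong[OF tr, of n] n by (simp add: \<chi>_def char_pow_def triv_char_def)
      moreover have "(A n ^ m) ^ 2 = (A n ^ 2) ^ m" by (simp add: mult.commute flip: power_mult)
      moreover have "A n ^ 2 = k.qc n"
        using lifted_quartic_char(2)[OF field_embedding_id card1 _ gen q4, of n] char_lift_id[of A] by (simp add: A_def)
      ultimately have "k.qc n ^ m = 1" by simp
      thus False using n m False k.qc_self[OF n(1)] by (auto simp: power3_eq_cube)
    qed
    hence "l.jac (char_lift \<iota> r \<chi>) (char_lift \<iota> r \<chi>) ^ 2 = ((- k.jac \<chi> \<chi>) ^ r) ^ 2"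
      using jac_lift[OF e card r q4 \<chi>_in] by simp
    also have "\<dots> = (k.jac \<chi> \<chi> ^ 2) ^ r" by (simp add: mult.commute flip: power_mult)
    also have "k.jac \<chi> \<chi> ^ 2 = j" using jacobi_w_eq[OF q4 gen m] False by (simp add: j_def \<chi>_def A_def)
    finally show ?thesis using False by (simp add: gr)
  qed

  obtain a b where ab: "a * b = 1"
    and k1: "k.k3_sum t = of_nat CARD('k) * (\<kappa> + (a + b))"
    and kr: "l.k3_sum (\<iota> t) = of_nat CARD('l) * (\<kappa> ^ r + (a ^ r + b ^ r))"
    using k3_sum_eigenvalues[OF e card r q4 t] unfolding \<kappa>_def q by blast
  define c where "c = of_nat q / j"
  have "F_w_red id 1 \<psi>\<^sub>1 \<phi> m lam = c * (\<kappa> + (a + b))"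
    unfolding F1 g1 k1 using qne by (simp add: c_def q)
  hence tr: "F_w_red id 1 \<psi>\<^sub>1 \<phi> m lam - \<kappa> * of_nat q / j = c * a + c * b"
    by (simp add: c_def algebra_simps add_divide_distrib)
  have det: "(of_nat q / j) ^ 2 = (c * a) * (c * b)"
    using ab by (simp add: c_def power2_eq_square mult_ac)
  have "F_w_red \<iota> r \<psi>\<^sub>r \<phi> m lam = of_nat CARD('l) / j ^ r * (\<kappa> ^ r + (a ^ r + b ^ r))"
    unfolding Fr jr kr using qne by simp
  also have "of_nat CARD('l) / j ^ r = c ^ r" by (simp add: c_def power_divide card q)
  also have "c ^ r * (\<kappa> ^ r + (a ^ r + b ^ r)) = (\<kappa> * of_nat q / j) ^ r + ((c * a) ^ r + (c * b) ^ r)"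
    by (simp add: c_def distrib_left power_mult_distrib power_divide)
  also have "(c * a) ^ r + (c * b) ^ r = eval2 (power_sum_poly r) (c * a + c * b) ((c * a) * (c * b))"
    by (rule power_sum_poly[symmetric])
  finally show ?thesis unfolding kappa j_def[symmetric] tr det .
qed

end
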